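(* Let $(\mathcal{A}',\mathcal{A},\mathcal{A}'',i^*,i_*,i^!,j_!,j^*,j_* )$ be a recollement of abelian categories. Then the following hold. (1) If $\mathcal{C}$ is an ICE-closed subcategory of $\mathcal{A}'$, then $i_*(\mathcal{C})$ is an ICE-closed subcategory of $\mathcal{A}$. (2) If $j_*$ (resp. $j_!$) is exact and $\mathcal{C}$ is an ICE-closed subcategory of $\mathcal{A}''$, then $j_*(\mathcal{C})$ (resp. $j_!(\mathcal{C})$) is an ICE-closed subcategory of $\mathcal{A}$. (3) The functor $j^*$ gives a bijection, $\mathcal{C}\mapsto j^*(\mathcal{C})$, from the set of ICE-closed subcategories $\mathcal{C}$ of $\mathcal{A}$ such that $i_*(\mathcal{A}')\subset\mathcal{C}$ and $j_!j^*(\mathcal{C})\subset\mathcal{C}$ onto the set of all ICE-closed subcategories of $\mathcal{A}''$. (4) If $\mathcal{C}$ is an ICE-closed subcategory of $\mathcal{A}$ with $i_*(\mathcal{A}')\subset\mathcal{C}$ and $j_!j^*(\mathcal{C})\subset\mathcal{C}$, then there is a new recollement of ICE-closed subcategories $(\mathcal{A}',\mathcal{C},j^*(\mathcal{C}),\overline{i^*},\overline{i_*},\overline{i^!},\overline{j_!},\overline{j^*},\overline{j_*})$, where the overlined functors are the restrictions of the original six functors.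
   Context: All subcategories are full and closed under isomorphisms; all functors between abelian categories are additive. For a functor $F$ and a subcategory $\mathcal{C}$ of its source, $F(\mathcal{C})$ denotes the essential image (objects isomorphic to $F(C)$ with $C\in\mathcal{C}$); $\mathrm{Im}\,F$ is the essential image of $F$ and $\mathrm{Ker}\,F$ is the full subcategory of objects sent to zero. A recollement $(\mathcal{A}',\mathcal{A},\mathcal{A}'',i^*,i_*,i^!,j_!,j^*,j_* )$ of abelian categories consists of abelian categories $\mathcal{A}',\mathcal{A},\mathcal{A}''$ and functors $i_*:\mathcal{A}'\to\mathcal{A}$, $i^*,i^!:\mathcal{A}\to\mathcal{A}'$, $j^*:\mathcal{A}\to\mathcal{A}''$, $j_!,j_*:\mathcal{A}''\to\mathcal{A}$ such that: (i) $(i^*,i_* )$, $(i_*,i^!)$, $(j_!,j^* )$, $(j^*,j_* )$ are adjoint pairs (left adjoint first); (ii) $i_*$, $j_!$, $j_*$ are fully faithful; (iii) $\mathrm{Ker}\,j^*=\mathrm{Im}\,i_*$. A subcategory $\mathcal{C}$ of an abelian category is ICE-closed if it is closed under images, cokernels and extensions: for every morphism $f:M\to N$ with $M,N\in\mathcal{C}$ one has $\mathrm{Im} f\in\mathcal{C}$ and $\mathrm{Coker} f\in\mathcal{C}$, and for every short exact sequence $0\to N_1\to N_2\to N_3\to 0$ with $N_1,N_3\in\mathcal{C}$ one has $N_2\in\mathcal{C}$. The empty subcategory, the zero subcategory and the entire category are all counted as ICE-closed subcategories. In (4), "recollement of ICE-closed subcategories" means that $j^*(\mathcal{C})$ is an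 ICE-closed subcategory of $\mathcal{A}''$, that the six functors restrict to functors $\overline{i_*}:\mathcal{A}'\to\mathcal{C}$, $\overline{i^*},\overline{i^!}:\mathcal{C}\to\mathcal{A}'$, $\overline{j^*}:\mathcal{C}\to j^*(\mathcal{C})$, $\overline{j_!},\overline{j_*}:j^*(\mathcal{C})\to\mathcal{C}$, and that these satisfy conditions (i)–(iii) above with $\mathcal{A}',\mathcal{C},j^*(\mathcal{C})$ in place of $\mathcal{A}',\mathcal{A},\mathcal{A}''$.
   Formalization: In (3) the bijection is onto the set of all nonempty ICE-closed subcategories of A''; the empty subcategory, counted as ICE-closed, is never j^*(C), since C contains i_*(A'), which contains a zero object. *)

theory Defs
  imports "HOL-Algebra.Group"
begin

section \<open>Categories\<close>

record ('o, 'm) category =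
  Ob :: "'o set"
  Arr :: "'m set"
  Dom :: "'m \<Rightarrow> 'o"
  Cod :: "'m \<Rightarrow> 'o"
  Ident :: "'o \<Rightarrow> 'm"
  Comp :: "'m \<Rightarrow> 'm \<Rightarrow> 'm"  (infixr \<open>\<cdot>\<index>\<close> 70)

definition Hom :: "('o, 'm, 'z) category_scheme \<Rightarrow> 'o \<Rightarrow> 'o \<Rightarrow> 'm set" where
  "Hom \<C> X Y = {f \<in> Arr \<C>. Dom \<C> f = X \<and> Cod \<C> f = Y}"

locale category =
  fixes \<C> :: "('o, 'm, 'z) category_scheme" (structure)
  assumes dom_in_Ob: "f \<in> Arr \<C> \<Longrightarrow> Dom \<C> f \<in> Ob \<C>"
    and cod_in_Ob: "f \<in> Arr \<C> \<Longrightarrow> Cod \<C> f \<in> Ob \<C>"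
    and ident_in_Hom: "X \<in> Ob \<C> \<Longrightarrow> Ident \<C> X \<in> Hom \<C> X X"
    and comp_in_Hom: "f \<in> Hom \<C> X Y \<Longrightarrow> g \<in> Hom \<C> Y Z \<Longrightarrow> g \<cdot> f \<in> Hom \<C> X Z"
    and ident_left: "f \<in> Hom \<C> X Y \<Longrightarrow> Ident \<C> Y \<cdot> f = f"
    and ident_right: "f \<in> Hom \<C> X Y \<Longrightarrow> f \<cdot> Ident \<C> X = f"
    and comp_assoc: "f \<in> Hom \<C> W X \<Longrightarrow> g \<in> Hom \<C> X Y \<Longrightarrow> h \<in> Hom \<C> Y Z \<Longrightarrow>
      (h \<cdot> g) \<cdot> f = h \<cdot> (g \<cdot> f)"

definition isomorphic :: "('o, 'm, 'z) category_scheme \<Rightarrow> 'o \<Rightarrow> 'o \<Rightarrow> bool" where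
  "isomorphic \<C> X Y \<longleftrightarrow> X \<in> Ob \<C> \<and> Y \<in> Ob \<C> \<and>
     (\<exists>f \<in> Hom \<C> X Y. \<exists>g \<in> Hom \<C> Y X.
        g \<cdot>\<^bsub>\<C>\<^esub> f = Ident \<C> X \<and> f \<cdot>\<^bsub>\<C>\<^esub> g = Ident \<C> Y)"

definition monic :: "('o, 'm, 'z) category_scheme \<Rightarrow> 'm \<Rightarrow> bool" where
  "monic \<C> f \<longleftrightarrow> f \<in> Arr \<C> \<and>
     (\<forall>W. \<forall>g \<in> Hom \<C> W (Dom \<C> f). \<forall>h \<in> Hom \<C> W (Dom \<C> f).
        f \<cdot>\<^bsub>\<C>\<^esub> g = f \<cdot>\<^bsub>\<C>\<^esub> h \<longrightarrow> g = h)"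

definition epic :: "('o, 'm, 'z) category_scheme \<Rightarrow> 'm \<Rightarrow> bool" where
  "epic \<C> f \<longleftrightarrow> f \<in> Arr \<C> \<and>
     (\<forall>W. \<forall>g \<in> Hom \<C> (Cod \<C> f) W. \<forall>h \<in> Hom \<C> (Cod \<C> f) W.
        g \<cdot>\<^bsub>\<C>\<^esub> f = h \<cdot>\<^bsub>\<C>\<^esub> f \<longrightarrow> g = h)"

definition zero_object :: "('o, 'm, 'z) category_scheme \<Rightarrow> 'o \<Rightarrow> bool" where
  "zero_object \<C> Z \<longleftrightarrow> Z \<in> Ob \<C> \<and>
     (\<forall>X \<in> Ob \<C>. (\<exists>!f. f \<in> Hom \<C> X Z) \<and> (\<exists>!f. f \<in> Hom \<C> Z X))"

definition full_subcategory ::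
  "('o, 'm, 'z) category_scheme \<Rightarrow> 'o set \<Rightarrow> ('o, 'm, 'z) category_scheme" where
  "full_subcategory \<C> S =
     \<C>\<lparr>Ob := S, Arr := {f \<in> Arr \<C>. Dom \<C> f \<in> S \<and> Cod \<C> f \<in> S}\<rparr>"

text \<open>A full subcategory closed under isomorphisms is encoded by its set of objects.\<close>

definition replete_subcategory :: "('o, 'm, 'z) category_scheme \<Rightarrow> 'o set \<Rightarrow> bool" where
  "replete_subcategory \<C> S \<longleftrightarrow> S \<subseteq> Ob \<C> \<and> (\<forall>X \<in> S. \<forall>Y. isomorphic \<C> X Y \<longrightarrow> Y \<in> S)"


section \<open>Abelian categories\<close>

record ('o, 'm) preadditive = "('o, 'm) category" +
  Zero :: "'o \<Rightarrow> 'o \<Rightarrow> 'm"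
  Plus :: "'m \<Rightarrow> 'm \<Rightarrow> 'm"  (infixl \<open>\<oplus>\<index>\<close> 65)

definition hom_group :: "('o, 'm, 'z) preadditive_scheme \<Rightarrow> 'o \<Rightarrow> 'o \<Rightarrow> 'm monoid" where
  "hom_group \<C> X Y = \<lparr>carrier = Hom \<C> X Y, monoid.mult = Plus \<C>, one = Zero \<C> X Y\<rparr>"

locale preadditive_category = category \<C>
  for \<C> :: "('o, 'm, 'z) preadditive_scheme" (structure) +
  assumes hom_comm_group: "X \<in> Ob \<C> \<Longrightarrow> Y \<in> Ob \<C> \<Longrightarrow> comm_group (hom_group \<C> X Y)"
    and comp_plus: "f \<in> Hom \<C> X Y \<Longrightarrow> g \<in> Hom \<C> Y Z \<Longrightarrow> h \<in> Hom \<C> Y Z \<Longrightarrow>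
      (g \<oplus> h) \<cdot> f = (g \<cdot> f) \<oplus> (h \<cdot> f)"
    and plus_comp: "f \<in> Hom \<C> X Y \<Longrightarrow> g \<in> Hom \<C> X Y \<Longrightarrow> h \<in> Hom \<C> Y Z \<Longrightarrow>
      h \<cdot> (f \<oplus> g) = (h \<cdot> f) \<oplus> (h \<cdot> g)"

definition is_kernel :: "('o, 'm, 'z) preadditive_scheme \<Rightarrow> 'm \<Rightarrow> 'm \<Rightarrow> bool" where
  "is_kernel \<C> f k \<longleftrightarrow> f \<in> Arr \<C> \<and> k \<in> Arr \<C> \<and> Cod \<C> k = Dom \<C> f \<and>
     f \<cdot>\<^bsub>\<C>\<^esub> k = Zero \<C> (Dom \<C> k) (Cod \<C> f) \<and>
     (\<forall>W. \<forall>h \<in> Hom \<C> W (Dom \<C> f). f \<cdot>\<^bsub>\<C>\<^esub> h = Zero \<C> W (Cod \<C> f) \<longrightarrow>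
        (\<exists>!u. u \<in> Hom \<C> W (Dom \<C> k) \<and> k \<cdot>\<^bsub>\<C>\<^esub> u = h))"

definition is_cokernel :: "('o, 'm, 'z) preadditive_scheme \<Rightarrow> 'm \<Rightarrow> 'm \<Rightarrow> bool" where
  "is_cokernel \<C> f c \<longleftrightarrow> f \<in> Arr \<C> \<and> c \<in> Arr \<C> \<and> Dom \<C> c = Cod \<C> f \<and>
     c \<cdot>\<^bsub>\<C>\<^esub> f = Zero \<C> (Dom \<C> f) (Cod \<C> c) \<and>
     (\<forall>W. \<forall>h \<in> Hom \<C> (Cod \<C> f) W. h \<cdot>\<^bsub>\<C>\<^esub> f = Zero \<C> (Dom \<C> f) W \<longrightarrow>
        (\<exists>!u. u \<in> Hom \<C> (Cod \<C> c) W \<and> u \<cdot>\<^bsub>\<C>\<^esub> c = h))"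

definition is_biproduct ::
  "('o, 'm, 'z) preadditive_scheme \<Rightarrow> 'o \<Rightarrow> 'o \<Rightarrow> 'o \<Rightarrow> 'm \<Rightarrow> 'm \<Rightarrow> 'm \<Rightarrow> 'm \<Rightarrow> bool" where
  "is_biproduct \<C> X Y P \<iota>\<^sub>1 \<iota>\<^sub>2 \<pi>\<^sub>1 \<pi>\<^sub>2 \<longleftrightarrow>
     P \<in> Ob \<C> \<and> \<iota>\<^sub>1 \<in> Hom \<C> X P \<and> \<iota>\<^sub>2 \<in> Hom \<C> Y P \<and> \<pi>\<^sub>1 \<in> Hom \<C> P X \<and> \<pi>\<^sub>2 \<in> Hom \<C> P Y \<and>
     \<pi>\<^sub>1 \<cdot>\<^bsub>\<C>\<^esub> \<iota>\<^sub>1 = Ident \<C> X \<and> \<pi>\<^sub>2 \<cdot>\<^bsub>\<C>\<^esub> \<iota>\<^sub>2 = Ident \<C> Y \<and>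
     (\<iota>\<^sub>1 \<cdot>\<^bsub>\<C>\<^esub> \<pi>\<^sub>1) \<oplus>\<^bsub>\<C>\<^esub> (\<iota>\<^sub>2 \<cdot>\<^bsub>\<C>\<^esub> \<pi>\<^sub>2) = Ident \<C> P"

locale abelian_category = preadditive_category \<C>
  for \<C> :: "('o, 'm, 'z) preadditive_scheme" (structure) +
  assumes has_zero_object: "\<exists>Z. zero_object \<C> Z"
    and has_biproducts: "X \<in> Ob \<C> \<Longrightarrow> Y \<in> Ob \<C> \<Longrightarrow> \<exists>P \<iota>\<^sub>1 \<iota>\<^sub>2 \<pi>\<^sub>1 \<pi>\<^sub>2. is_biproduct \<C> X Y P \<iota>\<^sub>1 \<iota>\<^sub>2 \<pi>\<^sub>1 \<pi>\<^sub>2"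
    and has_kernels: "f \<in> Arr \<C> \<Longrightarrow> \<exists>k. is_kernel \<C> f k"
    and has_cokernels: "f \<in> Arr \<C> \<Longrightarrow> \<exists>c. is_cokernel \<C> f c"
    and monic_is_kernel: "monic \<C> m \<Longrightarrow> \<exists>f. is_kernel \<C> f m"
    and epic_is_cokernel: "epic \<C> e \<Longrightarrow> \<exists>f. is_cokernel \<C> f e"

definition is_image :: "('o, 'm, 'z) preadditive_scheme \<Rightarrow> 'm \<Rightarrow> 'm \<Rightarrow> bool" where
  "is_image \<C> f m \<longleftrightarrow> (\<exists>c. is_cokernel \<C> f c \<and> is_kernel \<C> c m)"

text \<open>Exactness at the middle object says that \<open>Im f\<close> and \<open>Ker g\<close> are the same subobject,
  i.e. some \<open>m\<close> represents both.\<close>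

definition exact_at :: "('o, 'm, 'z) preadditive_scheme \<Rightarrow> 'm \<Rightarrow> 'm \<Rightarrow> bool" where
  "exact_at \<C> f g \<longleftrightarrow> (\<exists>m. is_image \<C> f m \<and> is_kernel \<C> g m)"

definition short_exact :: "('o, 'm, 'z) preadditive_scheme \<Rightarrow> 'm \<Rightarrow> 'm \<Rightarrow> bool" where
  "short_exact \<C> f g \<longleftrightarrow> monic \<C> f \<and> exact_at \<C> f g \<and> epic \<C> g"


section \<open>ICE-closed subcategories\<close>

text \<open>Images and cokernels are determined only up to isomorphism; since the subcategory is
  replete it does not matter that every representative is required to lie in it.
  The empty set satisfies the definition.\<close>

definition ICE_closed :: "('o, 'm, 'z) preadditive_scheme \<Rightarrow> 'o set \<Rightarrow> bool" where
  "ICE_closed \<C> S \<longleftrightarrow> replete_subcategory \<C> S \<and>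
     (\<forall>M \<in> S. \<forall>N \<in> S. \<forall>f \<in> Hom \<C> M N. \<forall>m. is_image \<C> f m \<longrightarrow> Dom \<C> m \<in> S) \<and>
     (\<forall>M \<in> S. \<forall>N \<in> S. \<forall>f \<in> Hom \<C> M N. \<forall>c. is_cokernel \<C> f c \<longrightarrow> Cod \<C> c \<in> S) \<and>
     (\<forall>N\<^sub>1 N\<^sub>2 N\<^sub>3. \<forall>f \<in> Hom \<C> N\<^sub>1 N\<^sub>2. \<forall>g \<in> Hom \<C> N\<^sub>2 N\<^sub>3.
        short_exact \<C> f g \<and> N\<^sub>1 \<in> S \<and> N\<^sub>3 \<in> S \<longrightarrow> N\<^sub>2 \<in> S)"


section \<open>Functors\<close>

record ('o1, 'm1, 'o2, 'm2) ftor =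
  obj_map :: "'o1 \<Rightarrow> 'o2"
  arr_map :: "'m1 \<Rightarrow> 'm2"

definition additive_functor ::
  "('o1, 'm1, 'y) preadditive_scheme \<Rightarrow> ('o2, 'm2, 'z) preadditive_scheme \<Rightarrow>
   ('o1, 'm1, 'o2, 'm2) ftor \<Rightarrow> bool" where
  "additive_functor \<C> \<D> F \<longleftrightarrow>
     (\<forall>X \<in> Ob \<C>. obj_map F X \<in> Ob \<D>) \<and>
     (\<forall>X Y. \<forall>f \<in> Hom \<C> X Y. arr_map F f \<in> Hom \<D> (obj_map F X) (obj_map F Y)) \<and>
     (\<forall>X \<in> Ob \<C>. arr_map F (Ident \<C> X) = Ident \<D> (obj_map F X)) \<and>
     (\<forall>X Y Z. \<forall>f \<in> Hom \<C> X Y. \<forall>g \<in> Hom \<C> Y Z.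
        arr_map F (g \<cdot>\<^bsub>\<C>\<^esub> f) = arr_map F g \<cdot>\<^bsub>\<D>\<^esub> arr_map F f) \<and>
     (\<forall>X Y. \<forall>f \<in> Hom \<C> X Y. \<forall>g \<in> Hom \<C> X Y.
        arr_map F (f \<oplus>\<^bsub>\<C>\<^esub> g) = arr_map F f \<oplus>\<^bsub>\<D>\<^esub> arr_map F g)"

definition exact_functor ::
  "('o1, 'm1, 'y) preadditive_scheme \<Rightarrow> ('o2, 'm2, 'z) preadditive_scheme \<Rightarrow>
   ('o1, 'm1, 'o2, 'm2) ftor \<Rightarrow> bool" where
  "exact_functor \<C> \<D> F \<longleftrightarrow> additive_functor \<C> \<D> F \<and>
     (\<forall>f g. short_exact \<C> f g \<longrightarrow> short_exact \<D> (arr_map F f) (arr_map F g))"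

definition fully_faithful ::
  "('o1, 'm1, 'y) category_scheme \<Rightarrow> ('o2, 'm2, 'z) category_scheme \<Rightarrow>
   ('o1, 'm1, 'o2, 'm2) ftor \<Rightarrow> bool" where
  "fully_faithful \<C> \<D> F \<longleftrightarrow>
     (\<forall>X \<in> Ob \<C>. \<forall>Y \<in> Ob \<C>.
        bij_betw (arr_map F) (Hom \<C> X Y) (Hom \<D> (obj_map F X) (obj_map F Y)))"

text \<open>\<open>adjoint_pair \<C> \<D> F G\<close>: the functor \<open>F : \<C> \<rightarrow> \<D>\<close> is left adjoint to \<open>G : \<D> \<rightarrow> \<C>\<close>.\<close>

definition adjoint_pair ::
  "('o1, 'm1, 'y) category_scheme \<Rightarrow> ('o2, 'm2, 'z) category_scheme \<Rightarrow>
   ('o1, 'm1, 'o2, 'm2) ftor \<Rightarrow> ('o2, 'm2, 'o1, 'm1) ftor \<Rightarrow> bool" where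
  "adjoint_pair \<C> \<D> F G \<longleftrightarrow>
     (\<exists>\<phi>. (\<forall>X \<in> Ob \<C>. \<forall>Y \<in> Ob \<D>.
             bij_betw (\<phi> X Y) (Hom \<D> (obj_map F X) Y) (Hom \<C> X (obj_map G Y))) \<and>
          (\<forall>X \<in> Ob \<C>. \<forall>X' \<in> Ob \<C>. \<forall>Y \<in> Ob \<D>. \<forall>Y' \<in> Ob \<D>.
             \<forall>u \<in> Hom \<C> X' X. \<forall>v \<in> Hom \<D> Y Y'. \<forall>f \<in> Hom \<D> (obj_map F X) Y.
               \<phi> X' Y' (v \<cdot>\<^bsub>\<D>\<^esub> (f \<cdot>\<^bsub>\<D>\<^esub> arr_map F u)) = arr_map G v \<cdot>\<^bsub>\<C>\<^esub> (\<phi> X Y f \<cdot>\<^bsub>\<C>\<^esub> u)))"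

definition ess_image ::
  "('o2, 'm2, 'z) category_scheme \<Rightarrow> ('o1, 'm1, 'o2, 'm2) ftor \<Rightarrow> 'o1 set \<Rightarrow> 'o2 set" where
  "ess_image \<D> F S = {Y \<in> Ob \<D>. \<exists>X \<in> S. isomorphic \<D> (obj_map F X) Y}"

definition ftor_kernel ::
  "('o1, 'm1, 'y) category_scheme \<Rightarrow> ('o2, 'm2, 'z) category_scheme \<Rightarrow>
   ('o1, 'm1, 'o2, 'm2) ftor \<Rightarrow> 'o1 set" where
  "ftor_kernel \<C> \<D> F = {X \<in> Ob \<C>. zero_object \<D> (obj_map F X)}"


section \<open>Recollements\<close>

text \<open>The functors are listed in the order \<open>i\<^sup>*, i\<^sub>*, i\<^sup>!, j\<^sub>!, j\<^sup>*, j\<^sub>*\<close>.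
  The three categories are not required to be abelian here, so that the conditions also make
  sense for full subcategories. A functor restricted to full subcategories is given by the same
  maps: every notion above looks only at their values on objects and arrows of the source.\<close>

definition recollement_conditions ::
  "('o1, 'm1) preadditive \<Rightarrow> ('o, 'm) preadditive \<Rightarrow> ('o2, 'm2) preadditive \<Rightarrow>
   ('o, 'm, 'o1, 'm1) ftor \<Rightarrow> ('o1, 'm1, 'o, 'm) ftor \<Rightarrow> ('o, 'm, 'o1, 'm1) ftor \<Rightarrow>
   ('o2, 'm2, 'o, 'm) ftor \<Rightarrow> ('o, 'm, 'o2, 'm2) ftor \<Rightarrow> ('o2, 'm2, 'o, 'm) ftor \<Rightarrow> bool" where
  "recollement_conditions \<A>' \<A> \<A>'' i_upstar i_lowstar i_upshriek j_lowshriek j_upstar j_lowstar \<longleftrightarrow>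
     additive_functor \<A> \<A>' i_upstar \<and> additive_functor \<A>' \<A> i_lowstar \<and>
     additive_functor \<A> \<A>' i_upshriek \<and> additive_functor \<A>'' \<A> j_lowshriek \<and>
     additive_functor \<A> \<A>'' j_upstar \<and> additive_functor \<A>'' \<A> j_lowstar \<and>
     adjoint_pair \<A> \<A>' i_upstar i_lowstar \<and> adjoint_pair \<A>' \<A> i_lowstar i_upshriek \<and>
     adjoint_pair \<A>'' \<A> j_lowshriek j_upstar \<and> adjoint_pair \<A> \<A>'' j_upstar j_lowstar \<and>
     fully_faithful \<A>' \<A> i_lowstar \<and> fully_faithful \<A>'' \<A> j_lowshriek \<and>
     fully_faithful \<A>'' \<A> j_lowstar \<and>
     ftor_kernel \<A> \<A>'' j_upstar = ess_image \<A> i_lowstar (Ob \<A>')"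

definition recollement ::
  "('o1, 'm1) preadditive \<Rightarrow> ('o, 'm) preadditive \<Rightarrow> ('o2, 'm2) preadditive \<Rightarrow>
   ('o, 'm, 'o1, 'm1) ftor \<Rightarrow> ('o1, 'm1, 'o, 'm) ftor \<Rightarrow> ('o, 'm, 'o1, 'm1) ftor \<Rightarrow>
   ('o2, 'm2, 'o, 'm) ftor \<Rightarrow> ('o, 'm, 'o2, 'm2) ftor \<Rightarrow> ('o2, 'm2, 'o, 'm) ftor \<Rightarrow> bool" where
  "recollement \<A>' \<A> \<A>'' i_upstar i_lowstar i_upshriek j_lowshriek j_upstar j_lowstar \<longleftrightarrow>
     abelian_category \<A>' \<and> abelian_category \<A> \<and> abelian_category \<A>'' \<and>
     recollement_conditions \<A>' \<A> \<A>'' i_upstar i_lowstar i_upshriek j_lowshriek j_upstar j_lowstar"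

definition ICE_recollement ::
  "('o1, 'm1) preadditive \<Rightarrow> ('o, 'm) preadditive \<Rightarrow> ('o2, 'm2) preadditive \<Rightarrow>
   ('o, 'm, 'o1, 'm1) ftor \<Rightarrow> ('o1, 'm1, 'o, 'm) ftor \<Rightarrow> ('o, 'm, 'o1, 'm1) ftor \<Rightarrow>
   ('o2, 'm2, 'o, 'm) ftor \<Rightarrow> ('o, 'm, 'o2, 'm2) ftor \<Rightarrow> ('o2, 'm2, 'o, 'm) ftor \<Rightarrow>
   'o set \<Rightarrow> bool" where
  "ICE_recollement \<A>' \<A> \<A>'' i_upstar i_lowstar i_upshriek j_lowshriek j_upstar j_lowstar C \<longleftrightarrow>
     ICE_closed \<A>'' (ess_image \<A>'' j_upstar C) \<and>
     recollement_conditions \<A>' (full_subcategory \<A> C)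
       (full_subcategory \<A>'' (ess_image \<A>'' j_upstar C))
       i_upstar i_lowstar i_upshriek j_lowshriek j_upstar j_lowstar"


section \<open>The empty subcategory\<close>

text \<open>The empty subcategory of \<open>\<A>''\<close> is ICE-closed, but it is never of the form \<open>j\<^sup>*(C)\<close> for a
  subcategory \<open>C\<close> containing \<open>i\<^sub>*(\<A>')\<close>. A bijection induced by \<open>j\<^sup>*\<close> on such \<open>C\<close> can
  therefore only be onto the nonempty ICE-closed subcategories of \<open>\<A>''\<close>.\<close>

lemma ICE_closed_empty: "ICE_closed \<C> {}"
  by (simp add: ICE_closed_def replete_subcategory_def)

lemma (in category) isomorphic_refl: "X \<in> Ob \<C> \<Longrightarrow> isomorphic \<C> X X"
  unfolding isomorphic_def using ident_in_Hom ident_left by blast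

lemma ess_image_j_upstar_nonempty:
  assumes R: "recollement \<A>' \<A> \<A>'' i_upstar i_lowstar i_upshriek j_lowshriek j_upstar j_lowstar"
    and C: "ess_image \<A> i_lowstar (Ob \<A>') \<subseteq> C"
  shows "ess_image \<A>'' j_upstar C \<noteq> {}"
proof -
  interpret A': abelian_category \<A>' using R by (simp add: recollement_def)
  interpret A: abelian_category \<A> using R by (simp add: recollement_def)
  interpret A'': abelian_category \<A>'' using R by (simp add: recollement_def)
  have i: "additive_functor \<A>' \<A> i_lowstar" and j: "additive_functor \<A> \<A>'' j_upstar"
    using R by (simp_all add: recollement_def recollement_conditions_def)
  obtain Z where Z: "Z \<in> Ob \<A>'" using A'.has_zero_object by (auto simp: zero_object_def)
  have iZ: "obj_map i_lowstar Z \<in> Ob \<A>" using i Z by (simp add: additive_functor_def)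
  hence "obj_map i_lowstar Z \<in> C" using C Z A.isomorphic_refl by (auto simp: ess_image_def)
  moreover have "obj_map j_upstar (obj_map i_lowstar Z) \<in> Ob \<A>''"
    using j iZ by (simp add: additive_functor_def)
  ultimately show ?thesis using A''.isomorphic_refl by (auto simp: ess_image_def)
qed

end

(* Everything reduces to one fact: a subcategory C of A as in (3) is the full preimage under j^* of
   j^*(C), because the kernel and the cokernel of the counit j_! j^* X -> X are killed by j^*, hence
   lie in i_*(A'), and an ICE-closed subcategory containing the source, the kernel and the cokernel
   of a morphism contains its target. Conversely, preimages of ICE-closed subcategories under the
   exact functor j^* are ICE-closed. For (1) and (2), an exact fully faithful functor carries
   ICE-closed subcategories to ICE-closed ones as soon as its essential image is closed under
   extensions; for i_* this image is the kernel of an exact functor, and for j_! and j_* the five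
   lemma applies to the counit and the unit. Statements about j_* are those about j_! in the
   opposite categories. *)

theory Submission
  imports Defs
begin

section \<open>Categories\<close>

text \<open>Two obstacles shape the argument. An ICE-closed subcategory need not be closed under
  kernels, and \<open>j_lowshriek\<close>, a left adjoint, is in general only right exact, so a
  short exact sequence in \<open>\<A>''\<close> cannot simply be lifted along it. What goes wrong is
  confined to the kernel of the lifted monomorphism; \<open>j_upstar\<close> kills this kernel, so
  it belongs to the part coming from \<open>\<A>'\<close> that every admissible subcategory
  contains. Secondly, the hypotheses on a subcategory mention \<open>j_lowshriek\<close> but not
  \<open>j_lowstar\<close>; that \<open>j_lowstar\<close> restricts as well is read off from the
  preimage description, since both are sections of \<open>j_upstar\<close> up to isomorphism.
  Exactness of \<open>j_upstar\<close> and \<open>i_lowstar\<close> is not part of the data: it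
  comes from each of them having adjoints on both sides. An adjunction is given by natural
  bijections of sets, so unit, counit and compatibility with zero morphisms have to be extracted
  from it. Nonemptiness is what puts zero objects into an ICE-closed subcategory, and with them the
  kernel of \<open>j_upstar\<close> into the preimage.\<close>

definition is_iso :: "('o, 'm, 'z) category_scheme \<Rightarrow> 'm \<Rightarrow> bool" where
  "is_iso \<C> f \<longleftrightarrow> f \<in> Arr \<C> \<and>
     (\<exists>g \<in> Hom \<C> (Cod \<C> f) (Dom \<C> f).
        g \<cdot>\<^bsub>\<C>\<^esub> f = Ident \<C> (Dom \<C> f) \<and> f \<cdot>\<^bsub>\<C>\<^esub> g = Ident \<C> (Cod \<C> f))"

context category
begin

lemma ident_simps [simp]:
  assumes "X \<in> Ob \<C>"
  shows "Ident \<C> X \<in> Arr \<C>" "Dom \<C> (Ident \<C> X) = X" "Cod \<C> (Ident \<C> X) = X"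
  using ident_in_Hom[OF assms] by (auto simp: Hom_def)

lemma comp_simps [simp]:
  assumes "f \<in> Arr \<C>" "g \<in> Arr \<C>" "Dom \<C> g = Cod \<C> f"
  shows "g \<cdot> f \<in> Arr \<C>" "Dom \<C> (g \<cdot> f) = Dom \<C> f" "Cod \<C> (g \<cdot> f) = Cod \<C> g"
  using comp_in_Hom[of f "Dom \<C> f" "Cod \<C> f" g "Cod \<C> g"] assms by (auto simp: Hom_def)

lemma ident_comp [simp]:
  "f \<in> Arr \<C> \<Longrightarrow> Cod \<C> f = Y \<Longrightarrow> Ident \<C> Y \<cdot> f = f"
  "f \<in> Arr \<C> \<Longrightarrow> Dom \<C> f = X \<Longrightarrow> f \<cdot> Ident \<C> X = f"
  using ident_left ident_right by (auto simp: Hom_def)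

lemma assoc:
  "f \<in> Arr \<C> \<Longrightarrow> g \<in> Arr \<C> \<Longrightarrow> h \<in> Arr \<C> \<Longrightarrow> Dom \<C> g = Cod \<C> f \<Longrightarrow> Dom \<C> h = Cod \<C> g \<Longrightarrow>
    (h \<cdot> g) \<cdot> f = h \<cdot> (g \<cdot> f)"
  using comp_assoc[of f "Dom \<C> f" "Cod \<C> f" g "Cod \<C> g" h "Cod \<C> h"] by (auto simp: Hom_def)

lemma Hom_Ob: "f \<in> Hom \<C> X Y \<Longrightarrow> X \<in> Ob \<C> \<and> Y \<in> Ob \<C>"
  using dom_in_Ob cod_in_Ob by (auto simp: Hom_def)

lemma Arr_Hom: "f \<in> Arr \<C> \<Longrightarrow> f \<in> Hom \<C> (Dom \<C> f) (Cod \<C> f)"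
  by (simp add: Hom_def)

lemma is_isoI:
  assumes "f \<in> Hom \<C> X Y" "g \<in> Hom \<C> Y X" "g \<cdot> f = Ident \<C> X" "f \<cdot> g = Ident \<C> Y"
  shows "is_iso \<C> f"
  using assms unfolding is_iso_def Hom_def by auto

lemma is_isoE:
  assumes "is_iso \<C> f" "f \<in> Hom \<C> X Y"
  obtains g where "g \<in> Hom \<C> Y X" "g \<cdot> f = Ident \<C> X" "f \<cdot> g = Ident \<C> Y" "is_iso \<C> g"
  using assms unfolding is_iso_def Hom_def by auto

lemma isomorphic_iff: "isomorphic \<C> X Y \<longleftrightarrow> (\<exists>f \<in> Hom \<C> X Y. is_iso \<C> f)"
  unfolding isomorphic_def is_iso_def using Hom_Ob by (fastforce simp: Hom_def)

lemma isomorphic_sym: "isomorphic \<C> X Y \<Longrightarrow> isomorphic \<C> Y X"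
  unfolding isomorphic_def by auto

lemma is_iso_comp:
  assumes f: "f \<in> Hom \<C> X Y" "is_iso \<C> f" and g: "g \<in> Hom \<C> Y Z" "is_iso \<C> g"
  shows "is_iso \<C> (g \<cdot> f)"
proof -
  obtain f' where f': "f' \<in> Hom \<C> Y X" "f' \<cdot> f = Ident \<C> X" "f \<cdot> f' = Ident \<C> Y"
    using f by (auto elim: is_isoE)
  obtain g' where g': "g' \<in> Hom \<C> Z Y" "g' \<cdot> g = Ident \<C> Y" "g \<cdot> g' = Ident \<C> Z"
    using g by (auto elim: is_isoE)
  have "(f' \<cdot> g') \<cdot> (g \<cdot> f) = f' \<cdot> ((g' \<cdot> g) \<cdot> f)" using f g f'(1) g'(1) by (simp add: Hom_def assoc)
  moreover have "(g \<cdot> f) \<cdot> (f' \<cdot> g') = g \<cdot> ((f \<cdot> f') \<cdot> g')"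
    using f g f'(1) g'(1) by (simp add: Hom_def assoc)
  ultimately show ?thesis
    using f g f' g' by (intro is_isoI[of _ X Z "f' \<cdot> g'"]) (auto simp: Hom_def)
qed

lemma is_iso_ident: "X \<in> Ob \<C> \<Longrightarrow> is_iso \<C> (Ident \<C> X)"
  by (rule is_isoI[of _ X X "Ident \<C> X"]) (auto simp: Hom_def)

lemma isomorphic_trans: "isomorphic \<C> X Y \<Longrightarrow> isomorphic \<C> Y Z \<Longrightarrow> isomorphic \<C> X Z"
  unfolding isomorphic_iff using is_iso_comp comp_in_Hom by blast

text \<open>Two-out-of-three for the outer factor. A triangle identity or a naturality square
  supplies the composite, and this extracts the counit or its image under a functor.\<close>

lemma is_iso_cancel:
  assumes f: "f \<in> Hom \<C> X Y" and g: "g \<in> Hom \<C> Y Z" and i: "is_iso \<C> f" "is_iso \<C> (g \<cdot> f)"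
  shows "is_iso \<C> g"
proof -
  obtain f' where f': "f' \<in> Hom \<C> Y X" "f' \<cdot> f = Ident \<C> X" "f \<cdot> f' = Ident \<C> Y" "is_iso \<C> f'"
    using f i by (auto elim: is_isoE)
  have "(g \<cdot> f) \<cdot> f' = g" using f g f' by (auto simp: Hom_def assoc)
  then show ?thesis using is_iso_comp[OF f'(1,4) comp_in_Hom[OF f g] i(2)] by simp
qed

lemma monicD:
  "monic \<C> f \<Longrightarrow> f \<in> Hom \<C> X Y \<Longrightarrow> g \<in> Hom \<C> W X \<Longrightarrow> h \<in> Hom \<C> W X \<Longrightarrow> f \<cdot> g = f \<cdot> h \<Longrightarrow> g = h"
  unfolding monic_def Hom_def by auto

lemma epicD:
  "epic \<C> f \<Longrightarrow> f \<in> Hom \<C> X Y \<Longrightarrow> g \<in> Hom \<C> Y W \<Longrightarrow> h \<in> Hom \<C> Y W \<Longrightarrow> g \<cdot> f = h \<cdot> f \<Longrightarrow> g = h"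
  unfolding epic_def Hom_def by auto

lemma monic_comp:
  assumes "f \<in> Hom \<C> X Y" "monic \<C> f" "g \<in> Hom \<C> Y Z" "monic \<C> g"
  shows "monic \<C> (g \<cdot> f)"
  unfolding monic_def
proof (intro conjI allI ballI impI)
  show "g \<cdot> f \<in> Arr \<C>" using assms by (auto simp: Hom_def)
  fix W a b assume "a \<in> Hom \<C> W (Dom \<C> (g \<cdot> f))" "b \<in> Hom \<C> W (Dom \<C> (g \<cdot> f))"
    and eq: "(g \<cdot> f) \<cdot> a = (g \<cdot> f) \<cdot> b"
  then have ab: "a \<in> Hom \<C> W X" "b \<in> Hom \<C> W X" using assms by (auto simp: Hom_def)
  then have "g \<cdot> (f \<cdot> a) = g \<cdot> (f \<cdot> b)" using eq assms by (auto simp: Hom_def assoc)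
  then show "a = b"
    using monicD[OF assms(4,3) comp_in_Hom[OF ab(1) assms(1)] comp_in_Hom[OF ab(2) assms(1)]]
      monicD[OF assms(2,1) ab] by blast
qed

lemma is_iso_monic:
  assumes "is_iso \<C> f"
  shows "monic \<C> f"
proof -
  obtain g where f: "f \<in> Arr \<C>" and g: "g \<in> Hom \<C> (Cod \<C> f) (Dom \<C> f)" "g \<cdot> f = Ident \<C> (Dom \<C> f)"
    using assms unfolding is_iso_def by auto
  have "a = b" if "a \<in> Hom \<C> W (Dom \<C> f)" "b \<in> Hom \<C> W (Dom \<C> f)" "f \<cdot> a = f \<cdot> b" for W a b
  proof -
    have "(g \<cdot> f) \<cdot> a = (g \<cdot> f) \<cdot> b" using that f g(1) by (auto simp: Hom_def assoc)
    then show ?thesis using that g(2) by (auto simp: Hom_def)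
  qed
  then show ?thesis using f unfolding monic_def by blast
qed

text \<open>Cancelling \<open>m\<close> in \<open>m \<cdot> (u \<cdot> m) = m\<close> makes a
  one-sided inverse two-sided. It serves where an argument produces an inverse on one side
  only.\<close>

lemma monic_left_inverse_is_iso:
  assumes m: "monic \<C> m" "m \<in> Hom \<C> X Y" and u: "u \<in> Hom \<C> Y X" "m \<cdot> u = Ident \<C> Y"
  shows "is_iso \<C> m"
proof -
  have "m \<cdot> (u \<cdot> m) = (m \<cdot> u) \<cdot> m" using m(2) u(1) by (auto simp: Hom_def assoc)
  also have "\<dots> = m \<cdot> Ident \<C> X" using m(2) u by (auto simp: Hom_def)
  finally have "u \<cdot> m = Ident \<C> X"
    using monicD[OF m comp_in_Hom[OF m(2) u(1)] ident_in_Hom] Hom_Ob[OF m(2)] by blast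
  then show ?thesis using is_isoI m u by blast
qed

end

lemma ess_imageI:
  "X \<in> S \<Longrightarrow> isomorphic \<D> (obj_map F X) Y \<Longrightarrow> Y \<in> ess_image \<D> F S"
  by (auto simp: ess_image_def isomorphic_def)

lemma (in category) ess_image_replete:
  "replete_subcategory \<C> (ess_image \<C> F S)"
  unfolding replete_subcategory_def ess_image_def
proof (intro conjI ballI allI impI)
  fix X Y assume X: "X \<in> {Y \<in> Ob \<C>. \<exists>X \<in> S. isomorphic \<C> (obj_map F X) Y}" and i: "isomorphic \<C> X Y"
  from X obtain Z where "Z \<in> S" "isomorphic \<C> (obj_map F Z) X" by blast
  moreover have "Y \<in> Ob \<C>" using i by (simp add: isomorphic_def)
  ultimately show "Y \<in> {Y \<in> Ob \<C>. \<exists>X \<in> S. isomorphic \<C> (obj_map F X) Y}"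
    using isomorphic_trans i by blast
qed blast


section \<open>Opposite categories\<close>

text \<open>As a record update this is an involution by rewriting, not merely up to isomorphism, so
  a statement proved for all categories can be instantiated at \<open>opposite \<C>\<close> and
  simplified to its dual. Of the additive structure only \<open>Zero\<close> changes, because it
  takes its objects as arguments.\<close>

definition opposite :: "('o, 'm, 'z) preadditive_scheme \<Rightarrow> ('o, 'm, 'z) preadditive_scheme" where
  "opposite \<C> = \<C>\<lparr>Dom := Cod \<C>, Cod := Dom \<C>, Comp := \<lambda>g f. f \<cdot>\<^bsub>\<C>\<^esub> g,
     Zero := \<lambda>X Y. Zero \<C> Y X\<rparr>"

lemma opposite_simps [simp]:
  "Ob (opposite \<C>) = Ob \<C>" "Arr (opposite \<C>) = Arr \<C>" "Dom (opposite \<C>) = Cod \<C>"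
  "Cod (opposite \<C>) = Dom \<C>" "Ident (opposite \<C>) = Ident \<C>" "g \<cdot>\<^bsub>opposite \<C>\<^esub> f = f \<cdot>\<^bsub>\<C>\<^esub> g"
  "Zero (opposite \<C>) X Y = Zero \<C> Y X" "Plus (opposite \<C>) = Plus \<C>"
  "opposite (opposite \<C>) = \<C>"
  by (simp_all add: opposite_def)

lemma Hom_opposite [simp]: "Hom (opposite \<C>) X Y = Hom \<C> Y X"
  by (auto simp: Hom_def)

lemma monic_opposite [simp]: "monic (opposite \<C>) f = epic \<C> f"
  by (simp add: monic_def epic_def)

lemma epic_opposite [simp]: "epic (opposite \<C>) f = monic \<C> f"
  by (simp add: monic_def epic_def)

lemma is_kernel_opposite [simp]: "is_kernel (opposite \<C>) = is_cokernel \<C>"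
  by (intro ext) (simp add: is_kernel_def is_cokernel_def)

lemma is_cokernel_opposite [simp]: "is_cokernel (opposite \<C>) = is_kernel \<C>"
  by (intro ext) (simp add: is_kernel_def is_cokernel_def)

lemma is_iso_opposite [simp]: "is_iso (opposite \<C>) f = is_iso \<C> f"
  unfolding is_iso_def by auto

lemma isomorphic_opposite [simp]: "isomorphic (opposite \<C>) X Y = isomorphic \<C> X Y"
  unfolding isomorphic_def by auto

lemma zero_object_opposite [simp]: "zero_object (opposite \<C>) Z = zero_object \<C> Z"
  unfolding zero_object_def by auto

lemma ess_image_opposite [simp]: "ess_image (opposite \<C>) F S = ess_image \<C> F S"
  by (simp add: ess_image_def)

lemma fully_faithful_opposite [simp]:
  "fully_faithful (opposite \<C>) (opposite \<D>) F = fully_faithful \<C> \<D> F"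
  unfolding fully_faithful_def by auto

lemma additive_functor_opposite:
  "additive_functor \<C> \<D> F \<Longrightarrow> additive_functor (opposite \<C>) (opposite \<D>) F"
  unfolding additive_functor_def Hom_opposite opposite_simps
  by (elim conjE, intro conjI allI ballI) simp_all

lemma category_opposite:
  assumes "category \<C>"
  shows "category (opposite \<C>)"
proof -
  interpret category \<C> by fact
  show ?thesis
    by unfold_locales
      (simp_all add: dom_in_Ob cod_in_Ob ident_in_Hom ident_left ident_right comp_assoc comp_in_Hom)
qed

lemma preadditive_category_opposite:
  assumes "preadditive_category \<C>"
  shows "preadditive_category (opposite \<C>)"
proof -
  interpret preadditive_category \<C> by fact
  have "category (opposite \<C>)" by (rule category_opposite) unfold_locales
  moreover have "hom_group (opposite \<C>) X Y = hom_group \<C> Y X" for X Y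
    by (simp add: hom_group_def)
  ultimately show ?thesis
    by (intro preadditive_category.intro preadditive_category_axioms.intro)
      (simp_all add: comp_plus plus_comp hom_comm_group)
qed

lemma abelian_category_opposite:
  assumes "abelian_category \<C>"
  shows "abelian_category (opposite \<C>)"
proof -
  interpret abelian_category \<C> by fact
  have P: "preadditive_category (opposite \<C>)"
    by (rule preadditive_category_opposite) unfold_locales
  have B: "\<exists>P i1 i2 p1 p2. is_biproduct (opposite \<C>) X Y P i1 i2 p1 p2"
    if XY: "X \<in> Ob \<C>" "Y \<in> Ob \<C>" for X Y
  proof -
    obtain P i1 i2 p1 p2 where "is_biproduct \<C> X Y P i1 i2 p1 p2"
      using has_biproducts XY by blast
    then have "is_biproduct (opposite \<C>) X Y P p1 p2 i1 i2" by (simp add: is_biproduct_def)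
    then show ?thesis by blast
  qed
  show ?thesis
    by (intro abelian_category.intro abelian_category_axioms.intro P)
      (simp_all add: has_zero_object has_kernels has_cokernels monic_is_kernel epic_is_cokernel B)
qed


section \<open>Abelian categories\<close>

context preadditive_category
begin

lemma zero_Hom:
  assumes "X \<in> Ob \<C>" "Y \<in> Ob \<C>"
  shows "Zero \<C> X Y \<in> Hom \<C> X Y"
proof -
  interpret comm_group "hom_group \<C> X Y" using hom_comm_group assms by blast
  show ?thesis using one_closed by (simp add: hom_group_def)
qed

text \<open>Cancellation in the hom group. Bilinearity of composition and additivity of functors
  only show that the image \<open>f\<close> of a zero morphism satisfies
  \<open>f \<oplus> f = f\<close>; this identifies it as zero.\<close>

lemma plus_idem_zero:
  assumes "f \<in> Hom \<C> X Y" "f \<oplus> f = f"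
  shows "f = Zero \<C> X Y"
proof -
  interpret comm_group "hom_group \<C> X Y" using hom_comm_group Hom_Ob[OF assms(1)] by blast
  show ?thesis using l_cancel_one'[of f f] assms by (simp add: hom_group_def)
qed

lemma zero_plus:
  assumes "f \<in> Hom \<C> X Y"
  shows "Zero \<C> X Y \<oplus> f = f"
proof -
  interpret comm_group "hom_group \<C> X Y" using hom_comm_group Hom_Ob[OF assms(1)] by blast
  show ?thesis using l_one[of f] assms by (simp add: hom_group_def)
qed

lemma comp_zero:
  assumes "f \<in> Hom \<C> X Y" "W \<in> Ob \<C>"
  shows "f \<cdot> Zero \<C> W X = Zero \<C> W Y"
proof (rule plus_idem_zero)
  have z: "Zero \<C> W X \<in> Hom \<C> W X" using zero_Hom assms Hom_Ob by blast
  show "f \<cdot> Zero \<C> W X \<in> Hom \<C> W Y" using comp_in_Hom z assms by blast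
  show "f \<cdot> Zero \<C> W X \<oplus> f \<cdot> Zero \<C> W X = f \<cdot> Zero \<C> W X"
    using plus_comp[OF z z assms(1)] zero_plus[OF z] by simp
qed

lemma op_preadditive: "preadditive_category (opposite \<C>)"
  by (rule preadditive_category_opposite) unfold_locales

lemma zero_comp:
  "f \<in> Hom \<C> X Y \<Longrightarrow> W \<in> Ob \<C> \<Longrightarrow> Zero \<C> Y W \<cdot> f = Zero \<C> X W"
  using preadditive_category.comp_zero[OF op_preadditive, of f Y X W] by simp

text \<open>The record has no negation, so the inverse of \<open>hom_group\<close> provides it.
  Differences reduce cancellation to the case of morphisms killed, which is how
  \<open>monicI\<close> works.\<close>

lemma obtain_difference:
  assumes "g \<in> Hom \<C> X Y" "h \<in> Hom \<C> X Y"
  obtains d where "d \<in> Hom \<C> X Y" "g = d \<oplus> h"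
proof -
  interpret comm_group "hom_group \<C> X Y" using hom_comm_group Hom_Ob[OF assms(1)] by blast
  show ?thesis
    using that[of "g \<otimes>\<^bsub>hom_group \<C> X Y\<^esub> inv\<^bsub>hom_group \<C> X Y\<^esub> h"] assms
      m_assoc[of g "inv\<^bsub>hom_group \<C> X Y\<^esub> h" h] inv_closed[of h] m_closed[of g "inv\<^bsub>hom_group \<C> X Y\<^esub> h"]
      l_inv[of h] r_one[of g]
    by (simp add: hom_group_def)
qed

lemma plus_cancel_zero:
  assumes "d \<in> Hom \<C> X Y" "h \<in> Hom \<C> X Y" "d \<oplus> h = h"
  shows "d = Zero \<C> X Y"
proof -
  interpret comm_group "hom_group \<C> X Y" using hom_comm_group Hom_Ob[OF assms(1)] by blast
  show ?thesis using assms r_cancel_one[of h d] by (simp add: hom_group_def)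
qed

lemma monicI:
  assumes f: "f \<in> Hom \<C> X Y"
    and z: "\<And>W g. g \<in> Hom \<C> W X \<Longrightarrow> f \<cdot> g = Zero \<C> W Y \<Longrightarrow> g = Zero \<C> W X"
  shows "monic \<C> f"
proof -
  have "g = h" if gh: "g \<in> Hom \<C> W X" "h \<in> Hom \<C> W X" "f \<cdot> g = f \<cdot> h" for W g h
  proof -
    obtain d where d: "d \<in> Hom \<C> W X" "g = d \<oplus> h" using obtain_difference gh by blast
    have "f \<cdot> d \<oplus> f \<cdot> h = f \<cdot> h" using plus_comp[OF d(1) gh(2) f] d gh by simp
    then have "f \<cdot> d = Zero \<C> W Y" using plus_cancel_zero comp_in_Hom d gh f by blast
    then have "d = Zero \<C> W X" using z d by blast
    then show ?thesis using d zero_plus gh by simp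
  qed
  then show ?thesis using f unfolding monic_def by (auto simp: Hom_def)
qed

lemma epicI:
  assumes "f \<in> Hom \<C> X Y"
    and "\<And>W g. g \<in> Hom \<C> Y W \<Longrightarrow> g \<cdot> f = Zero \<C> X W \<Longrightarrow> g = Zero \<C> Y W"
  shows "epic \<C> f"
  using preadditive_category.monicI[OF op_preadditive, of f Y X] assms by simp

text \<open>If the identity is zero, every morphism into or out of \<open>X\<close> absorbs it and
  vanishes. The equation replaces a quantification over all objects.\<close>

lemma zero_object_iff: "zero_object \<C> X \<longleftrightarrow> X \<in> Ob \<C> \<and> Ident \<C> X = Zero \<C> X X"
proof (intro iffI conjI)
  assume z: "zero_object \<C> X"
  then show X: "X \<in> Ob \<C>" by (simp add: zero_object_def)
  show "Ident \<C> X = Zero \<C> X X" using z X ident_in_Hom zero_Hom unfolding zero_object_def by blast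
next
  assume X: "X \<in> Ob \<C> \<and> Ident \<C> X = Zero \<C> X X"
  have "f = Zero \<C> Y X" if "f \<in> Hom \<C> Y X" for f Y
    using that X ident_left zero_comp Hom_Ob by metis
  moreover have "f = Zero \<C> X Y" if "f \<in> Hom \<C> X Y" for f Y
    using that X ident_right comp_zero Hom_Ob by metis
  ultimately show "zero_object \<C> X" using X zero_Hom unfolding zero_object_def by blast
qed

section \<open>Kernels, cokernels and images under change of representatives\<close>

lemma is_kernelI:
  assumes f: "f \<in> Hom \<C> X Y" and k: "k \<in> Hom \<C> K X" "monic \<C> k" and fk: "f \<cdot> k = Zero \<C> K Y"
    and u: "\<And>W h. h \<in> Hom \<C> W X \<Longrightarrow> f \<cdot> h = Zero \<C> W Y \<Longrightarrow> \<exists>u \<in> Hom \<C> W K. k \<cdot> u = h"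
  shows "is_kernel \<C> f k"
proof -
  have s: "f \<in> Arr \<C>" "k \<in> Arr \<C>" "Dom \<C> f = X" "Cod \<C> f = Y" "Dom \<C> k = K" "Cod \<C> k = X"
    using f k by (auto simp: Hom_def)
  show ?thesis
    unfolding is_kernel_def s
  proof (intro conjI allI ballI impI)
    show "f \<in> Arr \<C>" "k \<in> Arr \<C>" "X = X" "f \<cdot> k = Zero \<C> K Y" using s fk by simp_all
    fix W h assume h: "h \<in> Hom \<C> W X" "f \<cdot> h = Zero \<C> W Y"
    show "\<exists>!u. u \<in> Hom \<C> W K \<and> k \<cdot> u = h" using u[OF h] monicD[OF k(2,1)] by blast
  qed
qed

lemma is_kernelD:
  assumes k: "is_kernel \<C> f k" and f: "f \<in> Hom \<C> X Y"
  shows "k \<in> Hom \<C> (Dom \<C> k) X" "monic \<C> k" "f \<cdot> k = Zero \<C> (Dom \<C> k) Y"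
    "h \<in> Hom \<C> W X \<Longrightarrow> f \<cdot> h = Zero \<C> W Y \<Longrightarrow> \<exists>u \<in> Hom \<C> W (Dom \<C> k). k \<cdot> u = h"
proof -
  have s: "f \<in> Arr \<C>" "Dom \<C> f = X" "Cod \<C> f = Y" using f by (auto simp: Hom_def)
  have univ: "\<exists>!u. u \<in> Hom \<C> W (Dom \<C> k) \<and> k \<cdot> u = h"
    if "h \<in> Hom \<C> W X" "f \<cdot> h = Zero \<C> W Y" for h W
    using k that unfolding is_kernel_def s by blast
  show k1: "k \<in> Hom \<C> (Dom \<C> k) X" and fk: "f \<cdot> k = Zero \<C> (Dom \<C> k) Y"
    using k unfolding is_kernel_def s Hom_def by simp_all
  show "h \<in> Hom \<C> W X \<Longrightarrow> f \<cdot> h = Zero \<C> W Y \<Longrightarrow> \<exists>u \<in> Hom \<C> W (Dom \<C> k). k \<cdot> u = h"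
    using univ by blast
  show "monic \<C> k"
    unfolding monic_def
  proof (intro conjI allI ballI impI)
    show "k \<in> Arr \<C>" using k1 by (simp add: Hom_def)
    fix W g h assume gh: "g \<in> Hom \<C> W (Dom \<C> k)" "h \<in> Hom \<C> W (Dom \<C> k)" "k \<cdot> g = k \<cdot> h"
    \<comment> \<open>Monicity is the uniqueness half of the universal property, applied to
      \<open>k \<cdot> g\<close>: this is killed by \<open>f\<close> and equals \<open>k\<close>
      after \<open>g\<close> as well as \<open>k\<close> after \<open>h\<close>.\<close>
    have "f \<cdot> (k \<cdot> g) = (f \<cdot> k) \<cdot> g" using comp_assoc[OF gh(1) k1 f] by simp
    also have "\<dots> = Zero \<C> W Y" using fk zero_comp[OF gh(1)] Hom_Ob[OF f] by simp
    finally have z: "f \<cdot> (k \<cdot> g) = Zero \<C> W Y" .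
    from univ[OF comp_in_Hom[OF gh(1) k1] z] show "g = h" using gh by metis
  qed
qed

lemma is_cokernelD:
  assumes "is_cokernel \<C> f c" "f \<in> Hom \<C> X Y"
  shows "c \<in> Hom \<C> Y (Cod \<C> c)" "epic \<C> c" "c \<cdot> f = Zero \<C> X (Cod \<C> c)"
    "h \<in> Hom \<C> Y W \<Longrightarrow> h \<cdot> f = Zero \<C> X W \<Longrightarrow> \<exists>u \<in> Hom \<C> (Cod \<C> c) W. u \<cdot> c = h"
  using preadditive_category.is_kernelD[OF op_preadditive, of f c Y X] assms by simp_all

lemma is_kernel_Arr: "is_kernel \<C> f k \<Longrightarrow> f \<in> Hom \<C> (Dom \<C> f) (Cod \<C> f)"
  by (simp add: is_kernel_def Hom_def)

lemma is_cokernel_Arr: "is_cokernel \<C> f c \<Longrightarrow> f \<in> Hom \<C> (Dom \<C> f) (Cod \<C> f)"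
  by (simp add: is_cokernel_def Hom_def)

text \<open>Composing with a monic on the left does not change which morphisms are killed;
  \<open>is_kernel_cancel_monic\<close> is the way back.\<close>

lemma is_kernel_comp_monic:
  assumes k: "is_kernel \<C> f k" and f: "f \<in> Hom \<C> X Y" and b: "b \<in> Hom \<C> Y Z" "monic \<C> b"
  shows "is_kernel \<C> (b \<cdot> f) k"
proof (rule is_kernelI)
  note K = is_kernelD[OF k f]
  show "b \<cdot> f \<in> Hom \<C> X Z" using comp_in_Hom f b by blast
  show "k \<in> Hom \<C> (Dom \<C> k) X" "monic \<C> k" by (fact K)+
  show "(b \<cdot> f) \<cdot> k = Zero \<C> (Dom \<C> k) Z"
    using comp_assoc[OF K(1) f b(1)] K(3) comp_zero[OF b(1)] Hom_Ob[OF K(1)] by simp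
  fix W h assume h: "h \<in> Hom \<C> W X" "(b \<cdot> f) \<cdot> h = Zero \<C> W Z"
  have "b \<cdot> (f \<cdot> h) = b \<cdot> Zero \<C> W Y"
    using comp_assoc[OF h(1) f b(1)] h comp_zero[OF b(1)] Hom_Ob[OF h(1)] by simp
  then have "f \<cdot> h = Zero \<C> W Y"
    using monicD[OF b(2,1) comp_in_Hom[OF h(1) f] zero_Hom] Hom_Ob[OF h(1)] Hom_Ob[OF f] by blast
  then show "\<exists>u \<in> Hom \<C> W (Dom \<C> k). k \<cdot> u = h" using K(4)[OF h(1)] h(2) by blast
qed

lemma is_kernel_comp_iso:
  assumes k: "is_kernel \<C> f k" and f: "f \<in> Hom \<C> X Y"
    and a: "a \<in> Hom \<C> V X" "a' \<in> Hom \<C> X V" "a \<cdot> a' = Ident \<C> X" "a' \<cdot> a = Ident \<C> V"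
  shows "is_kernel \<C> (f \<cdot> a) (a' \<cdot> k)"
proof (rule is_kernelI)
  note K = is_kernelD[OF k f]
  show "f \<cdot> a \<in> Hom \<C> V Y" using comp_in_Hom f a by blast
  show "a' \<cdot> k \<in> Hom \<C> (Dom \<C> k) V" using comp_in_Hom[OF K(1) a(2)] .
  show "monic \<C> (a' \<cdot> k)"
    using monic_comp[OF K(1,2) a(2)] is_iso_monic is_isoI[OF a(2,1,3,4)] by blast
  have "(f \<cdot> a) \<cdot> (a' \<cdot> k) = f \<cdot> ((a \<cdot> a') \<cdot> k)" using f a(1,2) K(1) by (simp add: Hom_def assoc)
  then show "(f \<cdot> a) \<cdot> (a' \<cdot> k) = Zero \<C> (Dom \<C> k) Y" using a(3) K(1,3) ident_left by simp
  fix W h assume h: "h \<in> Hom \<C> W V" "(f \<cdot> a) \<cdot> h = Zero \<C> W Y"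
  then have "f \<cdot> (a \<cdot> h) = Zero \<C> W Y" using f a(1) by (simp add: Hom_def assoc)
  then obtain u where u: "u \<in> Hom \<C> W (Dom \<C> k)" "k \<cdot> u = a \<cdot> h"
    using K(4)[OF comp_in_Hom[OF h(1) a(1)]] by blast
  have "(a' \<cdot> k) \<cdot> u = a' \<cdot> (a \<cdot> h)" using comp_assoc[OF u(1) K(1) a(2)] u(2) by simp
  also have "\<dots> = h" using comp_assoc[OF h(1) a(1,2)] a(4) ident_left[OF h(1)] by simp
  finally show "\<exists>u \<in> Hom \<C> W (Dom \<C> k). (a' \<cdot> k) \<cdot> u = h" using u by blast
qed

lemma is_kernel_unique:
  assumes k: "is_kernel \<C> f k" and l: "is_kernel \<C> f l" and f: "f \<in> Hom \<C> X Y"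
  obtains u where "u \<in> Hom \<C> (Dom \<C> l) (Dom \<C> k)" "is_iso \<C> u" "k \<cdot> u = l"
proof -
  note K = is_kernelD[OF k f] and L = is_kernelD[OF l f]
  obtain u where u: "u \<in> Hom \<C> (Dom \<C> l) (Dom \<C> k)" "k \<cdot> u = l" using K(4)[OF L(1,3)] by blast
  obtain v where v: "v \<in> Hom \<C> (Dom \<C> k) (Dom \<C> l)" "l \<cdot> v = k" using L(4)[OF K(1,3)] by blast
  have D: "Dom \<C> k \<in> Ob \<C>" "Dom \<C> l \<in> Ob \<C>" using Hom_Ob[OF u(1)] by auto
  have "k \<cdot> (u \<cdot> v) = k" using comp_assoc[OF v(1) u(1) K(1)] u v by simp
  then have "u \<cdot> v = Ident \<C> (Dom \<C> k)"
    using monicD[OF K(2,1) comp_in_Hom[OF v(1) u(1)] ident_in_Hom] ident_right[OF K(1)] D by simp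
  moreover have "l \<cdot> (v \<cdot> u) = l" using comp_assoc[OF u(1) v(1) L(1)] u v by simp
  then have "v \<cdot> u = Ident \<C> (Dom \<C> l)"
    using monicD[OF L(2,1) comp_in_Hom[OF u(1) v(1)] ident_in_Hom] ident_right[OF L(1)] D by simp
  ultimately show ?thesis using that[OF u(1) is_isoI[OF u(1) v(1)] u(2)] by blast
qed

lemma is_kernel_unique_obj:
  assumes "is_kernel \<C> f k" "is_kernel \<C> f l"
  shows "isomorphic \<C> (Dom \<C> k) (Dom \<C> l)"
proof -
  obtain u where "u \<in> Hom \<C> (Dom \<C> l) (Dom \<C> k)" "is_iso \<C> u"
    using is_kernel_unique[OF assms is_kernel_Arr[OF assms(1)]] by blast
  then show ?thesis using isomorphic_sym unfolding isomorphic_iff by blast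
qed

lemma is_kernel_iso:
  assumes k: "is_kernel \<C> f k" and f: "f \<in> Hom \<C> X Y" and u: "u \<in> Hom \<C> W (Dom \<C> k)" "is_iso \<C> u"
  shows "is_kernel \<C> f (k \<cdot> u)"
proof (rule is_kernelI[OF f])
  note K = is_kernelD[OF k f]
  show "k \<cdot> u \<in> Hom \<C> W X" using comp_in_Hom[OF u(1) K(1)] .
  show "monic \<C> (k \<cdot> u)" using monic_comp[OF u(1) is_iso_monic[OF u(2)] K(1,2)] .
  show "f \<cdot> (k \<cdot> u) = Zero \<C> W Y"
    using comp_assoc[OF u(1) K(1) f] K(3) zero_comp[OF u(1)] Hom_Ob[OF f] by simp
  fix V h assume h: "h \<in> Hom \<C> V X" "f \<cdot> h = Zero \<C> V Y"
  obtain v where v: "v \<in> Hom \<C> V (Dom \<C> k)" "k \<cdot> v = h" using K(4)[OF h(1)] h(2) by blast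
  obtain u' where u': "u' \<in> Hom \<C> (Dom \<C> k) W" "u \<cdot> u' = Ident \<C> (Dom \<C> k)"
    using u by (auto elim: is_isoE)
  have "(k \<cdot> u) \<cdot> (u' \<cdot> v) = k \<cdot> ((u \<cdot> u') \<cdot> v)"
    using K(1) u u'(1) v(1) by (simp add: Hom_def assoc)
  also have "\<dots> = h" using u' v ident_left by simp
  finally show "\<exists>w \<in> Hom \<C> V W. (k \<cdot> u) \<cdot> w = h" using comp_in_Hom u' v by blast
qed

text \<open>Since \<open>f\<close> is monic, \<open>k\<close> is zero; since \<open>k\<close> is
  monic too, the identity of its domain is then zero.\<close>

lemma kernel_of_monic_zero:
  assumes k: "is_kernel \<C> f k" and f: "monic \<C> f"
  shows "zero_object \<C> (Dom \<C> k)"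
proof -
  have fh: "f \<in> Hom \<C> (Dom \<C> f) (Cod \<C> f)" using is_kernel_Arr[OF k] .
  note K = is_kernelD[OF k fh]
  have D: "Dom \<C> k \<in> Ob \<C>" "Dom \<C> f \<in> Ob \<C>" using Hom_Ob[OF K(1)] by auto
  have "f \<cdot> k = f \<cdot> Zero \<C> (Dom \<C> k) (Dom \<C> f)" using K(3) comp_zero[OF fh D(1)] by simp
  then have "k = Zero \<C> (Dom \<C> k) (Dom \<C> f)" using monicD[OF f fh K(1) zero_Hom[OF D]] by blast
  then have "k \<cdot> Ident \<C> (Dom \<C> k) = k \<cdot> Zero \<C> (Dom \<C> k) (Dom \<C> k)"
    using ident_right[OF K(1)] comp_zero[OF K(1) D(1)] by simp
  then show ?thesis
    using monicD[OF K(2,1) ident_in_Hom[OF D(1)] zero_Hom[OF D(1) D(1)]] zero_object_iff D by blast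
qed

text \<open>Dual of \<open>is_kernel_comp_monic\<close>. In the opposite category \<open>f\<close>
  runs from \<open>Y\<close> to \<open>X\<close>, which explains the order of the instantiated
  objects; the cokernel facts after it are obtained in the same way.\<close>

lemma is_cokernel_comp_epic:
  "is_cokernel \<C> f c \<Longrightarrow> f \<in> Hom \<C> X Y \<Longrightarrow> a \<in> Hom \<C> V X \<Longrightarrow> epic \<C> a \<Longrightarrow> is_cokernel \<C> (f \<cdot> a) c"
  using preadditive_category.is_kernel_comp_monic[OF op_preadditive, of f c Y X a V] by simp

lemma is_cokernel_comp_iso:
  "is_cokernel \<C> f c \<Longrightarrow> f \<in> Hom \<C> X Y \<Longrightarrow> b \<in> Hom \<C> Y Z \<Longrightarrow> b' \<in> Hom \<C> Z Y \<Longrightarrow>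
    b' \<cdot> b = Ident \<C> Y \<Longrightarrow> b \<cdot> b' = Ident \<C> Z \<Longrightarrow> is_cokernel \<C> (b \<cdot> f) (c \<cdot> b')"
  using preadditive_category.is_kernel_comp_iso[OF op_preadditive, of f c Y X b Z b'] by simp

lemma is_cokernel_unique:
  assumes "is_cokernel \<C> f c" "is_cokernel \<C> f d" "f \<in> Hom \<C> X Y"
  obtains u where "u \<in> Hom \<C> (Cod \<C> c) (Cod \<C> d)" "is_iso \<C> u" "u \<cdot> c = d"
  using preadditive_category.is_kernel_unique[OF op_preadditive, of f c d Y X] assms by auto

lemma is_cokernel_unique_obj:
  "is_cokernel \<C> f c \<Longrightarrow> is_cokernel \<C> f d \<Longrightarrow> isomorphic \<C> (Cod \<C> c) (Cod \<C> d)"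
  using preadditive_category.is_kernel_unique_obj[OF op_preadditive, of f c d] by simp

lemma cokernel_of_epic_zero: "is_cokernel \<C> f c \<Longrightarrow> epic \<C> f \<Longrightarrow> zero_object \<C> (Cod \<C> c)"
  using preadditive_category.kernel_of_monic_zero[OF op_preadditive, of f c] by simp

lemma is_iso_epic: "is_iso \<C> f \<Longrightarrow> epic \<C> f"
  using category.is_iso_monic[OF preadditive_category.axioms(1)[OF op_preadditive], of f] by simp

lemma is_kernel_cancel_monic:
  assumes k: "is_kernel \<C> (b \<cdot> f) k" and f: "f \<in> Hom \<C> X Y" and b: "b \<in> Hom \<C> Y Z" "monic \<C> b"
  shows "is_kernel \<C> f k"
proof (rule is_kernelI[OF f])
  note K = is_kernelD[OF k comp_in_Hom[OF f b(1)]]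
  show "k \<in> Hom \<C> (Dom \<C> k) X" "monic \<C> k" by (fact K)+
  have D: "Dom \<C> k \<in> Ob \<C>" "Y \<in> Ob \<C>" "Z \<in> Ob \<C>" using Hom_Ob[OF K(1)] Hom_Ob[OF b(1)] by auto
  have "b \<cdot> (f \<cdot> k) = b \<cdot> Zero \<C> (Dom \<C> k) Y"
    using K(3) comp_assoc[OF K(1) f b(1)] comp_zero[OF b(1) D(1)] by simp
  then show "f \<cdot> k = Zero \<C> (Dom \<C> k) Y"
    using monicD[OF b(2,1) comp_in_Hom[OF K(1) f] zero_Hom[OF D(1,2)]] by blast
  fix W h assume h: "h \<in> Hom \<C> W X" "f \<cdot> h = Zero \<C> W Y"
  have "(b \<cdot> f) \<cdot> h = Zero \<C> W Z"
    using comp_assoc[OF h(1) f b(1)] h(2) comp_zero[OF b(1)] Hom_Ob[OF h(1)] by simp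
  then show "\<exists>u \<in> Hom \<C> W (Dom \<C> k). k \<cdot> u = h" using K(4)[OF h(1)] by blast
qed

text \<open>The two images may be kernels of different cokernels \<open>c\<close> and
  \<open>d\<close> of \<open>f\<close>. These differ by an isomorphism, which as a monic does not
  alter kernels, so both images are kernels of \<open>d\<close>.\<close>

lemma is_image_unique_obj:
  assumes "is_image \<C> f m" "is_image \<C> f n"
  shows "isomorphic \<C> (Dom \<C> m) (Dom \<C> n)"
proof -
  obtain c d where c: "is_cokernel \<C> f c" "is_kernel \<C> c m" and d: "is_cokernel \<C> f d" "is_kernel \<C> d n"
    using assms unfolding is_image_def by blast
  note f = is_cokernel_Arr[OF c(1)]
  obtain u where u: "u \<in> Hom \<C> (Cod \<C> c) (Cod \<C> d)" "is_iso \<C> u" "u \<cdot> c = d"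
    using is_cokernel_unique[OF c(1) d(1) f] by blast
  have "is_kernel \<C> d m"
    using is_kernel_comp_monic[OF c(2) is_cokernelD(1)[OF c(1) f] u(1) is_iso_monic[OF u(2)]] u(3)
    by simp
  then show ?thesis using is_kernel_unique_obj d(2) by blast
qed

lemma is_cokernel_conjugate:
  assumes c: "is_cokernel \<C> f c" and f: "f \<in> Hom \<C> X Y" and a: "a \<in> Hom \<C> V X" "is_iso \<C> a"
    and b: "b \<in> Hom \<C> Y Z" "b' \<in> Hom \<C> Z Y" "b' \<cdot> b = Ident \<C> Y" "b \<cdot> b' = Ident \<C> Z"
  shows "is_cokernel \<C> (b \<cdot> (f \<cdot> a)) (c \<cdot> b')"
  using is_cokernel_comp_iso[OF is_cokernel_comp_epic[OF c f a(1) is_iso_epic[OF a(2)]]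
      comp_in_Hom[OF a(1) f] b] .

text \<open>A full functor lifts a morphism between objects of its essential image only after
  conjugation with isomorphisms; this and \<open>is_cokernel_conjugate\<close> carry images and
  cokernels across that change.\<close>

lemma is_image_conjugate:
  assumes m: "is_image \<C> f m" and f: "f \<in> Hom \<C> X Y" and a: "a \<in> Hom \<C> V X" "is_iso \<C> a"
    and b: "b \<in> Hom \<C> Y Z" "b' \<in> Hom \<C> Z Y" "b' \<cdot> b = Ident \<C> Y" "b \<cdot> b' = Ident \<C> Z"
  shows "is_image \<C> (b \<cdot> (f \<cdot> a)) (b \<cdot> m)"
proof -
  obtain c where c: "is_cokernel \<C> f c" "is_kernel \<C> c m" using m unfolding is_image_def by blast
  show ?thesis unfolding is_image_def
    using is_cokernel_conjugate[OF c(1) f a b]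
      is_kernel_comp_iso[OF c(2) is_cokernelD(1)[OF c(1) f] b(2,1,3,4)] by blast
qed

lemma is_image_Arr: "is_image \<C> f m \<Longrightarrow> f \<in> Hom \<C> (Dom \<C> f) (Cod \<C> f)"
  unfolding is_image_def using is_cokernel_Arr by blast

lemma is_image_Hom: "is_image \<C> f m \<Longrightarrow> f \<in> Hom \<C> X Y \<Longrightarrow> m \<in> Hom \<C> (Dom \<C> m) Y"
  unfolding is_image_def using is_kernelD(1) is_cokernelD(1) by blast

end

context abelian_category
begin

lemma op_abelian: "abelian_category (opposite \<C>)"
  by (rule abelian_category_opposite) unfold_locales

text \<open>\<open>m\<close> is the kernel of some \<open>f\<close>, and \<open>f\<close> factors
  through \<open>c\<close> because it kills \<open>m\<close>. Hence whatever \<open>c\<close> kills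
  is killed by \<open>f\<close> and factors through \<open>m\<close>.\<close>

lemma monic_kernel_of_cokernel:
  assumes m: "monic \<C> m" and c: "is_cokernel \<C> m c"
  shows "is_kernel \<C> c m"
proof -
  define K X where "K = Dom \<C> m" and "X = Cod \<C> m"
  have mh: "m \<in> Hom \<C> K X" using is_cokernel_Arr[OF c] by (simp add: K_def X_def)
  note C = is_cokernelD[OF c mh]
  obtain f where f: "is_kernel \<C> f m" using monic_is_kernel[OF m] by blast
  have fh: "f \<in> Hom \<C> X (Cod \<C> f)" using f by (simp add: is_kernel_def Hom_def X_def)
  note F = is_kernelD[OF f fh, folded K_def]
  obtain t where t: "t \<in> Hom \<C> (Cod \<C> c) (Cod \<C> f)" "t \<cdot> c = f" using C(4)[OF fh F(3)] by blast
  show ?thesis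
  proof (rule is_kernelI[OF C(1) mh m C(3)])
    fix W h assume h: "h \<in> Hom \<C> W X" "c \<cdot> h = Zero \<C> W (Cod \<C> c)"
    have "f \<cdot> h = Zero \<C> W (Cod \<C> f)"
      using comp_assoc[OF h(1) C(1) t(1)] t(2) h(2) comp_zero[OF t(1)] Hom_Ob[OF h(1)] by simp
    then show "\<exists>u \<in> Hom \<C> W K. m \<cdot> u = h" using F(4)[OF h(1)] by blast
  qed
qed

lemma epic_cokernel_of_kernel: "epic \<C> e \<Longrightarrow> is_kernel \<C> e k \<Longrightarrow> is_cokernel \<C> k e"
  using abelian_category.monic_kernel_of_cokernel[OF op_abelian, of e k] by simp

lemma has_images:
  assumes "f \<in> Arr \<C>"
  obtains m where "is_image \<C> f m"
proof -
  obtain c where c: "is_cokernel \<C> f c" using has_cokernels[OF assms] by blast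
  then have "c \<in> Arr \<C>" by (simp add: is_cokernel_def)
  then show ?thesis using has_kernels c that unfolding is_image_def by blast
qed

text \<open>The comparison map \<open>e\<close> onto the image is epic: if \<open>g \<cdot> e = 0\<close>, then \<open>f\<close> factors through
  the subobject \<open>Ker g\<close> of the image, which is the kernel of some \<open>h\<close> killing \<open>f\<close> and hence
  killing the image.\<close>

lemma image_factorization:
  assumes m: "is_image \<C> f m" and f: "f \<in> Hom \<C> X Y"
  obtains e where "e \<in> Hom \<C> X (Dom \<C> m)" "m \<cdot> e = f" "epic \<C> e" "monic \<C> m"
proof -
  obtain c where c: "is_cokernel \<C> f c" "is_kernel \<C> c m" using m unfolding is_image_def by blast
  note C = is_cokernelD[OF c(1) f]
  note M = is_kernelD[OF c(2) C(1)]
  obtain e where e: "e \<in> Hom \<C> X (Dom \<C> m)" "m \<cdot> e = f" using M(4)[OF f C(3)] by blast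
  have "epic \<C> e"
  proof (rule epicI[OF e(1)])
    fix W g assume g: "g \<in> Hom \<C> (Dom \<C> m) W" "g \<cdot> e = Zero \<C> X W"
    have "g \<in> Arr \<C>" using g(1) by (simp add: Hom_def)
    then obtain k where k: "is_kernel \<C> g k" using has_kernels by blast
    note K = is_kernelD[OF k g(1)]
    obtain e' where e': "e' \<in> Hom \<C> X (Dom \<C> k)" "k \<cdot> e' = e" using K(4)[OF e(1) g(2)] by blast
    have mk: "m \<cdot> k \<in> Hom \<C> (Dom \<C> k) Y" "monic \<C> (m \<cdot> k)"
      using comp_in_Hom[OF K(1) M(1)] monic_comp[OF K(1,2) M(1,2)] by auto
    obtain h where h: "is_kernel \<C> h (m \<cdot> k)" using monic_is_kernel[OF mk(2)] by blast
    have hh: "h \<in> Hom \<C> Y (Cod \<C> h)" using h mk(1) by (simp add: is_kernel_def Hom_def)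
    note H = is_kernelD[OF h hh]
    have Dmk: "Dom \<C> (m \<cdot> k) = Dom \<C> k" using mk(1) by (simp add: Hom_def)
    have "f = (m \<cdot> k) \<cdot> e'" using comp_assoc[OF e'(1) K(1) M(1)] e' e by simp
    then have "h \<cdot> f = (h \<cdot> (m \<cdot> k)) \<cdot> e'" using comp_assoc[OF e'(1) mk(1) hh] by simp
    then have "h \<cdot> f = Zero \<C> X (Cod \<C> h)"
      using H(3) Dmk zero_comp[OF e'(1)] Hom_Ob[OF hh] by simp
    then obtain h' where h': "h' \<in> Hom \<C> (Cod \<C> c) (Cod \<C> h)" "h' \<cdot> c = h" using C(4)[OF hh] by blast
    have "h \<cdot> m = Zero \<C> (Dom \<C> m) (Cod \<C> h)"
      using comp_assoc[OF M(1) C(1) h'(1)] h'(2) M(3) comp_zero[OF h'(1)] Hom_Ob[OF M(1)] by simp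
    then obtain t where t: "t \<in> Hom \<C> (Dom \<C> m) (Dom \<C> k)" "(m \<cdot> k) \<cdot> t = m"
      using H(4)[OF M(1)] Dmk by auto
    have "m \<cdot> (k \<cdot> t) = m \<cdot> Ident \<C> (Dom \<C> m)"
      using comp_assoc[OF t(1) K(1) M(1)] t(2) ident_right[OF M(1)] by simp
    then have kt: "k \<cdot> t = Ident \<C> (Dom \<C> m)"
      using monicD[OF M(2,1) comp_in_Hom[OF t(1) K(1)] ident_in_Hom] Hom_Ob[OF M(1)] by blast
    have "g = (g \<cdot> k) \<cdot> t" using comp_assoc[OF t(1) K(1) g(1)] kt ident_right[OF g(1)] by simp
    then show "g = Zero \<C> (Dom \<C> m) W" using K(3) zero_comp[OF t(1)] Hom_Ob[OF g(1)] by simp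
  qed
  then show ?thesis using that e M(2) by blast
qed

text \<open>This is the first isomorphism theorem: as \<open>m\<close> is monic, \<open>e\<close>
  has the same kernel as \<open>f\<close>, and an epic is the cokernel of its kernel.\<close>

lemma image_cokernel_of_kernel:
  assumes m: "is_image \<C> f m" and f: "f \<in> Hom \<C> X Y" and k: "is_kernel \<C> f k"
  obtains e where "e \<in> Hom \<C> X (Dom \<C> m)" "m \<cdot> e = f" "is_cokernel \<C> k e"
proof -
  obtain e where e: "e \<in> Hom \<C> X (Dom \<C> m)" "m \<cdot> e = f" "epic \<C> e" "monic \<C> m"
    using image_factorization[OF m f] .
  have "is_kernel \<C> e k" using is_kernel_cancel_monic[OF _ e(1) is_image_Hom[OF m f] e(4)] e(2) k by simp
  then show ?thesis using that e epic_cokernel_of_kernel by blast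
qed

text \<open>The cokernel map of an epic is zero, so it kills the identity of \<open>Y\<close>, which
  therefore factors through \<open>m\<close>, the kernel of that cokernel.\<close>

lemma monic_epic_is_iso:
  assumes m: "monic \<C> m" and e: "epic \<C> m"
  shows "is_iso \<C> m"
proof -
  define X Y where "X = Dom \<C> m" and "Y = Cod \<C> m"
  have mA: "m \<in> Arr \<C>" using m by (simp add: monic_def)
  have mh: "m \<in> Hom \<C> X Y" using mA by (simp add: Hom_def X_def Y_def)
  obtain c where c: "is_cokernel \<C> m c" using has_cokernels[OF mA] by blast
  note C = is_cokernelD[OF c mh]
  have Q: "Cod \<C> c \<in> Ob \<C>" "X \<in> Ob \<C>" "Y \<in> Ob \<C>" using Hom_Ob[OF C(1)] Hom_Ob[OF mh] by auto
  have "c \<cdot> m = Zero \<C> Y (Cod \<C> c) \<cdot> m" using C(3) zero_comp[OF mh Q(1)] by simp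
  then have "c = Zero \<C> Y (Cod \<C> c)" using epicD[OF e mh C(1) zero_Hom[OF Q(3,1)]] by blast
  then have "c \<cdot> Ident \<C> Y = Zero \<C> Y (Cod \<C> c)" using ident_right[OF C(1)] by simp
  then obtain u where "u \<in> Hom \<C> Y (Dom \<C> m)" "m \<cdot> u = Ident \<C> Y"
    using is_kernelD(4)[OF monic_kernel_of_cokernel[OF m c] C(1) ident_in_Hom[OF Q(3)]] by blast
  then show ?thesis using monic_left_inverse_is_iso[OF m mh] by (simp add: X_def)
qed

text \<open>A monic \<open>f\<close> represents its own image, being the kernel of its cokernel; the
  \<open>m\<close> shared by \<open>Im f\<close> and \<open>Ker g\<close> thus agrees with
  \<open>f\<close> up to an isomorphism. The right-hand side is visibly self-dual and refers only to
  kernels and cokernels.\<close>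

lemma short_exact_iff: "short_exact \<C> f g \<longleftrightarrow> is_kernel \<C> g f \<and> is_cokernel \<C> f g"
proof
  assume s: "short_exact \<C> f g"
  then have f: "monic \<C> f" and g: "epic \<C> g" unfolding short_exact_def by auto
  obtain c m where c: "is_cokernel \<C> f c" "is_kernel \<C> c m" and m: "is_kernel \<C> g m"
    using s unfolding short_exact_def exact_at_def is_image_def by blast
  note cf = monic_kernel_of_cokernel[OF f c(1)]
  obtain u where u: "u \<in> Hom \<C> (Dom \<C> f) (Dom \<C> m)" "is_iso \<C> u" "m \<cdot> u = f"
    using is_kernel_unique[OF c(2) cf is_kernel_Arr[OF cf]] by blast
  have "is_kernel \<C> g f" using is_kernel_iso[OF m is_kernel_Arr[OF m] u(1,2)] u(3) by simp
  then show "is_kernel \<C> g f \<and> is_cokernel \<C> f g" using epic_cokernel_of_kernel[OF g] by blast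
next
  assume a: "is_kernel \<C> g f \<and> is_cokernel \<C> f g"
  then have k: "is_kernel \<C> g f" and c: "is_cokernel \<C> f g" by auto
  show "short_exact \<C> f g"
    unfolding short_exact_def exact_at_def is_image_def
    using is_kernelD(2)[OF k is_kernel_Arr[OF k]] is_cokernelD(2)[OF c is_cokernel_Arr[OF c]] k c
    by blast
qed

lemma short_exact_opposite: "short_exact (opposite \<C>) g f \<longleftrightarrow> short_exact \<C> f g"
  using abelian_category.short_exact_iff[OF op_abelian, of g f] short_exact_iff by auto

text \<open>Chase of a generalised element \<open>h\<close> of \<open>Y\<close> with
  \<open>b \<cdot> h\<close> zero: \<open>c\<close> being monic, \<open>g\<close> kills
  \<open>h\<close>, so \<open>h\<close> comes from some \<open>w\<close> into \<open>X\<close>; then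
  \<open>f'\<close> and \<open>a\<close>, both monic, force \<open>w\<close> to vanish.\<close>

lemma five_lemma_monic:
  assumes s: "short_exact \<C> f g" and s': "short_exact \<C> f' g'"
    and f: "f \<in> Hom \<C> X Y" and g: "g \<in> Hom \<C> Y Z"
    and f': "f' \<in> Hom \<C> X' Y'" and g': "g' \<in> Hom \<C> Y' Z'"
    and a: "a \<in> Hom \<C> X X'" "monic \<C> a" and b: "b \<in> Hom \<C> Y Y'" and c: "c \<in> Hom \<C> Z Z'" "monic \<C> c"
    and sq: "b \<cdot> f = f' \<cdot> a" "c \<cdot> g = g' \<cdot> b"
  shows "monic \<C> b"
proof (rule monicI[OF b])
  fix W h assume h: "h \<in> Hom \<C> W Y" "b \<cdot> h = Zero \<C> W Y'"
  have O: "W \<in> Ob \<C>" "X \<in> Ob \<C>" "X' \<in> Ob \<C>" "Z \<in> Ob \<C>"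
    using Hom_Ob[OF h(1)] Hom_Ob[OF f] Hom_Ob[OF f'] Hom_Ob[OF g] by auto
  have Df: "Dom \<C> f = X" using f by (simp add: Hom_def)
  note K = is_kernelD[OF conjunct1[OF s[unfolded short_exact_iff]] g, unfolded Df]
  have mf': "monic \<C> f'" using s' by (simp add: short_exact_def)
  have "c \<cdot> (g \<cdot> h) = g' \<cdot> (b \<cdot> h)"
    using comp_assoc[OF h(1) g c(1)] comp_assoc[OF h(1) b g'] sq by simp
  also have "\<dots> = c \<cdot> Zero \<C> W Z" using h(2) comp_zero[OF g' O(1)] comp_zero[OF c(1) O(1)] by simp
  finally have "g \<cdot> h = Zero \<C> W Z"
    using monicD[OF c(2,1) comp_in_Hom[OF h(1) g] zero_Hom[OF O(1,4)]] by blast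
  then obtain w where w: "w \<in> Hom \<C> W X" "f \<cdot> w = h" using K(4)[OF h(1)] by blast
  have "f' \<cdot> (a \<cdot> w) = b \<cdot> (f \<cdot> w)"
    using comp_assoc[OF w(1) a(1) f'] comp_assoc[OF w(1) f b] sq by simp
  also have "\<dots> = f' \<cdot> Zero \<C> W X'" using w h(2) comp_zero[OF f' O(1)] by simp
  finally have "a \<cdot> w = a \<cdot> Zero \<C> W X"
    using monicD[OF mf' f' comp_in_Hom[OF w(1) a(1)] zero_Hom[OF O(1,3)]] comp_zero[OF a(1) O(1)] by simp
  then have "w = Zero \<C> W X" using monicD[OF a(2,1) w(1) zero_Hom[OF O(1,2)]] by blast
  then show "h = Zero \<C> W Y" using w(2) comp_zero[OF f O(1)] by simp
qed

lemma five_lemma: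
  assumes s: "short_exact \<C> f g" and s': "short_exact \<C> f' g'"
    and f: "f \<in> Hom \<C> X Y" and g: "g \<in> Hom \<C> Y Z"
    and f': "f' \<in> Hom \<C> X' Y'" and g': "g' \<in> Hom \<C> Y' Z'"
    and a: "a \<in> Hom \<C> X X'" "is_iso \<C> a" and b: "b \<in> Hom \<C> Y Y'" and c: "c \<in> Hom \<C> Z Z'" "is_iso \<C> c"
    and sq: "b \<cdot> f = f' \<cdot> a" "c \<cdot> g = g' \<cdot> b"
  shows "is_iso \<C> b"
proof (rule monic_epic_is_iso)
  show "monic \<C> b"
    using five_lemma_monic[OF s s' f g f' g' a(1) is_iso_monic[OF a(2)] b c(1) is_iso_monic[OF c(2)] sq] .
  \<comment> \<open>Turning all arrows makes the primed row the source and swaps the two maps in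
    each row as well as \<open>a\<close> and \<open>c\<close>.\<close>
  show "epic \<C> b"
    using abelian_category.five_lemma_monic[OF op_abelian, of g' f' g f Z' Y' X' Z Y X c b a]
      assms is_iso_epic[OF a(2)] is_iso_epic[OF c(2)] by (simp add: short_exact_opposite)
qed

text \<open>The identity of \<open>Y\<close> is killed by \<open>g\<close>, whose target is zero,
  and hence factors through the zero object \<open>X\<close>.\<close>

lemma short_exact_zero_ends:
  assumes s: "short_exact \<C> f g" and f: "f \<in> Hom \<C> X Y" and g: "g \<in> Hom \<C> Y Z"
    and z: "zero_object \<C> X" "zero_object \<C> Z"
  shows "zero_object \<C> Y"
proof -
  have O: "X \<in> Ob \<C>" "Y \<in> Ob \<C>" "Z \<in> Ob \<C>" using Hom_Ob[OF f] Hom_Ob[OF g] by auto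
  have Df: "Dom \<C> f = X" using f by (simp add: Hom_def)
  have "g \<cdot> Ident \<C> Y = Zero \<C> Y Z"
    using z(2) O(2) ident_right[OF g] g zero_Hom[OF O(2,3)] unfolding zero_object_def by metis
  then obtain u where u: "u \<in> Hom \<C> Y X" "f \<cdot> u = Ident \<C> Y"
    using is_kernelD(4)[OF conjunct1[OF s[unfolded short_exact_iff]] g ident_in_Hom[OF O(2)]] Df by auto
  have "u = Zero \<C> Y X"
    using z(1) O(2) u(1) zero_Hom[OF O(2,1)] unfolding zero_object_def by metis
  then have "Ident \<C> Y = Zero \<C> Y Y" using u(2) comp_zero[OF f O(2)] by simp
  then show ?thesis using O(2) zero_object_iff by blast
qed

section \<open>Members of an ICE-closed subcategory\<close>

lemma ICE_closed_replete: "ICE_closed \<C> S \<Longrightarrow> isomorphic \<C> X Y \<Longrightarrow> X \<in> S \<Longrightarrow> Y \<in> S"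
  unfolding ICE_closed_def replete_subcategory_def by blast

lemma ICE_closed_cokernel:
  "ICE_closed \<C> S \<Longrightarrow> is_cokernel \<C> f c \<Longrightarrow> Dom \<C> f \<in> S \<Longrightarrow> Cod \<C> f \<in> S \<Longrightarrow> Cod \<C> c \<in> S"
  unfolding ICE_closed_def using is_cokernel_Arr by blast

lemma ICE_closed_image:
  "ICE_closed \<C> S \<Longrightarrow> is_image \<C> f m \<Longrightarrow> Dom \<C> f \<in> S \<Longrightarrow> Cod \<C> f \<in> S \<Longrightarrow> Dom \<C> m \<in> S"
  unfolding ICE_closed_def using is_image_Arr by blast

lemma ICE_closed_extension:
  "ICE_closed \<C> S \<Longrightarrow> short_exact \<C> f g \<Longrightarrow> f \<in> Hom \<C> X Y \<Longrightarrow> g \<in> Hom \<C> Y Z \<Longrightarrow> X \<in> S \<Longrightarrow> Z \<in> S \<Longrightarrow> Y \<in> S"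
  unfolding ICE_closed_def by blast

text \<open>The cokernel of the identity of any member is a zero object, and zero objects are
  isomorphic. Some member has to exist to start from.\<close>

lemma ICE_closed_zero:
  assumes S: "ICE_closed \<C> S" "S \<noteq> {}" and Z: "zero_object \<C> Z"
  shows "Z \<in> S"
proof -
  obtain X where X: "X \<in> S" using S by blast
  then have XO: "X \<in> Ob \<C>" using S unfolding ICE_closed_def replete_subcategory_def by blast
  obtain c where c: "is_cokernel \<C> (Ident \<C> X) c" using has_cokernels ident_simps(1)[OF XO] by blast
  have Qz: "zero_object \<C> (Cod \<C> c)" using cokernel_of_epic_zero[OF c is_iso_epic[OF is_iso_ident[OF XO]]] .
  have Q: "Cod \<C> c \<in> S" using ICE_closed_cokernel[OF S(1) c] X XO by simp
  have O: "Z \<in> Ob \<C>" "Cod \<C> c \<in> Ob \<C>" using Z Qz by (auto simp: zero_object_def)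
  note z = zero_Hom[OF O] zero_Hom[OF O(2,1)]
  have "isomorphic \<C> (Cod \<C> c) Z"
    unfolding isomorphic_def
    using O z Qz Z comp_zero[OF z(1) O(2)] comp_zero[OF z(2) O(1)] zero_object_iff by metis
  then show ?thesis using ICE_closed_replete[OF S(1)] Q by blast
qed

text \<open>Closure under images does not apply to \<open>h\<close>, whose target is not yet known
  to lie in \<open>S\<close>. The image is reached instead as the cokernel of \<open>k\<close>, a
  morphism between members; \<open>X\<close> is then an extension of the cokernel of
  \<open>h\<close> by the image.\<close>

lemma ICE_closed_codomain:
  assumes S: "ICE_closed \<C> S" and h: "h \<in> Hom \<C> M X" and k: "is_kernel \<C> h k" and c: "is_cokernel \<C> h c"
    and in_S: "M \<in> S" "Dom \<C> k \<in> S" "Cod \<C> c \<in> S"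
  shows "X \<in> S"
proof -
  have hA: "h \<in> Arr \<C>" using h by (simp add: Hom_def)
  note C = is_cokernelD[OF c h] and K = is_kernelD[OF k h]
  have "c \<in> Arr \<C>" using C(1) by (simp add: Hom_def)
  then obtain m where m: "is_kernel \<C> c m" using has_kernels by blast
  have im: "is_image \<C> h m" using c m by (auto simp: is_image_def)
  obtain e where e: "e \<in> Hom \<C> M (Dom \<C> m)" "m \<cdot> e = h" "is_cokernel \<C> k e"
    using image_cokernel_of_kernel[OF im h k] .
  have Ce: "Cod \<C> e = Dom \<C> m" using e(1) by (simp add: Hom_def)
  have Ck: "Cod \<C> k = M" using K(1) by (simp add: Hom_def)
  have "Dom \<C> m \<in> S" using ICE_closed_cokernel[OF S e(3)] Ce Ck in_S by simp
  moreover have "short_exact \<C> m c"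
    using short_exact_iff epic_cokernel_of_kernel[OF C(2) m] m by blast
  ultimately show ?thesis
    using ICE_closed_extension[OF S _ is_kernelD(1)[OF m C(1)] C(1)] in_S by blast
qed

end

section \<open>Additive functors\<close>

locale additive = A: abelian_category \<A> + B: abelian_category \<B>
  for \<A> :: "('o1, 'm1, 'y) preadditive_scheme" and \<B> :: "('o2, 'm2, 'z) preadditive_scheme" +
  fixes F :: "('o1, 'm1, 'o2, 'm2) ftor"
  assumes F: "additive_functor \<A> \<B> F"
begin

lemma F_Ob: "X \<in> Ob \<A> \<Longrightarrow> obj_map F X \<in> Ob \<B>"
  using F unfolding additive_functor_def by blast

lemma F_Hom: "f \<in> Hom \<A> X Y \<Longrightarrow> arr_map F f \<in> Hom \<B> (obj_map F X) (obj_map F Y)"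
  using F unfolding additive_functor_def by blast

lemma F_ident: "X \<in> Ob \<A> \<Longrightarrow> arr_map F (Ident \<A> X) = Ident \<B> (obj_map F X)"
  using F unfolding additive_functor_def by blast

lemma F_comp:
  "f \<in> Hom \<A> X Y \<Longrightarrow> g \<in> Hom \<A> Y Z \<Longrightarrow> arr_map F (g \<cdot>\<^bsub>\<A>\<^esub> f) = arr_map F g \<cdot>\<^bsub>\<B>\<^esub> arr_map F f"
  using F unfolding additive_functor_def by blast

lemma F_zero:
  assumes "X \<in> Ob \<A>" "Y \<in> Ob \<A>"
  shows "arr_map F (Zero \<A> X Y) = Zero \<B> (obj_map F X) (obj_map F Y)"
proof -
  note z = A.zero_Hom[OF assms]
  have "arr_map F (Zero \<A> X Y \<oplus>\<^bsub>\<A>\<^esub> Zero \<A> X Y) = arr_map F (Zero \<A> X Y) \<oplus>\<^bsub>\<B>\<^esub> arr_map F (Zero \<A> X Y)"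
    using F z unfolding additive_functor_def by blast
  then show ?thesis using A.zero_plus[OF z] B.plus_idem_zero[OF F_Hom[OF z]] by simp
qed

lemma F_is_iso:
  assumes "is_iso \<A> f" "f \<in> Hom \<A> X Y"
  shows "is_iso \<B> (arr_map F f)"
proof -
  obtain g where g: "g \<in> Hom \<A> Y X" "g \<cdot>\<^bsub>\<A>\<^esub> f = Ident \<A> X" "f \<cdot>\<^bsub>\<A>\<^esub> g = Ident \<A> Y"
    using assms by (auto elim: A.is_isoE)
  show ?thesis
    using B.is_isoI[OF F_Hom[OF assms(2)] F_Hom[OF g(1)]]
      F_comp[OF assms(2) g(1)] F_comp[OF g(1) assms(2)] g F_ident A.Hom_Ob[OF g(1)] by simp
qed

lemma F_isomorphic: "isomorphic \<A> X Y \<Longrightarrow> isomorphic \<B> (obj_map F X) (obj_map F Y)"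
  unfolding A.isomorphic_iff B.isomorphic_iff using F_is_iso F_Hom by blast

lemma F_in_ess_image: "X \<in> Ob \<A> \<Longrightarrow> X \<in> S \<Longrightarrow> obj_map F X \<in> ess_image \<B> F S"
  by (rule ess_imageI) (auto intro: B.isomorphic_refl F_Ob)

lemma op_additive: "additive (opposite \<A>) (opposite \<B>) F"
  using A.op_abelian B.op_abelian additive_functor_opposite[OF F]
  by (simp add: additive_def additive_axioms_def)

end

text \<open>A predicate with the two categories as arguments, so that preservation of cokernels is
  the same predicate on opposite categories and every result about right adjoints dualises to left
  adjoints.\<close>

definition preserves_kernels ::
  "('o1, 'm1, 'y) preadditive_scheme \<Rightarrow> ('o2, 'm2, 'z) preadditive_scheme \<Rightarrow>
   ('o1, 'm1, 'o2, 'm2) ftor \<Rightarrow> bool" where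
  "preserves_kernels \<C> \<D> F \<longleftrightarrow>
     (\<forall>f k. is_kernel \<C> f k \<longrightarrow> is_kernel \<D> (arr_map F f) (arr_map F k))"

abbreviation preserves_cokernels ::
  "('o1, 'm1, 'y) preadditive_scheme \<Rightarrow> ('o2, 'm2, 'z) preadditive_scheme \<Rightarrow>
   ('o1, 'm1, 'o2, 'm2) ftor \<Rightarrow> bool" where
  "preserves_cokernels \<C> \<D> \<equiv> preserves_kernels (opposite \<C>) (opposite \<D>)"

context additive
begin

text \<open>Factor \<open>f\<close> as \<open>m\<close> after \<open>e\<close> through its image.
  Both \<open>k, e\<close> and \<open>m, c\<close> are short exact, so \<open>F\<close> keeps
  \<open>k\<close> the kernel of \<open>e\<close> and keeps \<open>m\<close> monic; composing with a
  monic leaves the kernel unchanged.\<close>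

lemma exact_preserves_kernels:
  assumes ex: "\<And>f g. short_exact \<A> f g \<Longrightarrow> short_exact \<B> (arr_map F f) (arr_map F g)"
  shows "preserves_kernels \<A> \<B> F"
  unfolding preserves_kernels_def
proof (intro allI impI)
  fix f k assume k: "is_kernel \<A> f k"
  note f = A.is_kernel_Arr[OF k]
  obtain m where m: "is_image \<A> f m" using A.has_images k by (auto simp: is_kernel_def)
  obtain e where e: "e \<in> Hom \<A> (Dom \<A> f) (Dom \<A> m)" "m \<cdot>\<^bsub>\<A>\<^esub> e = f" "is_cokernel \<A> k e"
    using A.image_cokernel_of_kernel[OF m f k] .
  note mh = A.is_image_Hom[OF m f]
  obtain c where c: "is_cokernel \<A> f c" "is_kernel \<A> c m" using m by (auto simp: is_image_def)
  have mm: "monic \<A> m" using A.is_kernelD(2)[OF c(2) A.is_kernel_Arr[OF c(2)]] .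
  have "is_kernel \<A> e k"
    using A.is_kernel_cancel_monic[OF _ e(1) mh mm] e(2) k by simp
  then have "short_exact \<A> k e" using A.short_exact_iff e(3) by blast
  then have Fk: "is_kernel \<B> (arr_map F e) (arr_map F k)" using ex B.short_exact_iff by blast
  have "epic \<A> c" using A.is_cokernelD(2)[OF c(1) f] .
  then have "short_exact \<A> m c" using A.short_exact_iff A.epic_cokernel_of_kernel c(2) by blast
  then have "monic \<B> (arr_map F m)" using ex unfolding short_exact_def by blast
  then show "is_kernel \<B> (arr_map F f) (arr_map F k)"
    using B.is_kernel_comp_monic[OF Fk F_Hom[OF e(1)] F_Hom[OF mh]] F_comp[OF e(1) mh] e(2) by simp
qed

end

lemma (in additive) exact_functor_preserves:
  assumes "exact_functor \<A> \<B> F"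
  shows "preserves_kernels \<A> \<B> F" "preserves_cokernels \<A> \<B> F"
proof -
  have ex: "short_exact \<A> f g \<Longrightarrow> short_exact \<B> (arr_map F f) (arr_map F g)" for f g
    using assms unfolding exact_functor_def by blast
  show "preserves_kernels \<A> \<B> F" using exact_preserves_kernels[OF ex] by blast
  show "preserves_cokernels \<A> \<B> F"
    using additive.exact_preserves_kernels[OF op_additive] ex
    by (simp add: A.short_exact_opposite B.short_exact_opposite)
qed

text \<open>Exactness in the form in which adjoints deliver it, one half from each side. Images and
  short exact sequences are built from kernels and cokernels and follow.\<close>

locale exact_additive = additive +
  assumes kernels: "preserves_kernels \<A> \<B> F" and cokernels: "preserves_cokernels \<A> \<B> F"
begin

lemma F_kernel: "is_kernel \<A> f k \<Longrightarrow> is_kernel \<B> (arr_map F f) (arr_map F k)"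
  using kernels unfolding preserves_kernels_def by blast

lemma F_cokernel: "is_cokernel \<A> f c \<Longrightarrow> is_cokernel \<B> (arr_map F f) (arr_map F c)"
  using cokernels unfolding preserves_kernels_def by simp

lemma F_image: "is_image \<A> f m \<Longrightarrow> is_image \<B> (arr_map F f) (arr_map F m)"
  unfolding is_image_def using F_kernel F_cokernel by blast

lemma F_short_exact: "short_exact \<A> f g \<Longrightarrow> short_exact \<B> (arr_map F f) (arr_map F g)"
  unfolding A.short_exact_iff B.short_exact_iff using F_kernel F_cokernel by blast

lemma F_Dom: "f \<in> Arr \<A> \<Longrightarrow> Dom \<B> (arr_map F f) = obj_map F (Dom \<A> f)"
  using F_Hom[OF A.Arr_Hom] by (simp add: Hom_def)

lemma F_Cod: "f \<in> Arr \<A> \<Longrightarrow> Cod \<B> (arr_map F f) = obj_map F (Cod \<A> f)"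
  using F_Hom[OF A.Arr_Hom] by (simp add: Hom_def)

lemma ICE_closed_preimage:
  assumes D: "ICE_closed \<B> D"
  shows "ICE_closed \<A> {X \<in> Ob \<A>. obj_map F X \<in> D}"
  unfolding ICE_closed_def replete_subcategory_def
proof (intro conjI allI ballI impI)
  show "{X \<in> Ob \<A>. obj_map F X \<in> D} \<subseteq> Ob \<A>" by blast
  fix X Y assume "X \<in> {X \<in> Ob \<A>. obj_map F X \<in> D}" "isomorphic \<A> X Y"
  then show "Y \<in> {X \<in> Ob \<A>. obj_map F X \<in> D}"
    using B.ICE_closed_replete[OF D F_isomorphic, of X Y] unfolding isomorphic_def[of \<A> X Y] by blast
next
  fix M N f m assume M: "M \<in> {X \<in> Ob \<A>. obj_map F X \<in> D}" "N \<in> {X \<in> Ob \<A>. obj_map F X \<in> D}"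
    and f: "f \<in> Hom \<A> M N" and m: "is_image \<A> f m"
  have fA: "f \<in> Arr \<A>" "Dom \<A> f = M" "Cod \<A> f = N" using f by (auto simp: Hom_def)
  have mh: "m \<in> Hom \<A> (Dom \<A> m) N" using A.is_image_Hom[OF m f] .
  then have "m \<in> Arr \<A>" by (simp add: Hom_def)
  then show "Dom \<A> m \<in> {X \<in> Ob \<A>. obj_map F X \<in> D}"
    using B.ICE_closed_image[OF D F_image[OF m]] M fA F_Dom F_Cod A.Hom_Ob[OF mh] by simp
next
  fix M N f c assume M: "M \<in> {X \<in> Ob \<A>. obj_map F X \<in> D}" "N \<in> {X \<in> Ob \<A>. obj_map F X \<in> D}"
    and f: "f \<in> Hom \<A> M N" and c: "is_cokernel \<A> f c"
  have fA: "f \<in> Arr \<A>" "Dom \<A> f = M" "Cod \<A> f = N" using f by (auto simp: Hom_def)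
  have ch: "c \<in> Hom \<A> N (Cod \<A> c)" using A.is_cokernelD(1)[OF c f] .
  then have "c \<in> Arr \<A>" by (simp add: Hom_def)
  then show "Cod \<A> c \<in> {X \<in> Ob \<A>. obj_map F X \<in> D}"
    using B.ICE_closed_cokernel[OF D F_cokernel[OF c]] M fA F_Dom F_Cod A.Hom_Ob[OF ch] by simp
next
  fix X Y Z f g assume f: "f \<in> Hom \<A> X Y" and g: "g \<in> Hom \<A> Y Z"
    and s: "short_exact \<A> f g \<and> X \<in> {X \<in> Ob \<A>. obj_map F X \<in> D} \<and> Z \<in> {X \<in> Ob \<A>. obj_map F X \<in> D}"
  then show "Y \<in> {X \<in> Ob \<A>. obj_map F X \<in> D}"
    using B.ICE_closed_extension[OF D F_short_exact F_Hom[OF f] F_Hom[OF g]] A.Hom_Ob[OF g] by simp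
qed

end

section \<open>Fully faithful functors and their essential images\<close>

locale full_additive = additive +
  assumes ff: "fully_faithful \<A> \<B> F"
begin

lemma F_full:
  assumes "X \<in> Ob \<A>" "Y \<in> Ob \<A>" "g \<in> Hom \<B> (obj_map F X) (obj_map F Y)"
  obtains f where "f \<in> Hom \<A> X Y" "arr_map F f = g"
proof -
  have "g \<in> arr_map F ` Hom \<A> X Y"
    using assms ff unfolding fully_faithful_def bij_betw_def by blast
  then show ?thesis using that by blast
qed

lemma F_faithful:
  assumes "f \<in> Hom \<A> X Y" "g \<in> Hom \<A> X Y" "arr_map F f = arr_map F g"
  shows "f = g"
  using assms ff A.Hom_Ob[OF assms(1)] unfolding fully_faithful_def bij_betw_def inj_on_def by blast

lemma op_full_additive: "full_additive (opposite \<A>) (opposite \<B>) F"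
  using op_additive ff by (simp add: full_additive_def full_additive_axioms_def)

text \<open>The universal property in \<open>\<B>\<close> is tested only against objects in the
  image of \<open>F\<close>: fullness lifts the factorisation, faithfulness lifts the
  equations.\<close>

lemma reflects_kernel:
  assumes f: "f \<in> Hom \<A> X Y" and k: "k \<in> Hom \<A> K X" and Fk: "is_kernel \<B> (arr_map F f) (arr_map F k)"
  shows "is_kernel \<A> f k"
proof (rule A.is_kernelI[OF f k])
  have O: "X \<in> Ob \<A>" "Y \<in> Ob \<A>" "K \<in> Ob \<A>" using A.Hom_Ob[OF f] A.Hom_Ob[OF k] by auto
  have D: "Dom \<B> (arr_map F k) = obj_map F K" using F_Hom[OF k] by (simp add: Hom_def)
  note K = B.is_kernelD[OF Fk F_Hom[OF f], unfolded D]
  show "f \<cdot>\<^bsub>\<A>\<^esub> k = Zero \<A> K Y"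
    by (rule F_faithful[OF A.comp_in_Hom[OF k f] A.zero_Hom[OF O(3,2)]])
      (simp add: F_comp[OF k f] F_zero[OF O(3,2)] K(3))
  show "monic \<A> k"
    unfolding monic_def
  proof (intro conjI allI ballI impI)
    show "k \<in> Arr \<A>" using k by (simp add: Hom_def)
    fix W g h assume gh: "g \<in> Hom \<A> W (Dom \<A> k)" "h \<in> Hom \<A> W (Dom \<A> k)" "k \<cdot>\<^bsub>\<A>\<^esub> g = k \<cdot>\<^bsub>\<A>\<^esub> h"
    have gh': "g \<in> Hom \<A> W K" "h \<in> Hom \<A> W K" using gh(1,2) k by (auto simp: Hom_def)
    show "g = h"
      by (rule F_faithful[OF gh'], rule B.monicD[OF K(2,1) F_Hom[OF gh'(1)] F_Hom[OF gh'(2)]])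
        (simp only: F_comp[OF gh'(1) k, symmetric] F_comp[OF gh'(2) k, symmetric] gh(3))
  qed
  fix W h assume h: "h \<in> Hom \<A> W X" "f \<cdot>\<^bsub>\<A>\<^esub> h = Zero \<A> W Y"
  have W: "W \<in> Ob \<A>" using A.Hom_Ob[OF h(1)] by simp
  have "arr_map F f \<cdot>\<^bsub>\<B>\<^esub> arr_map F h = Zero \<B> (obj_map F W) (obj_map F Y)"
    using F_comp[OF h(1) f] h(2) F_zero[OF W O(2)] by simp
  then obtain v where v: "v \<in> Hom \<B> (obj_map F W) (obj_map F K)" "arr_map F k \<cdot>\<^bsub>\<B>\<^esub> v = arr_map F h"
    using K(4)[OF F_Hom[OF h(1)]] by blast
  obtain u where u: "u \<in> Hom \<A> W K" "arr_map F u = v" using F_full[OF W O(3) v(1)] .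
  have "k \<cdot>\<^bsub>\<A>\<^esub> u = h"
    by (rule F_faithful[OF A.comp_in_Hom[OF u(1) k] h(1)]) (simp add: F_comp[OF u(1) k] u(2) v(2))
  then show "\<exists>u \<in> Hom \<A> W K. k \<cdot>\<^bsub>\<A>\<^esub> u = h" using u(1) by blast
qed

lemma reflects_cokernel:
  "f \<in> Hom \<A> X Y \<Longrightarrow> c \<in> Hom \<A> Y Q \<Longrightarrow> is_cokernel \<B> (arr_map F f) (arr_map F c) \<Longrightarrow> is_cokernel \<A> f c"
  using full_additive.reflects_kernel[OF op_full_additive, of f Y X c Q] by simp

lemma ess_imageE:
  assumes "M \<in> ess_image \<B> F S"
  obtains X a a' where "X \<in> S" "a \<in> Hom \<B> (obj_map F X) M" "a' \<in> Hom \<B> M (obj_map F X)"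
    "a' \<cdot>\<^bsub>\<B>\<^esub> a = Ident \<B> (obj_map F X)" "a \<cdot>\<^bsub>\<B>\<^esub> a' = Ident \<B> M"
  using assms unfolding ess_image_def isomorphic_def by blast

end

locale exact_full_additive = exact_additive + full_additive
begin

text \<open>Up to isomorphism a morphism between members of the essential image is \<open>F\<close>
  of a morphism between members of \<open>C\<close>, and exactness lets images and cokernels be
  computed in \<open>\<A>\<close>. For extensions \<open>ext\<close> provides the middle object,
  after which the whole sequence can be lifted.\<close>

lemma ICE_closed_ess_image:
  assumes C: "ICE_closed \<A> C"
    and ext: "\<And>X Y Z f g. short_exact \<B> f g \<Longrightarrow> f \<in> Hom \<B> X Y \<Longrightarrow> g \<in> Hom \<B> Y Z \<Longrightarrow>
      X \<in> ess_image \<B> F (Ob \<A>) \<Longrightarrow> Z \<in> ess_image \<B> F (Ob \<A>) \<Longrightarrow> Y \<in> ess_image \<B> F (Ob \<A>)"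
  shows "ICE_closed \<B> (ess_image \<B> F C)"
proof -
  have CO: "C \<subseteq> Ob \<A>" using C by (simp add: ICE_closed_def replete_subcategory_def)
  have im: "Dom \<B> m \<in> ess_image \<B> F C" (is ?im)
    and coker: "is_cokernel \<B> f c \<Longrightarrow> Cod \<B> c \<in> ess_image \<B> F C"
    if MN: "M \<in> ess_image \<B> F C" "N \<in> ess_image \<B> F C" and f: "f \<in> Hom \<B> M N"
      and m: "is_image \<B> f m" for M N f m c
  proof -
    obtain X a a' where X: "X \<in> C" and a: "a \<in> Hom \<B> (obj_map F X) M" "a' \<in> Hom \<B> M (obj_map F X)"
      "a' \<cdot>\<^bsub>\<B>\<^esub> a = Ident \<B> (obj_map F X)" "a \<cdot>\<^bsub>\<B>\<^esub> a' = Ident \<B> M"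
      using MN(1) by (rule ess_imageE)
    obtain Y b b' where Y: "Y \<in> C" and b: "b \<in> Hom \<B> (obj_map F Y) N" "b' \<in> Hom \<B> N (obj_map F Y)"
      "b' \<cdot>\<^bsub>\<B>\<^esub> b = Ident \<B> (obj_map F Y)" "b \<cdot>\<^bsub>\<B>\<^esub> b' = Ident \<B> N"
      using MN(2) by (rule ess_imageE)
    have ia: "is_iso \<B> a" using B.is_isoI[OF a] .
    have XY: "X \<in> Ob \<A>" "Y \<in> Ob \<A>" using X Y CO by auto
    \<comment> \<open>The conjugate of \<open>f\<close> has both ends of the form \<open>F\<close>
      of an object, so fullness applies to it.\<close>
    have f': "b' \<cdot>\<^bsub>\<B>\<^esub> (f \<cdot>\<^bsub>\<B>\<^esub> a) \<in> Hom \<B> (obj_map F X) (obj_map F Y)"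
      using B.comp_in_Hom[OF B.comp_in_Hom[OF a(1) f] b(2)] .
    obtain g where g: "g \<in> Hom \<A> X Y" "arr_map F g = b' \<cdot>\<^bsub>\<B>\<^esub> (f \<cdot>\<^bsub>\<B>\<^esub> a)" using F_full[OF XY f'] .
    have gA: "g \<in> Arr \<A>" "Dom \<A> g = X" "Cod \<A> g = Y" using g(1) by (auto simp: Hom_def)
    obtain n where n: "is_image \<A> g n" using A.has_images[OF gA(1)] .
    have nA: "n \<in> Arr \<A>" using A.is_image_Hom[OF n g(1)] by (simp add: Hom_def)
    have "Dom \<A> n \<in> C" using A.ICE_closed_image[OF C n] gA X Y by simp
    moreover have "isomorphic \<B> (Dom \<B> (arr_map F n)) (Dom \<B> (b' \<cdot>\<^bsub>\<B>\<^esub> m))"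
      using B.is_image_unique_obj[OF F_image[OF n]] B.is_image_conjugate[OF m f a(1) ia b(2,1,4,3)] g(2) by simp
    moreover have "Dom \<B> (b' \<cdot>\<^bsub>\<B>\<^esub> m) = Dom \<B> m"
      using B.comp_in_Hom[OF B.is_image_Hom[OF m f] b(2)] by (simp add: Hom_def)
    ultimately show ?im using F_Dom[OF nA] ess_imageI by metis
    assume c: "is_cokernel \<B> f c"
    obtain d where d: "is_cokernel \<A> g d" using A.has_cokernels[OF gA(1)] by blast
    have dA: "d \<in> Arr \<A>" using d by (simp add: is_cokernel_def)
    have "Cod \<A> d \<in> C" using A.ICE_closed_cokernel[OF C d] gA X Y by simp
    moreover have "isomorphic \<B> (Cod \<B> (arr_map F d)) (Cod \<B> (c \<cdot>\<^bsub>\<B>\<^esub> b))"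
      using B.is_cokernel_unique_obj[OF F_cokernel[OF d]] B.is_cokernel_conjugate[OF c f a(1) ia b(2,1,4,3)] g(2) by simp
    moreover have "Cod \<B> (c \<cdot>\<^bsub>\<B>\<^esub> b) = Cod \<B> c"
      using B.comp_in_Hom[OF b(1) B.is_cokernelD(1)[OF c f]] by (simp add: Hom_def)
    ultimately show "Cod \<B> c \<in> ess_image \<B> F C" using F_Cod[OF dA] ess_imageI by metis
  qed
  have sub: "ess_image \<B> F C \<subseteq> ess_image \<B> F (Ob \<A>)" using CO unfolding ess_image_def by blast
  have extC: "N \<in> ess_image \<B> F C"
    if f: "f \<in> Hom \<B> M N" and g: "g \<in> Hom \<B> N L" and s: "short_exact \<B> f g"
      and ends: "M \<in> ess_image \<B> F C" "L \<in> ess_image \<B> F C" for M N L f g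
  proof -
    \<comment> \<open>This only gives some \<open>Y\<close> in \<open>\<A>\<close>; that
      \<open>Y\<close> lies in \<open>C\<close> has to be shown by closure of \<open>C\<close> under
      extensions in \<open>\<A>\<close>.\<close>
    have "N \<in> ess_image \<B> F (Ob \<A>)" using ext[OF s f g] ends sub by blast
    then obtain Y b b' where Y: "Y \<in> Ob \<A>" and b: "b \<in> Hom \<B> (obj_map F Y) N" "b' \<in> Hom \<B> N (obj_map F Y)"
      "b' \<cdot>\<^bsub>\<B>\<^esub> b = Ident \<B> (obj_map F Y)" "b \<cdot>\<^bsub>\<B>\<^esub> b' = Ident \<B> N"
      by (rule ess_imageE)
    obtain X a a' where X: "X \<in> C" and a: "a \<in> Hom \<B> (obj_map F X) M" "a' \<in> Hom \<B> M (obj_map F X)"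
      "a' \<cdot>\<^bsub>\<B>\<^esub> a = Ident \<B> (obj_map F X)" "a \<cdot>\<^bsub>\<B>\<^esub> a' = Ident \<B> M"
      using ends(1) by (rule ess_imageE)
    obtain Z c c' where Z: "Z \<in> C" and c: "c \<in> Hom \<B> (obj_map F Z) L" "c' \<in> Hom \<B> L (obj_map F Z)"
      "c' \<cdot>\<^bsub>\<B>\<^esub> c = Ident \<B> (obj_map F Z)" "c \<cdot>\<^bsub>\<B>\<^esub> c' = Ident \<B> L"
      using ends(2) by (rule ess_imageE)
    have XZ: "X \<in> Ob \<A>" "Z \<in> Ob \<A>" using X Z CO by auto
    have ia: "is_iso \<B> a" and ib: "is_iso \<B> b" and ic: "is_iso \<B> c'"
      using B.is_isoI[OF a] B.is_isoI[OF b] B.is_isoI[OF c(2,1,4,3)] by auto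
    define f' where "f' = b' \<cdot>\<^bsub>\<B>\<^esub> (f \<cdot>\<^bsub>\<B>\<^esub> a)"
    define g' where "g' = c' \<cdot>\<^bsub>\<B>\<^esub> (g \<cdot>\<^bsub>\<B>\<^esub> b)"
    have f'h: "f' \<in> Hom \<B> (obj_map F X) (obj_map F Y)"
      using B.comp_in_Hom[OF B.comp_in_Hom[OF a(1) f] b(2)] by (simp add: f'_def)
    have g'h: "g' \<in> Hom \<B> (obj_map F Y) (obj_map F Z)"
      using B.comp_in_Hom[OF B.comp_in_Hom[OF b(1) g] c(2)] by (simp add: g'_def)
    obtain p where p: "p \<in> Hom \<A> X Y" "arr_map F p = f'" using F_full[OF XZ(1) Y f'h] .
    obtain q where q: "q \<in> Hom \<A> Y Z" "arr_map F q = g'" using F_full[OF Y XZ(2) g'h] .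
    have k: "is_kernel \<B> g f" and ck: "is_cokernel \<B> f g" using s B.short_exact_iff by auto
    have gb: "g \<cdot>\<^bsub>\<B>\<^esub> b \<in> Hom \<B> (obj_map F Y) L" using B.comp_in_Hom[OF b(1) g] .
    \<comment> \<open>Kernel of \<open>g'\<close> in three moves: transport along \<open>b\<close>,
      compose on the left with the monic \<open>c'\<close>, and reparametrise the kernel by
      \<open>a\<close>.\<close>
    have "is_kernel \<B> g' (b' \<cdot>\<^bsub>\<B>\<^esub> f)"
      using B.is_kernel_comp_monic[OF B.is_kernel_comp_iso[OF k g b(1,2,4,3)] gb c(2) B.is_iso_monic[OF ic]]
      by (simp add: g'_def)
    moreover have "a \<in> Hom \<B> (obj_map F X) (Dom \<B> (b' \<cdot>\<^bsub>\<B>\<^esub> f))"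
      using a(1) B.comp_in_Hom[OF f b(2)] by (simp add: Hom_def)
    moreover have "f' = (b' \<cdot>\<^bsub>\<B>\<^esub> f) \<cdot>\<^bsub>\<B>\<^esub> a"
      using B.comp_assoc[OF a(1) f b(2)] by (simp add: f'_def)
    ultimately have K: "is_kernel \<B> g' f'" using B.is_kernel_iso[OF _ g'h _ ia] by simp
    have "epic \<B> g" using s by (simp add: short_exact_def)
    \<comment> \<open>Epics compose because monics do in the opposite category.\<close>
    moreover have "epic \<B> h \<Longrightarrow> epic \<B> h' \<Longrightarrow> h \<in> Hom \<B> U V \<Longrightarrow> h' \<in> Hom \<B> V W \<Longrightarrow> epic \<B> (h' \<cdot>\<^bsub>\<B>\<^esub> h)"
      for h h' U V W
      using category.monic_comp[OF preadditive_category.axioms(1)[OF B.op_preadditive], of h' W V h U] by simp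
    ultimately have "epic \<B> g'"
      unfolding g'_def using B.is_iso_epic[OF ib] B.is_iso_epic[OF ic] b(1) g gb c(2) by metis
    then have CK: "is_cokernel \<B> f' g'" using B.epic_cokernel_of_kernel K by blast
    have "short_exact \<A> p q"
      unfolding A.short_exact_iff
      using reflects_kernel[OF q(1) p(1)] reflects_cokernel[OF p(1) q(1)] K CK p(2) q(2) by simp
    then have "Y \<in> C" using A.ICE_closed_extension[OF C _ p(1) q(1)] X Z by blast
    moreover have "isomorphic \<B> (obj_map F Y) N" using B.isomorphic_iff b(1) ib by blast
    ultimately show ?thesis by (rule ess_imageI)
  qed
  \<comment> \<open>\<open>coker\<close> shares the lifted morphism, and therefore its block, with
    \<open>im\<close>, and so assumes an image \<open>m\<close> of \<open>f\<close>;
    \<open>has_images\<close> supplies one.\<close>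
  have coker': "Cod \<B> c \<in> ess_image \<B> F C"
    if h: "M \<in> ess_image \<B> F C" "N \<in> ess_image \<B> F C" "f \<in> Hom \<B> M N" "is_cokernel \<B> f c" for M N f c
  proof -
    obtain m where m: "is_image \<B> f m" using B.has_images h(3) by (auto simp: Hom_def)
    show ?thesis using coker[OF h(1-3) m h(4)] .
  qed
  show ?thesis
    unfolding ICE_closed_def
  proof (intro conjI allI ballI impI)
    show "replete_subcategory \<B> (ess_image \<B> F C)" by (rule B.ess_image_replete)
  next
    fix X Y Z f g assume "f \<in> Hom \<B> X Y" "g \<in> Hom \<B> Y Z"
      "short_exact \<B> f g \<and> X \<in> ess_image \<B> F C \<and> Z \<in> ess_image \<B> F C"
    then show "Y \<in> ess_image \<B> F C" using extC[of f X Y g Z] by blast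
  qed (use im coker' in blast)+
qed

end

section \<open>Adjunctions\<close>

locale adjunction = F: additive \<C> \<D> F + G: additive \<D> \<C> G
  for \<C> :: "('o1, 'm1, 'y) preadditive_scheme" and \<D> :: "('o2, 'm2, 'z) preadditive_scheme"
    and F G +
  assumes adj: "adjoint_pair \<C> \<D> F G"
begin

text \<open>\<open>adjoint_pair\<close> merely asserts that a natural family of bijections exists.
  One is fixed here, so that unit and counit become well-defined terms belonging to the same
  family.\<close>

definition transpose :: "'o1 \<Rightarrow> 'o2 \<Rightarrow> 'm2 \<Rightarrow> 'm1" where
  "transpose = (SOME \<phi>. (\<forall>X \<in> Ob \<C>. \<forall>Y \<in> Ob \<D>.
             bij_betw (\<phi> X Y) (Hom \<D> (obj_map F X) Y) (Hom \<C> X (obj_map G Y))) \<and>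
          (\<forall>X \<in> Ob \<C>. \<forall>X' \<in> Ob \<C>. \<forall>Y \<in> Ob \<D>. \<forall>Y' \<in> Ob \<D>.
             \<forall>u \<in> Hom \<C> X' X. \<forall>v \<in> Hom \<D> Y Y'. \<forall>f \<in> Hom \<D> (obj_map F X) Y.
               \<phi> X' Y' (v \<cdot>\<^bsub>\<D>\<^esub> (f \<cdot>\<^bsub>\<D>\<^esub> arr_map F u)) = arr_map G v \<cdot>\<^bsub>\<C>\<^esub> (\<phi> X Y f \<cdot>\<^bsub>\<C>\<^esub> u)))"

lemma transpose_bij:
    "X \<in> Ob \<C> \<Longrightarrow> Y \<in> Ob \<D> \<Longrightarrow>
      bij_betw (transpose X Y) (Hom \<D> (obj_map F X) Y) (Hom \<C> X (obj_map G Y))"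
  and transpose_natural:
    "u \<in> Hom \<C> X' X \<Longrightarrow> v \<in> Hom \<D> Y Y' \<Longrightarrow> f \<in> Hom \<D> (obj_map F X) Y \<Longrightarrow>
      transpose X' Y' (v \<cdot>\<^bsub>\<D>\<^esub> (f \<cdot>\<^bsub>\<D>\<^esub> arr_map F u)) = arr_map G v \<cdot>\<^bsub>\<C>\<^esub> (transpose X Y f \<cdot>\<^bsub>\<C>\<^esub> u)"
proof -
  note t = someI_ex[OF adj[unfolded adjoint_pair_def], folded transpose_def]
  show "X \<in> Ob \<C> \<Longrightarrow> Y \<in> Ob \<D> \<Longrightarrow>
      bij_betw (transpose X Y) (Hom \<D> (obj_map F X) Y) (Hom \<C> X (obj_map G Y))"
    using conjunct1[OF t] by blast
  assume u: "u \<in> Hom \<C> X' X" and v: "v \<in> Hom \<D> Y Y'" and f: "f \<in> Hom \<D> (obj_map F X) Y"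
  have O: "X \<in> Ob \<C>" "X' \<in> Ob \<C>" "Y \<in> Ob \<D>" "Y' \<in> Ob \<D>"
    using F.A.Hom_Ob[OF u] F.B.Hom_Ob[OF v] by auto
  show "transpose X' Y' (v \<cdot>\<^bsub>\<D>\<^esub> (f \<cdot>\<^bsub>\<D>\<^esub> arr_map F u)) = arr_map G v \<cdot>\<^bsub>\<C>\<^esub> (transpose X Y f \<cdot>\<^bsub>\<C>\<^esub> u)"
    by (rule conjunct2[OF t, rule_format, OF O u v f])
qed

lemma transpose_Hom:
  "X \<in> Ob \<C> \<Longrightarrow> f \<in> Hom \<D> (obj_map F X) Y \<Longrightarrow> transpose X Y f \<in> Hom \<C> X (obj_map G Y)"
  using bij_betw_apply[OF transpose_bij[of X Y]] F.B.Hom_Ob[of f] by blast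

lemma transpose_inj:
  assumes "X \<in> Ob \<C>" "f \<in> Hom \<D> (obj_map F X) Y" "g \<in> Hom \<D> (obj_map F X) Y"
    "transpose X Y f = transpose X Y g"
  shows "f = g"
  using inj_onD[OF bij_betw_imp_inj_on[OF transpose_bij[of X Y]]] assms F.B.Hom_Ob[OF assms(2)] by blast

lemma transpose_surj:
  assumes "Y \<in> Ob \<D>" "g \<in> Hom \<C> X (obj_map G Y)"
  obtains f where "f \<in> Hom \<D> (obj_map F X) Y" "transpose X Y f = g"
proof -
  have "g \<in> transpose X Y ` Hom \<D> (obj_map F X) Y"
    using bij_betw_imp_surj_on[OF transpose_bij[of X Y]] assms F.A.Hom_Ob[OF assms(2)] by simp
  then show ?thesis using that by blast
qed

lemma transpose_left:
  assumes X: "X \<in> Ob \<C>" and f: "f \<in> Hom \<D> (obj_map F X) Y" and v: "v \<in> Hom \<D> Y Y'"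
  shows "transpose X Y' (v \<cdot>\<^bsub>\<D>\<^esub> f) = arr_map G v \<cdot>\<^bsub>\<C>\<^esub> transpose X Y f"
  using transpose_natural[OF F.A.ident_in_Hom[OF X] v f] F.F_ident[OF X] F.B.ident_right[OF f]
    F.A.ident_right[OF transpose_Hom[OF X f]] by simp

lemma transpose_right:
  assumes f: "f \<in> Hom \<D> (obj_map F X) Y" and u: "u \<in> Hom \<C> X' X"
  shows "transpose X' Y (f \<cdot>\<^bsub>\<D>\<^esub> arr_map F u) = transpose X Y f \<cdot>\<^bsub>\<C>\<^esub> u"
proof -
  have O: "X \<in> Ob \<C>" "Y \<in> Ob \<D>" using F.A.Hom_Ob[OF u] F.B.Hom_Ob[OF f] by auto
  show ?thesis
    using transpose_natural[OF u F.B.ident_in_Hom[OF O(2)] f] G.F_ident[OF O(2)]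
      F.B.ident_left[OF F.B.comp_in_Hom[OF F.F_Hom[OF u] f]]
      F.A.ident_left[OF F.A.comp_in_Hom[OF u transpose_Hom[OF O(1) f]]] by simp
qed

section \<open>Unit, counit and duality of adjunctions\<close>

definition unit :: "'o1 \<Rightarrow> 'm1" where
  "unit X = transpose X (obj_map F X) (Ident \<D> (obj_map F X))"

definition counit :: "'o2 \<Rightarrow> 'm2" where
  "counit Y = (SOME f. f \<in> Hom \<D> (obj_map F (obj_map G Y)) Y \<and>
     transpose (obj_map G Y) Y f = Ident \<C> (obj_map G Y))"

lemma unit_Hom: "X \<in> Ob \<C> \<Longrightarrow> unit X \<in> Hom \<C> X (obj_map G (obj_map F X))"
  unfolding unit_def using transpose_Hom F.B.ident_in_Hom[OF F.F_Ob] by blast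

lemma counit:
  assumes "Y \<in> Ob \<D>"
  shows "counit Y \<in> Hom \<D> (obj_map F (obj_map G Y)) Y"
    "transpose (obj_map G Y) Y (counit Y) = Ident \<C> (obj_map G Y)"
proof -
  have "\<exists>f. f \<in> Hom \<D> (obj_map F (obj_map G Y)) Y \<and>
     transpose (obj_map G Y) Y f = Ident \<C> (obj_map G Y)"
    using transpose_surj[OF assms F.A.ident_in_Hom[OF G.F_Ob[OF assms]]] by blast
  from someI_ex[OF this, folded counit_def]
  show "counit Y \<in> Hom \<D> (obj_map F (obj_map G Y)) Y"
    "transpose (obj_map G Y) Y (counit Y) = Ident \<C> (obj_map G Y)" by auto
qed

text \<open>Naturality in the first variable at an identity. It says that composing with the unit is
  the action of \<open>F\<close> followed by a bijection, so properties of \<open>F\<close> on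
  morphisms become properties of the unit.\<close>

lemma transpose_F:
  assumes u: "u \<in> Hom \<C> X X'"
  shows "transpose X (obj_map F X') (arr_map F u) = unit X' \<cdot>\<^bsub>\<C>\<^esub> u"
  using transpose_right[OF F.B.ident_in_Hom[OF F.F_Ob] u] F.A.Hom_Ob[OF u] F.B.ident_left[OF F.F_Hom[OF u]]
  by (simp add: unit_def)

lemma unit_natural:
  assumes u: "u \<in> Hom \<C> X X'"
  shows "arr_map G (arr_map F u) \<cdot>\<^bsub>\<C>\<^esub> unit X = unit X' \<cdot>\<^bsub>\<C>\<^esub> u"
  using transpose_left[OF _ F.B.ident_in_Hom[OF F.F_Ob] F.F_Hom[OF u]] F.A.Hom_Ob[OF u]
    F.B.ident_right[OF F.F_Hom[OF u]] transpose_F[OF u]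
  by (simp add: unit_def)

lemma counit_natural:
  assumes v: "v \<in> Hom \<D> Y Y'"
  shows "v \<cdot>\<^bsub>\<D>\<^esub> counit Y = counit Y' \<cdot>\<^bsub>\<D>\<^esub> arr_map F (arr_map G v)"
proof -
  have O: "Y \<in> Ob \<D>" "Y' \<in> Ob \<D>" using F.B.Hom_Ob[OF v] by auto
  note Gv = G.F_Hom[OF v] and e = counit[OF O(1)] and e' = counit[OF O(2)]
  show ?thesis
    by (rule transpose_inj[OF G.F_Ob[OF O(1)] F.B.comp_in_Hom[OF e(1) v]
        F.B.comp_in_Hom[OF F.F_Hom[OF Gv] e'(1)]])
      (simp add: transpose_left[OF G.F_Ob[OF O(1)] e(1) v] transpose_right[OF e'(1) Gv] e(2) e'(2)
        F.A.ident_left[OF Gv] F.A.ident_right[OF Gv])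
qed

text \<open>One triangle identity: transpose the counit composed with an identity, the transpose of
  that identity being the unit. \<open>counit_F_unit\<close> is the other one, checked after
  transposing.\<close>

lemma G_counit_unit:
  assumes Y: "Y \<in> Ob \<D>"
  shows "arr_map G (counit Y) \<cdot>\<^bsub>\<C>\<^esub> unit (obj_map G Y) = Ident \<C> (obj_map G Y)"
  using transpose_left[OF G.F_Ob[OF Y] F.B.ident_in_Hom[OF F.F_Ob[OF G.F_Ob[OF Y]]] counit(1)[OF Y]]
    counit[OF Y] F.B.ident_right[OF counit(1)[OF Y]] by (simp add: unit_def)

lemma counit_F_unit:
  assumes X: "X \<in> Ob \<C>"
  shows "counit (obj_map F X) \<cdot>\<^bsub>\<D>\<^esub> arr_map F (unit X) = Ident \<D> (obj_map F X)"
proof -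
  note FX = F.F_Ob[OF X] and u = unit_Hom[OF X]
  note e = counit[OF FX]
  show ?thesis
    by (rule transpose_inj[OF X F.B.comp_in_Hom[OF F.F_Hom[OF u] e(1)] F.B.ident_in_Hom[OF FX]])
      (simp add: transpose_right[OF e(1) u] e(2) F.A.ident_left[OF u], simp add: unit_def)
qed

text \<open>The inverse bijections serve as the family for the opposite categories, with
  \<open>G\<close> now on the left. Their naturality is verified after applying the injective
  \<open>transpose\<close>.\<close>

lemma adjoint_pair_opposite: "adjoint_pair (opposite \<D>) (opposite \<C>) G F"
proof -
  define \<psi> where "\<psi> Y X = inv_into (Hom \<D> (obj_map F X) Y) (transpose X Y)" for Y X
  have \<psi>: "\<psi> Y X f \<in> Hom \<D> (obj_map F X) Y" "transpose X Y (\<psi> Y X f) = f"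
    if "X \<in> Ob \<C>" "Y \<in> Ob \<D>" "f \<in> Hom \<C> X (obj_map G Y)" for X Y f
    unfolding \<psi>_def using bij_betw_imp_surj_on[OF transpose_bij[OF that(1,2)]] that(3)
    by (simp_all add: inv_into_into f_inv_into_f)
  have bij: "bij_betw (\<psi> Y X) (Hom \<C> X (obj_map G Y)) (Hom \<D> (obj_map F X) Y)"
    if "X \<in> Ob \<C>" "Y \<in> Ob \<D>" for X Y
    unfolding \<psi>_def by (rule bij_betw_inv_into[OF transpose_bij[OF that]])
  have nat: "\<psi> Y' X' ((arr_map G u \<cdot>\<^bsub>\<C>\<^esub> f) \<cdot>\<^bsub>\<C>\<^esub> v) = (u \<cdot>\<^bsub>\<D>\<^esub> \<psi> Y X f) \<cdot>\<^bsub>\<D>\<^esub> arr_map F v"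
    if u: "u \<in> Hom \<D> Y Y'" and v: "v \<in> Hom \<C> X' X" and f: "f \<in> Hom \<C> X (obj_map G Y)" for X X' Y Y' u v f
  proof -
    have O: "Y \<in> Ob \<D>" "Y' \<in> Ob \<D>" "X \<in> Ob \<C>" "X' \<in> Ob \<C>"
      using F.B.Hom_Ob[OF u] F.A.Hom_Ob[OF v] by auto
    note p = \<psi>[OF O(3,1) f]
    have h: "(arr_map G u \<cdot>\<^bsub>\<C>\<^esub> f) \<cdot>\<^bsub>\<C>\<^esub> v \<in> Hom \<C> X' (obj_map G Y')"
      using F.A.comp_in_Hom[OF v F.A.comp_in_Hom[OF f G.F_Hom[OF u]]] .
    note q = \<psi>[OF O(4,2) h]
    have up: "u \<cdot>\<^bsub>\<D>\<^esub> \<psi> Y X f \<in> Hom \<D> (obj_map F X) Y'" using F.B.comp_in_Hom[OF p(1) u] .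
    have r: "(u \<cdot>\<^bsub>\<D>\<^esub> \<psi> Y X f) \<cdot>\<^bsub>\<D>\<^esub> arr_map F v \<in> Hom \<D> (obj_map F X') Y'"
      using F.B.comp_in_Hom[OF F.F_Hom[OF v] up] .
    show ?thesis
      by (rule transpose_inj[OF O(4) q(1) r])
        (simp only: q(2) transpose_right[OF up v] transpose_left[OF O(3) p(1) u] p(2))
  qed
  show ?thesis
    unfolding adjoint_pair_def opposite_simps Hom_opposite
    by (rule exI[of _ \<psi>]) (use bij nat in blast)
qed

lemma op_adjunction: "adjunction (opposite \<D>) (opposite \<C>) G F"
  using F.op_additive G.op_additive adjoint_pair_opposite
  by (simp add: adjunction_def adjunction_axioms_def)

text \<open>Transposition turns a test morphism from \<open>W\<close> into a value of
  \<open>G\<close> into a morphism out of \<open>F\<close> of \<open>W\<close>, where the universal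
  property of \<open>k\<close> is available.\<close>

lemma right_adjoint_preserves_kernels: "preserves_kernels \<D> \<C> G"
  unfolding preserves_kernels_def
proof (intro allI impI)
  fix f k assume k: "is_kernel \<D> f k"
  define K X Y where "K = Dom \<D> k" and "X = Dom \<D> f" and "Y = Cod \<D> f"
  have f: "f \<in> Hom \<D> X Y" using F.B.is_kernel_Arr[OF k] by (simp add: X_def Y_def)
  note K = F.B.is_kernelD[OF k f, folded K_def]
  have O: "X \<in> Ob \<D>" "Y \<in> Ob \<D>" "K \<in> Ob \<D>" using F.B.Hom_Ob[OF f] F.B.Hom_Ob[OF K(1)] by auto
  note Gf = G.F_Hom[OF f] and Gk = G.F_Hom[OF K(1)]
  show "is_kernel \<C> (arr_map G f) (arr_map G k)"
  proof (rule F.A.is_kernelI[OF Gf Gk])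
    show "arr_map G f \<cdot>\<^bsub>\<C>\<^esub> arr_map G k = Zero \<C> (obj_map G K) (obj_map G Y)"
      using G.F_comp[OF K(1) f] K(3) G.F_zero[OF O(3,2)] by simp
    show "monic \<C> (arr_map G k)"
      unfolding monic_def
    proof (intro conjI allI ballI impI)
      show "arr_map G k \<in> Arr \<C>" using Gk by (simp add: Hom_def)
      fix W a b assume "a \<in> Hom \<C> W (Dom \<C> (arr_map G k))" "b \<in> Hom \<C> W (Dom \<C> (arr_map G k))"
        and eq: "arr_map G k \<cdot>\<^bsub>\<C>\<^esub> a = arr_map G k \<cdot>\<^bsub>\<C>\<^esub> b"
      then have ab: "a \<in> Hom \<C> W (obj_map G K)" "b \<in> Hom \<C> W (obj_map G K)"
        using Gk by (auto simp: Hom_def)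
      have W: "W \<in> Ob \<C>" using F.A.Hom_Ob[OF ab(1)] by simp
      obtain a' where a': "a' \<in> Hom \<D> (obj_map F W) K" "transpose W K a' = a"
        using transpose_surj[OF O(3) ab(1)] .
      obtain b' where b': "b' \<in> Hom \<D> (obj_map F W) K" "transpose W K b' = b"
        using transpose_surj[OF O(3) ab(2)] .
      have "k \<cdot>\<^bsub>\<D>\<^esub> a' = k \<cdot>\<^bsub>\<D>\<^esub> b'"
        by (rule transpose_inj[OF W F.B.comp_in_Hom[OF a'(1) K(1)] F.B.comp_in_Hom[OF b'(1) K(1)]])
          (simp only: transpose_left[OF W a'(1) K(1)] transpose_left[OF W b'(1) K(1)] a'(2) b'(2) eq)
      then have "a' = b'" by (rule F.B.monicD[OF K(2,1) a'(1) b'(1)])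
      then show "a = b" using a'(2) b'(2) by simp
    qed
    fix W h assume h: "h \<in> Hom \<C> W (obj_map G X)"
      "arr_map G f \<cdot>\<^bsub>\<C>\<^esub> h = Zero \<C> W (obj_map G Y)"
    have W: "W \<in> Ob \<C>" using F.A.Hom_Ob[OF h(1)] by simp
    obtain h' where h': "h' \<in> Hom \<D> (obj_map F W) X" "transpose W X h' = h"
      using transpose_surj[OF O(1) h(1)] .
    have z: "Zero \<D> X Y \<in> Hom \<D> X Y" using F.B.zero_Hom[OF O(1,2)] .
    \<comment> \<open>\<open>transpose\<close> is known only as a bijection of sets, so zero is
      written as a zero morphism after \<open>h'\<close>; naturality and additivity of
      \<open>G\<close> then evaluate its transpose.\<close>
    have "transpose W Y (Zero \<D> X Y \<cdot>\<^bsub>\<D>\<^esub> h') = Zero \<C> W (obj_map G Y)"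
      using transpose_left[OF W h'(1) z] h'(2) G.F_zero[OF O(1,2)]
        F.A.zero_comp[OF h(1) G.F_Ob[OF O(2)]] by simp
    then have "f \<cdot>\<^bsub>\<D>\<^esub> h' = Zero \<D> X Y \<cdot>\<^bsub>\<D>\<^esub> h'"
      by (intro transpose_inj[OF W F.B.comp_in_Hom[OF h'(1) f] F.B.comp_in_Hom[OF h'(1) z]])
        (simp only: transpose_left[OF W h'(1) f] h'(2) h(2))
    then have "f \<cdot>\<^bsub>\<D>\<^esub> h' = Zero \<D> (obj_map F W) Y" using F.B.zero_comp[OF h'(1) O(2)] by simp
    then obtain u where u: "u \<in> Hom \<D> (obj_map F W) K" "k \<cdot>\<^bsub>\<D>\<^esub> u = h'" using K(4)[OF h'(1)] by blast
    have "arr_map G k \<cdot>\<^bsub>\<C>\<^esub> transpose W K u = h" using transpose_left[OF W u(1) K(1)] u(2) h'(2) by simp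
    then show "\<exists>u \<in> Hom \<C> W (obj_map G K). arr_map G k \<cdot>\<^bsub>\<C>\<^esub> u = h"
      using transpose_Hom[OF W u(1)] by blast
  qed
qed

end

lemma (in adjunction) left_adjoint_preserves_cokernels: "preserves_cokernels \<C> \<D> F"
  using adjunction.right_adjoint_preserves_kernels[OF op_adjunction] .

section \<open>Adjunctions with fully faithful left adjoint\<close>

locale full_adjunction = adjunction + full_additive \<C> \<D> F
begin

text \<open>By \<open>transpose_F\<close>, composing with the unit is a bijection when
  \<open>F\<close> is fully faithful. Injectivity makes the unit monic, and a preimage of the
  identity is a right inverse.\<close>

lemma unit_is_iso:
  assumes X: "X \<in> Ob \<C>"
  shows "is_iso \<C> (unit X)"
proof -
  let ?Z = "obj_map G (obj_map F X)"
  have Z: "?Z \<in> Ob \<C>" using G.F_Ob[OF F.F_Ob[OF X]] .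
  have m: "monic \<C> (unit X)"
    unfolding monic_def
  proof (intro conjI allI ballI impI)
    show "unit X \<in> Arr \<C>" using unit_Hom[OF X] by (simp add: Hom_def)
    fix W a b assume "a \<in> Hom \<C> W (Dom \<C> (unit X))" "b \<in> Hom \<C> W (Dom \<C> (unit X))"
      and eq: "unit X \<cdot>\<^bsub>\<C>\<^esub> a = unit X \<cdot>\<^bsub>\<C>\<^esub> b"
    then have ab: "a \<in> Hom \<C> W X" "b \<in> Hom \<C> W X" using unit_Hom[OF X] by (auto simp: Hom_def)
    have W: "W \<in> Ob \<C>" using F.A.Hom_Ob[OF ab(1)] by simp
    have "arr_map F a = arr_map F b"
      by (rule transpose_inj[OF W F.F_Hom[OF ab(1)] F.F_Hom[OF ab(2)]])
        (simp only: transpose_F[OF ab(1)] transpose_F[OF ab(2)] eq)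
    then show "a = b" using F_faithful[OF ab] by blast
  qed
  obtain g where g: "g \<in> Hom \<D> (obj_map F ?Z) (obj_map F X)" "transpose ?Z (obj_map F X) g = Ident \<C> ?Z"
    using transpose_surj[OF F.F_Ob[OF X] F.A.ident_in_Hom[OF Z]] .
  obtain u where u: "u \<in> Hom \<C> ?Z X" "arr_map F u = g" using F_full[OF Z X g(1)] .
  have "unit X \<cdot>\<^bsub>\<C>\<^esub> u = Ident \<C> ?Z" using transpose_F[OF u(1)] u(2) g(2) by simp
  then show ?thesis using F.A.monic_left_inverse_is_iso[OF m unit_Hom[OF X] u(1)] by blast
qed

text \<open>Naturality of the unit, solved for \<open>G\<close> applied to \<open>F\<close> applied
  to \<open>f\<close>; \<open>a\<close> is the inverse of the unit at \<open>X\<close>. In this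
  shape the conjugation lemmas for images apply.\<close>

lemma GF_conjugate:
  assumes f: "f \<in> Hom \<C> X Y"
  obtains a where "a \<in> Hom \<C> (obj_map G (obj_map F X)) X" "is_iso \<C> a"
    "arr_map G (arr_map F f) = unit Y \<cdot>\<^bsub>\<C>\<^esub> (f \<cdot>\<^bsub>\<C>\<^esub> a)"
proof -
  have O: "X \<in> Ob \<C>" "Y \<in> Ob \<C>" using F.A.Hom_Ob[OF f] by auto
  note uX = unit_Hom[OF O(1)] and uY = unit_Hom[OF O(2)] and GFf = G.F_Hom[OF F.F_Hom[OF f]]
  obtain a where a: "a \<in> Hom \<C> (obj_map G (obj_map F X)) X"
    "unit X \<cdot>\<^bsub>\<C>\<^esub> a = Ident \<C> (obj_map G (obj_map F X))" "is_iso \<C> a"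
    using unit_is_iso[OF O(1)] uX by (auto elim: F.A.is_isoE)
  have "unit Y \<cdot>\<^bsub>\<C>\<^esub> (f \<cdot>\<^bsub>\<C>\<^esub> a) = (unit Y \<cdot>\<^bsub>\<C>\<^esub> f) \<cdot>\<^bsub>\<C>\<^esub> a"
    using F.A.comp_assoc[OF a(1) f uY] by simp
  also have "\<dots> = (arr_map G (arr_map F f) \<cdot>\<^bsub>\<C>\<^esub> unit X) \<cdot>\<^bsub>\<C>\<^esub> a"
    using unit_natural[OF f] by simp
  also have "\<dots> = arr_map G (arr_map F f)"
    using F.A.comp_assoc[OF a(1) uX GFf] a(2) F.A.ident_right[OF GFf] by simp
  finally show ?thesis using that a by simp
qed

lemma GF_isomorphic: "X \<in> Ob \<C> \<Longrightarrow> isomorphic \<C> X (obj_map G (obj_map F X))"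
  unfolding F.A.isomorphic_iff using unit_is_iso unit_Hom by blast

lemma G_counit_is_iso:
  assumes Y: "Y \<in> Ob \<D>"
  shows "is_iso \<C> (arr_map G (counit Y))"
  using F.A.is_iso_cancel[OF unit_Hom[OF G.F_Ob[OF Y]] G.F_Hom[OF counit(1)[OF Y]]
      unit_is_iso[OF G.F_Ob[OF Y]]]
    G_counit_unit[OF Y] F.A.is_iso_ident[OF G.F_Ob[OF Y]] by simp

text \<open>At a value of \<open>F\<close> the triangle identity inverts the counit; naturality
  carries this along an isomorphism to all of the essential image.\<close>

lemma counit_is_iso:
  assumes N: "N \<in> ess_image \<D> F (Ob \<C>)"
  shows "is_iso \<D> (counit N)"
proof -
  obtain X a where X: "X \<in> Ob \<C>" and a: "a \<in> Hom \<D> (obj_map F X) N" "is_iso \<D> a"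
    using N unfolding ess_image_def F.B.isomorphic_iff by blast
  have NO: "N \<in> Ob \<D>" using F.B.Hom_Ob[OF a(1)] by simp
  note FX = F.F_Ob[OF X]
  have c: "is_iso \<D> (counit (obj_map F X))"
    using F.B.is_iso_cancel[OF F.F_Hom[OF unit_Hom[OF X]] counit(1)[OF FX]
        F.F_is_iso[OF unit_is_iso[OF X] unit_Hom[OF X]]]
      counit_F_unit[OF X] F.B.is_iso_ident[OF FX] by simp
  have Ga: "arr_map G a \<in> Hom \<C> (obj_map G (obj_map F X)) (obj_map G N)" "is_iso \<C> (arr_map G a)"
    using G.F_Hom[OF a(1)] G.F_is_iso[OF a(2,1)] by auto
  show ?thesis
    using F.B.is_iso_cancel[OF F.F_Hom[OF Ga(1)] counit(1)[OF NO] F.F_is_iso[OF Ga(2,1)]]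
      counit_natural[OF a(1)] F.B.is_iso_comp[OF counit(1)[OF FX] c a] by simp
qed

text \<open>The counit is a morphism of short exact sequences onto \<open>f, g\<close>, invertible
  at both ends; exactness of the composite of \<open>G\<close> and \<open>F\<close> supplies the
  source row.\<close>

lemma ess_image_extension:
  assumes ex: "\<And>f g. short_exact \<D> f g \<Longrightarrow> short_exact \<D> (arr_map F (arr_map G f)) (arr_map F (arr_map G g))"
    and s: "short_exact \<D> f g" and f: "f \<in> Hom \<D> X Y" and g: "g \<in> Hom \<D> Y Z"
    and XZ: "X \<in> ess_image \<D> F (Ob \<C>)" "Z \<in> ess_image \<D> F (Ob \<C>)"
  shows "Y \<in> ess_image \<D> F (Ob \<C>)"
proof -
  have O: "X \<in> Ob \<D>" "Y \<in> Ob \<D>" "Z \<in> Ob \<D>" using F.B.Hom_Ob[OF f] F.B.Hom_Ob[OF g] by auto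
  note e = counit(1)[OF O(1)] counit(1)[OF O(2)] counit(1)[OF O(3)]
  have "is_iso \<D> (counit Y)"
    using F.B.five_lemma[OF ex[OF s] s F.F_Hom[OF G.F_Hom[OF f]] F.F_Hom[OF G.F_Hom[OF g]] f g
        e(1) counit_is_iso[OF XZ(1)] e(2) e(3) counit_is_iso[OF XZ(2)]
        counit_natural[OF f, symmetric] counit_natural[OF g, symmetric]] .
  then have "isomorphic \<D> (obj_map F (obj_map G Y)) Y" using F.B.isomorphic_iff e(2) by blast
  then show ?thesis using ess_imageI G.F_Ob[OF O(2)] by metis
qed

end

section \<open>Full subcategories\<close>

text \<open>This relation, unlike \<open>full_subcategory\<close>, also holds between a category and itself; a
  functor restricted on one side only is covered by the same lemmas.\<close>

definition full_in :: "('o, 'm) preadditive \<Rightarrow> ('o, 'm) preadditive \<Rightarrow> bool" where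
  "full_in \<B> \<C> \<longleftrightarrow> Ob \<B> \<subseteq> Ob \<C> \<and> Ident \<B> = Ident \<C> \<and> Comp \<B> = Comp \<C> \<and> Plus \<B> = Plus \<C> \<and>
     (\<forall>X Y. Hom \<B> X Y = {f \<in> Hom \<C> X Y. X \<in> Ob \<B> \<and> Y \<in> Ob \<B>})"

lemma full_in_full_subcategory: "S \<subseteq> Ob \<C> \<Longrightarrow> full_in (full_subcategory \<C> S) \<C>"
  by (auto simp: full_in_def Hom_def full_subcategory_def)

lemma full_in_refl: "category \<C> \<Longrightarrow> full_in \<C> \<C>"
  unfolding full_in_def using category.Hom_Ob by fastforce

lemma full_in_simps:
  assumes "full_in \<B> \<C>"
  shows "Ident \<B> = Ident \<C>" "Comp \<B> = Comp \<C>" "Plus \<B> = Plus \<C>"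
  using assms by (simp_all add: full_in_def)

lemma full_in_Ob: "full_in \<B> \<C> \<Longrightarrow> X \<in> Ob \<B> \<Longrightarrow> X \<in> Ob \<C>"
  unfolding full_in_def by blast

lemma full_in_Hom: "full_in \<B> \<C> \<Longrightarrow> f \<in> Hom \<B> X Y \<longleftrightarrow> f \<in> Hom \<C> X Y \<and> X \<in> Ob \<B> \<and> Y \<in> Ob \<B>"
  unfolding full_in_def by blast

lemma full_in_Hom_eq: "full_in \<B> \<C> \<Longrightarrow> X \<in> Ob \<B> \<Longrightarrow> Y \<in> Ob \<B> \<Longrightarrow> Hom \<B> X Y = Hom \<C> X Y"
  unfolding full_in_def by simp

lemma additive_functor_restrict:
  assumes F: "additive_functor \<C> \<D> F" and C: "full_in \<C>' \<C>" and D: "full_in \<D>' \<D>"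
    and ob: "\<And>X. X \<in> Ob \<C>' \<Longrightarrow> obj_map F X \<in> Ob \<D>'"
  shows "additive_functor \<C>' \<D>' F"
  unfolding additive_functor_def full_in_simps[OF C] full_in_simps[OF D]
    full_in_Hom[OF C] full_in_Hom[OF D] Ball_def
proof (intro conjI allI impI; (elim conjE)?)
  fix X assume X: "X \<in> Ob \<C>'"
  show "obj_map F X \<in> Ob \<D>'" using ob X .
  show "arr_map F (Ident \<C> X) = Ident \<D> (obj_map F X)"
    using F full_in_Ob[OF C X] unfolding additive_functor_def by blast
next
  fix X Y f assume f: "f \<in> Hom \<C> X Y" and X: "X \<in> Ob \<C>'" and Y: "Y \<in> Ob \<C>'"
  show "arr_map F f \<in> Hom \<D> (obj_map F X) (obj_map F Y)"
    using F f unfolding additive_functor_def by blast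
  show "obj_map F X \<in> Ob \<D>'" "obj_map F Y \<in> Ob \<D>'" using ob X Y by auto
  fix g
  show "arr_map F (f \<oplus>\<^bsub>\<C>\<^esub> g) = arr_map F f \<oplus>\<^bsub>\<D>\<^esub> arr_map F g" if "g \<in> Hom \<C> X Y"
    using F f that unfolding additive_functor_def by blast
  fix Z
  show "arr_map F (g \<cdot>\<^bsub>\<C>\<^esub> f) = arr_map F g \<cdot>\<^bsub>\<D>\<^esub> arr_map F f" if "g \<in> Hom \<C> Y Z"
    using F f that unfolding additive_functor_def by blast
qed

lemma fully_faithful_restrict:
  assumes F: "fully_faithful \<C> \<D> F" and C: "full_in \<C>' \<C>" and D: "full_in \<D>' \<D>"
    and ob: "\<And>X. X \<in> Ob \<C>' \<Longrightarrow> obj_map F X \<in> Ob \<D>'"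
  shows "fully_faithful \<C>' \<D>' F"
  unfolding fully_faithful_def
  using F ob by (simp add: fully_faithful_def full_in_Hom_eq[OF C] full_in_Hom_eq[OF D] full_in_Ob[OF C])

text \<open>Hom-sets between objects of a full subcategory are unchanged, so the same family of
  bijections serves once both functors respect the objects.\<close>

lemma adjoint_pair_restrict:
  assumes F: "adjoint_pair \<C> \<D> F G" and C: "full_in \<C>' \<C>" and D: "full_in \<D>' \<D>"
    and obF: "\<And>X. X \<in> Ob \<C>' \<Longrightarrow> obj_map F X \<in> Ob \<D>'"
    and obG: "\<And>Y. Y \<in> Ob \<D>' \<Longrightarrow> obj_map G Y \<in> Ob \<C>'"
  shows "adjoint_pair \<C>' \<D>' F G"
proof -
  obtain \<phi> where bij: "\<And>X Y. X \<in> Ob \<C> \<Longrightarrow> Y \<in> Ob \<D> \<Longrightarrow>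
      bij_betw (\<phi> X Y) (Hom \<D> (obj_map F X) Y) (Hom \<C> X (obj_map G Y))"
    and nat: "\<And>X X' Y Y' u v f. X \<in> Ob \<C> \<Longrightarrow> X' \<in> Ob \<C> \<Longrightarrow> Y \<in> Ob \<D> \<Longrightarrow> Y' \<in> Ob \<D> \<Longrightarrow>
      u \<in> Hom \<C> X' X \<Longrightarrow> v \<in> Hom \<D> Y Y' \<Longrightarrow> f \<in> Hom \<D> (obj_map F X) Y \<Longrightarrow>
      \<phi> X' Y' (v \<cdot>\<^bsub>\<D>\<^esub> (f \<cdot>\<^bsub>\<D>\<^esub> arr_map F u)) = arr_map G v \<cdot>\<^bsub>\<C>\<^esub> (\<phi> X Y f \<cdot>\<^bsub>\<C>\<^esub> u)"
    using F unfolding adjoint_pair_def by metis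
  show ?thesis
    unfolding adjoint_pair_def
  proof (intro exI[of _ \<phi>] conjI ballI)
    fix X Y assume "X \<in> Ob \<C>'" "Y \<in> Ob \<D>'"
    then show "bij_betw (\<phi> X Y) (Hom \<D>' (obj_map F X) Y) (Hom \<C>' X (obj_map G Y))"
      using bij full_in_Ob[OF C] full_in_Ob[OF D] obF obG
      by (simp add: full_in_Hom_eq[OF C] full_in_Hom_eq[OF D])
  next
    fix X X' Y Y' u v f
    assume O: "X \<in> Ob \<C>'" "X' \<in> Ob \<C>'" "Y \<in> Ob \<D>'" "Y' \<in> Ob \<D>'"
      and uvf: "u \<in> Hom \<C>' X' X" "v \<in> Hom \<D>' Y Y'" "f \<in> Hom \<D>' (obj_map F X) Y"
    have uvf': "u \<in> Hom \<C> X' X" "v \<in> Hom \<D> Y Y'" "f \<in> Hom \<D> (obj_map F X) Y"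
      using uvf by (simp_all add: full_in_Hom[OF C] full_in_Hom[OF D])
    show "\<phi> X' Y' (v \<cdot>\<^bsub>\<D>'\<^esub> (f \<cdot>\<^bsub>\<D>'\<^esub> arr_map F u)) = arr_map G v \<cdot>\<^bsub>\<C>'\<^esub> (\<phi> X Y f \<cdot>\<^bsub>\<C>'\<^esub> u)"
      unfolding full_in_simps[OF C] full_in_simps[OF D]
      by (rule nat[OF full_in_Ob[OF C O(1)] full_in_Ob[OF C O(2)] full_in_Ob[OF D O(3)]
            full_in_Ob[OF D O(4)] uvf'])
  qed
qed

lemma full_in_isomorphic:
  "full_in \<B> \<C> \<Longrightarrow> X \<in> Ob \<B> \<Longrightarrow> Y \<in> Ob \<B> \<Longrightarrow> isomorphic \<B> X Y \<longleftrightarrow> isomorphic \<C> X Y"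
  unfolding isomorphic_def by (simp add: full_in_Hom_eq full_in_Ob full_in_simps)

text \<open>The subcategory offers fewer test objects, but \<open>X\<close> itself is one of them:
  having a single endomorphism makes its identity zero, which is enough in
  \<open>\<C>\<close>.\<close>

lemma full_in_zero_object:
  assumes C: "preadditive_category \<C>" and B: "full_in \<B> \<C>" and X: "X \<in> Ob \<B>"
  shows "zero_object \<B> X \<longleftrightarrow> zero_object \<C> X"
proof
  interpret preadditive_category \<C> by (rule C)
  assume "zero_object \<B> X"
  then have "\<exists>!f. f \<in> Hom \<B> X X" using X unfolding zero_object_def by blast
  then have ex: "\<exists>!f. f \<in> Hom \<C> X X" using full_in_Hom_eq[OF B X X] by simp
  have XC: "X \<in> Ob \<C>" using full_in_Ob[OF B X] .
  show "zero_object \<C> X"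
    using ex ident_in_Hom[OF XC] zero_Hom[OF XC XC] XC zero_object_iff by blast
next
  assume "zero_object \<C> X"
  then show "zero_object \<B> X"
    using X full_in_Ob[OF B] unfolding zero_object_def by (simp add: full_in_Hom_eq[OF B])
qed


section \<open>Recollements\<close>

locale abelian_recollement =
  fixes \<A>' :: "('o1, 'm1) preadditive"
    and \<A> :: "('o, 'm) preadditive"
    and \<A>'' :: "('o2, 'm2) preadditive"
    and i_upstar :: "('o, 'm, 'o1, 'm1) ftor"
    and i_lowstar :: "('o1, 'm1, 'o, 'm) ftor"
    and i_upshriek :: "('o, 'm, 'o1, 'm1) ftor"
    and j_lowshriek :: "('o2, 'm2, 'o, 'm) ftor"
    and j_upstar :: "('o, 'm, 'o2, 'm2) ftor"
    and j_lowstar :: "('o2, 'm2, 'o, 'm) ftor"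
  assumes R: "recollement \<A>' \<A> \<A>'' i_upstar i_lowstar i_upshriek j_lowshriek j_upstar j_lowstar"
begin

lemma conditions:
  "recollement_conditions \<A>' \<A> \<A>'' i_upstar i_lowstar i_upshriek j_lowshriek j_upstar j_lowstar"
  using R by (simp add: recollement_def)

lemma zero_j_upstar_iff:
  "X \<in> Ob \<A> \<Longrightarrow> zero_object \<A>'' (obj_map j_upstar X) \<longleftrightarrow> X \<in> ess_image \<A> i_lowstar (Ob \<A>')"
  using conditions unfolding recollement_conditions_def ftor_kernel_def by blast

end

sublocale abelian_recollement \<subseteq> A': abelian_category \<A>'
  using R by (simp add: recollement_def)

sublocale abelian_recollement \<subseteq> A: abelian_category \<A>
  using R by (simp add: recollement_def)

sublocale abelian_recollement \<subseteq> A'': abelian_category \<A>''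
  using R by (simp add: recollement_def)

sublocale abelian_recollement \<subseteq> i: additive \<A>' \<A> i_lowstar
  by unfold_locales (use conditions in \<open>simp add: recollement_conditions_def\<close>)

sublocale abelian_recollement \<subseteq> j: additive \<A> \<A>'' j_upstar
  by unfold_locales (use conditions in \<open>simp add: recollement_conditions_def\<close>)

sublocale abelian_recollement \<subseteq> j_shriek: full_adjunction \<A>'' \<A> j_lowshriek j_upstar
  by unfold_locales (use conditions in \<open>simp_all add: recollement_conditions_def\<close>)

sublocale abelian_recollement \<subseteq> j_star: adjunction \<A> \<A>'' j_upstar j_lowstar
  by unfold_locales (use conditions in \<open>simp_all add: recollement_conditions_def\<close>)

sublocale abelian_recollement \<subseteq> j_star: full_additive \<A>'' \<A> j_lowstar
  by unfold_locales (use conditions in \<open>simp_all add: recollement_conditions_def\<close>)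

text \<open>Kernels are preserved because \<open>j_upstar\<close> is right adjoint to
  \<open>j_lowshriek\<close>, cokernels because it is left adjoint to
  \<open>j_lowstar\<close>.\<close>

sublocale abelian_recollement \<subseteq> j: exact_additive \<A> \<A>'' j_upstar
  by unfold_locales
    (rule j_shriek.right_adjoint_preserves_kernels j_star.left_adjoint_preserves_cokernels)+

sublocale abelian_recollement \<subseteq> i_star: adjunction \<A> \<A>' i_upstar i_lowstar
  by unfold_locales (use conditions in \<open>simp_all add: recollement_conditions_def\<close>)

sublocale abelian_recollement \<subseteq> i_shriek: adjunction \<A>' \<A> i_lowstar i_upshriek
  by unfold_locales (use conditions in \<open>simp_all add: recollement_conditions_def\<close>)

text \<open>\<open>i_lowstar\<close> is exact for the same reason: it stands between its left
  adjoint \<open>i_upstar\<close> and its right adjoint \<open>i_upshriek\<close>.\<close>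

sublocale abelian_recollement \<subseteq> i: exact_full_additive \<A>' \<A> i_lowstar
  by unfold_locales
    (use conditions in \<open>simp add: recollement_conditions_def
        i_star.right_adjoint_preserves_kernels i_shriek.left_adjoint_preserves_cokernels\<close>)+

section \<open>ICE-closed subcategories in a recollement\<close>

context abelian_recollement
begin

lemma ICE_closed_i_lowstar:
  assumes C: "ICE_closed \<A>' C"
  shows "ICE_closed \<A> (ess_image \<A> i_lowstar C)"
proof (rule i.ICE_closed_ess_image[OF C])
  fix X Y Z f g
  assume s: "short_exact \<A> f g" and f: "f \<in> Hom \<A> X Y" and g: "g \<in> Hom \<A> Y Z"
    and XZ: "X \<in> ess_image \<A> i_lowstar (Ob \<A>')" "Z \<in> ess_image \<A> i_lowstar (Ob \<A>')"
  have O: "X \<in> Ob \<A>" "Y \<in> Ob \<A>" "Z \<in> Ob \<A>" using A.Hom_Ob[OF f] A.Hom_Ob[OF g] by auto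
  have z: "zero_object \<A>'' (obj_map j_upstar X)" "zero_object \<A>'' (obj_map j_upstar Z)"
    using XZ O zero_j_upstar_iff by auto
  have "zero_object \<A>'' (obj_map j_upstar Y)"
    by (rule A''.short_exact_zero_ends[OF j.F_short_exact[OF s] j.F_Hom[OF f] j.F_Hom[OF g] z])
  then show "Y \<in> ess_image \<A> i_lowstar (Ob \<A>')" using zero_j_upstar_iff O by blast
qed

lemma ICE_closed_j_lowshriek:
  assumes ex: "exact_functor \<A>'' \<A> j_lowshriek" and C: "ICE_closed \<A>'' C"
  shows "ICE_closed \<A> (ess_image \<A> j_lowshriek C)"
proof -
  interpret js: exact_full_additive \<A>'' \<A> j_lowshriek
    by unfold_locales (rule j_shriek.F.exact_functor_preserves[OF ex])+
  show ?thesis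
    by (rule js.ICE_closed_ess_image[OF C], rule j_shriek.ess_image_extension)
      (rule js.F_short_exact, erule j.F_short_exact)
qed

lemma ICE_closed_j_lowstar:
  assumes ex: "exact_functor \<A>'' \<A> j_lowstar" and C: "ICE_closed \<A>'' C"
  shows "ICE_closed \<A> (ess_image \<A> j_lowstar C)"
proof -
  interpret js: exact_full_additive \<A>'' \<A> j_lowstar
    by unfold_locales (rule j_star.G.exact_functor_preserves[OF ex])+
  have op: "full_adjunction (opposite \<A>'') (opposite \<A>) j_lowstar j_upstar"
    using j_star.op_adjunction j_star.op_full_additive by (rule full_adjunction.intro)
  show ?thesis
  proof (rule js.ICE_closed_ess_image[OF C])
    fix X Y Z f g
    assume "short_exact \<A> f g" "f \<in> Hom \<A> X Y" "g \<in> Hom \<A> Y Z"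
      "X \<in> ess_image \<A> j_lowstar (Ob \<A>'')" "Z \<in> ess_image \<A> j_lowstar (Ob \<A>'')"
    then show "Y \<in> ess_image \<A> j_lowstar (Ob \<A>'')"
      using full_adjunction.ess_image_extension[OF op, of g f Z Y X] js.F_short_exact[OF j.F_short_exact]
      by (simp add: A.short_exact_opposite)
  qed
qed

lemma j_upstar_j_lowshriek: "Y \<in> Ob \<A>'' \<Longrightarrow> isomorphic \<A>'' (obj_map j_upstar (obj_map j_lowshriek Y)) Y"
  using j_shriek.GF_isomorphic A''.isomorphic_sym by blast

lemma j_upstar_j_lowstar:
  assumes Y: "Y \<in> Ob \<A>''"
  shows "isomorphic \<A>'' (obj_map j_upstar (obj_map j_lowstar Y)) Y"
proof -
  have op: "full_adjunction (opposite \<A>'') (opposite \<A>) j_lowstar j_upstar"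
    using j_star.op_adjunction j_star.op_full_additive by (rule full_adjunction.intro)
  show ?thesis using full_adjunction.GF_isomorphic[OF op, of Y] Y A''.isomorphic_sym by simp
qed

lemma preimage_ess_image:
  assumes C: "ICE_closed \<A> C" and i: "ess_image \<A> i_lowstar (Ob \<A>') \<subseteq> C"
    and j: "ess_image \<A> j_lowshriek (ess_image \<A>'' j_upstar C) \<subseteq> C"
  shows "{X \<in> Ob \<A>. obj_map j_upstar X \<in> ess_image \<A>'' j_upstar C} = C" (is "?P = C")
proof
  have CO: "C \<subseteq> Ob \<A>" using C by (simp add: ICE_closed_def replete_subcategory_def)
  then show "C \<subseteq> ?P" using j.F_in_ess_image by blast
  show "?P \<subseteq> C"
  proof
    fix X assume "X \<in> ?P"
    then have X: "X \<in> Ob \<A>" and jX: "obj_map j_upstar X \<in> ess_image \<A>'' j_upstar C" by auto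
    let ?e = "j_shriek.counit X"
    note e = j_shriek.counit(1)[OF X]
    \<comment> \<open>The unit is invertible since \<open>j_lowshriek\<close> is fully faithful, and
      the triangle identity passes this on to \<open>j_upstar\<close> of the counit. Being exact,
      \<open>j_upstar\<close> then kills the kernel and the cokernel.\<close>
    note je = j_shriek.G_counit_is_iso[OF X]
    have eA: "?e \<in> Arr \<A>" using e by (simp add: Hom_def)
    obtain k c where k: "is_kernel \<A> ?e k" and c: "is_cokernel \<A> ?e c"
      using A.has_kernels[OF eA] A.has_cokernels[OF eA] by blast
    have kA: "k \<in> Arr \<A>" and cA: "c \<in> Arr \<A>" using k c by (auto simp: is_kernel_def is_cokernel_def)
    have zk: "zero_object \<A>'' (obj_map j_upstar (Dom \<A> k))"
      using A''.kernel_of_monic_zero[OF j.F_kernel[OF k] A''.is_iso_monic[OF je]] j.F_Dom[OF kA] by simp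
    have zc: "zero_object \<A>'' (obj_map j_upstar (Cod \<A> c))"
      using A''.cokernel_of_epic_zero[OF j.F_cokernel[OF c] A''.is_iso_epic[OF je]] j.F_Cod[OF cA] by simp
    have "Dom \<A> k \<in> C" "Cod \<A> c \<in> C"
      using zk zc zero_j_upstar_iff A.dom_in_Ob[OF kA] A.cod_in_Ob[OF cA] i by auto
    \<comment> \<open>\<open>X\<close> is not known to be in \<open>C\<close>, but
      \<open>obj_map j_upstar X\<close> lies in the essential image of \<open>C\<close>, to which
      the hypothesis on \<open>j_lowshriek\<close> applies.\<close>
    moreover have "obj_map j_lowshriek (obj_map j_upstar X) \<in> C"
      using j_shriek.F.F_in_ess_image[OF j.F_Ob[OF X] jX] j by blast
    ultimately show "X \<in> C" using A.ICE_closed_codomain[OF C e k c] by blast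
  qed
qed

text \<open>Everything is lifted along \<open>j_lowshriek\<close>, treated in the preimage and
  brought back by \<open>j_upstar\<close>. For extensions the lift of \<open>f\<close> may fail to
  be monic, but \<open>j_upstar\<close> kills its kernel, which therefore lies in the preimage;
  \<open>ICE_closed_codomain\<close> replaces the missing short exact sequence.\<close>

lemma ICE_closed_of_preimage:
  assumes rep: "replete_subcategory \<A>'' D"
    and P: "ICE_closed \<A> {X \<in> Ob \<A>. obj_map j_upstar X \<in> D}" (is "ICE_closed \<A> ?P")
    and i: "ess_image \<A> i_lowstar (Ob \<A>') \<subseteq> {X \<in> Ob \<A>. obj_map j_upstar X \<in> D}"
  shows "ICE_closed \<A>'' D"
proof -
  have DO: "D \<subseteq> Ob \<A>''" using rep by (simp add: replete_subcategory_def)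
  have iso: "Y \<in> D" if "X \<in> D" "isomorphic \<A>'' X Y" for X Y
    using rep that unfolding replete_subcategory_def by blast
  have lift: "obj_map j_lowshriek Y \<in> ?P" if "Y \<in> D" for Y
    using iso[OF that] j_shriek.GF_isomorphic j_shriek.F.F_Ob that DO by blast
  have im: "Dom \<A>'' m \<in> D"
    if MN: "M \<in> D" "N \<in> D" and f: "f \<in> Hom \<A>'' M N" and m: "is_image \<A>'' f m" for M N f m
  proof -
    have O: "M \<in> Ob \<A>''" "N \<in> Ob \<A>''" using MN DO by auto
    note Ff = j_shriek.F.F_Hom[OF f]
    have FfA: "arr_map j_lowshriek f \<in> Arr \<A>" "Dom \<A> (arr_map j_lowshriek f) = obj_map j_lowshriek M"
      "Cod \<A> (arr_map j_lowshriek f) = obj_map j_lowshriek N" using Ff by (auto simp: Hom_def)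
    obtain n where n: "is_image \<A> (arr_map j_lowshriek f) n" using A.has_images[OF FfA(1)] .
    have nA: "n \<in> Arr \<A>" using A.is_image_Hom[OF n Ff] by (simp add: Hom_def)
    have nP: "obj_map j_upstar (Dom \<A> n) \<in> D"
      using A.ICE_closed_image[OF P n] FfA lift[OF MN(1)] lift[OF MN(2)] by simp
    note uN = j_shriek.unit_Hom[OF O(2)]
    obtain a where a: "a \<in> Hom \<A>'' (obj_map j_upstar (obj_map j_lowshriek M)) M" "is_iso \<A>'' a"
      "arr_map j_upstar (arr_map j_lowshriek f) = j_shriek.unit N \<cdot>\<^bsub>\<A>''\<^esub> (f \<cdot>\<^bsub>\<A>''\<^esub> a)"
      by (rule j_shriek.GF_conjugate[OF f])
    obtain b where b: "b \<in> Hom \<A>'' (obj_map j_upstar (obj_map j_lowshriek N)) N"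
      "b \<cdot>\<^bsub>\<A>''\<^esub> j_shriek.unit N = Ident \<A>'' N"
      "j_shriek.unit N \<cdot>\<^bsub>\<A>''\<^esub> b = Ident \<A>'' (obj_map j_upstar (obj_map j_lowshriek N))"
      using j_shriek.unit_is_iso[OF O(2)] uN by (auto elim: A''.is_isoE)
    \<comment> \<open>The image \<open>n\<close> is taken in \<open>\<A>\<close>, as
      \<open>j_lowshriek\<close> need not preserve images. Exactness of \<open>j_upstar\<close>
      sends it to an image of a conjugate of \<open>f\<close>.\<close>
    have "is_image \<A>'' (arr_map j_upstar (arr_map j_lowshriek f)) (j_shriek.unit N \<cdot>\<^bsub>\<A>''\<^esub> m)"
      using A''.is_image_conjugate[OF m f a(1,2) uN b] a(3) by simp
    then have "isomorphic \<A>'' (Dom \<A>'' (arr_map j_upstar n)) (Dom \<A>'' (j_shriek.unit N \<cdot>\<^bsub>\<A>''\<^esub> m))"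
      using A''.is_image_unique_obj[OF j.F_image[OF n]] by blast
    moreover have "Dom \<A>'' (j_shriek.unit N \<cdot>\<^bsub>\<A>''\<^esub> m) = Dom \<A>'' m"
      using A''.comp_in_Hom[OF A''.is_image_Hom[OF m f] uN] by (simp add: Hom_def)
    ultimately show ?thesis using iso nP j.F_Dom[OF nA] by simp
  qed
  have coker: "Cod \<A>'' c \<in> D"
    if MN: "M \<in> D" "N \<in> D" and f: "f \<in> Hom \<A>'' M N" and c: "is_cokernel \<A>'' f c" for M N f c
  proof -
    note C = A''.is_cokernelD(1)[OF c f]
    have fA: "Dom \<A>'' f = M" "Cod \<A>'' f = N" using f by (auto simp: Hom_def)
    \<comment> \<open>A left adjoint preserves cokernels, so \<open>c\<close> itself can be lifted
      and no conjugation occurs.\<close>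
    have "is_cokernel \<A> (arr_map j_lowshriek f) (arr_map j_lowshriek c)"
      using j_shriek.left_adjoint_preserves_cokernels c unfolding preserves_kernels_def by simp
    then have "Cod \<A> (arr_map j_lowshriek c) \<in> ?P"
      using A.ICE_closed_cokernel[OF P] lift[OF MN(1)] lift[OF MN(2)] j_shriek.F.F_Hom[OF f]
      by (simp add: Hom_def)
    then have "obj_map j_upstar (obj_map j_lowshriek (Cod \<A>'' c)) \<in> D"
      using j_shriek.F.F_Hom[OF C] by (simp add: Hom_def)
    then show ?thesis using iso j_upstar_j_lowshriek A''.Hom_Ob[OF C] by blast
  qed
  have ext: "Y \<in> D"
    if f: "f \<in> Hom \<A>'' X Y" and g: "g \<in> Hom \<A>'' Y Z" and s: "short_exact \<A>'' f g"
      and XZ: "X \<in> D" "Z \<in> D" for X Y Z f g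
  proof -
    note Ff = j_shriek.F.F_Hom[OF f] and Fg = j_shriek.F.F_Hom[OF g]
    have c: "is_cokernel \<A> (arr_map j_lowshriek f) (arr_map j_lowshriek g)"
      using j_shriek.left_adjoint_preserves_cokernels s A''.short_exact_iff
      unfolding preserves_kernels_def by simp
    obtain k where k: "is_kernel \<A> (arr_map j_lowshriek f) k"
      using A.has_kernels Ff by (auto simp: Hom_def)
    have kA: "k \<in> Arr \<A>" using k by (simp add: is_kernel_def)
    have O: "X \<in> Ob \<A>''" "Y \<in> Ob \<A>''" using A''.Hom_Ob[OF f] by auto
    obtain a where a: "a \<in> Hom \<A>'' (obj_map j_upstar (obj_map j_lowshriek X)) X" "is_iso \<A>'' a"
      "arr_map j_upstar (arr_map j_lowshriek f) = j_shriek.unit Y \<cdot>\<^bsub>\<A>''\<^esub> (f \<cdot>\<^bsub>\<A>''\<^esub> a)"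
      by (rule j_shriek.GF_conjugate[OF f])
    \<comment> \<open>\<open>a(3)\<close> exhibits the result of applying both functors as
      \<open>f\<close> between two isomorphisms, hence monic although the lift of \<open>f\<close>
      need not be.\<close>
    have "monic \<A>'' f" using s by (simp add: short_exact_def)
    from A''.monic_comp[OF a(1) A''.is_iso_monic[OF a(2)] f this]
    have "monic \<A>'' (arr_map j_upstar (arr_map j_lowshriek f))"
      unfolding a(3)
      by (rule A''.monic_comp[OF A''.comp_in_Hom[OF a(1) f] _ j_shriek.unit_Hom[OF O(2)]
            A''.is_iso_monic[OF j_shriek.unit_is_iso[OF O(2)]]])
    then have "zero_object \<A>'' (obj_map j_upstar (Dom \<A> k))"
      using A''.kernel_of_monic_zero[OF j.F_kernel[OF k]] j.F_Dom[OF kA] by simp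
    then have "Dom \<A> k \<in> ?P" using zero_j_upstar_iff A.dom_in_Ob[OF kA] i by blast
    moreover have "Cod \<A> (arr_map j_lowshriek g) = obj_map j_lowshriek Z" using Fg by (simp add: Hom_def)
    ultimately have "obj_map j_lowshriek Y \<in> ?P"
      using A.ICE_closed_codomain[OF P Ff k c] lift[OF XZ(1)] lift[OF XZ(2)] by simp
    then show ?thesis using iso j_upstar_j_lowshriek[OF O(2)] by blast
  qed
  show ?thesis
    unfolding ICE_closed_def
  proof (intro conjI allI ballI impI)
    fix X Y Z f g assume "f \<in> Hom \<A>'' X Y" "g \<in> Hom \<A>'' Y Z" "short_exact \<A>'' f g \<and> X \<in> D \<and> Z \<in> D"
    then show "Y \<in> D" using ext[of f X Y g Z] by blast
  qed (use rep im coker in blast)+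
qed

lemma ICE_closed_ess_image_j_upstar:
  assumes C: "ICE_closed \<A> C" and i: "ess_image \<A> i_lowstar (Ob \<A>') \<subseteq> C"
    and j: "ess_image \<A> j_lowshriek (ess_image \<A>'' j_upstar C) \<subseteq> C"
  shows "ICE_closed \<A>'' (ess_image \<A>'' j_upstar C)"
  using ICE_closed_of_preimage[OF A''.ess_image_replete, of j_upstar C] C i preimage_ess_image[OF C i j] by simp

text \<open>\<open>j_upstar\<close> is essentially surjective: the object
  \<open>obj_map j_lowshriek Y\<close> is sent to \<open>Y\<close> up to isomorphism.\<close>

lemma ess_image_preimage:
  assumes D: "replete_subcategory \<A>'' D"
  shows "ess_image \<A>'' j_upstar {X \<in> Ob \<A>. obj_map j_upstar X \<in> D} = D"
proof
  have DO: "D \<subseteq> Ob \<A>''" using D by (simp add: replete_subcategory_def)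
  have iso: "Y \<in> D" if "X \<in> D" "isomorphic \<A>'' X Y" for X Y
    using D that unfolding replete_subcategory_def by blast
  show "ess_image \<A>'' j_upstar {X \<in> Ob \<A>. obj_map j_upstar X \<in> D} \<subseteq> D"
    unfolding ess_image_def using iso by blast
  show "D \<subseteq> ess_image \<A>'' j_upstar {X \<in> Ob \<A>. obj_map j_upstar X \<in> D}"
  proof
    fix Y assume Y: "Y \<in> D"
    then have YO: "Y \<in> Ob \<A>''" using DO by blast
    have "obj_map j_upstar (obj_map j_lowshriek Y) \<in> D"
      using iso[OF Y j_shriek.GF_isomorphic[OF YO]] .
    then have "obj_map j_lowshriek Y \<in> {X \<in> Ob \<A>. obj_map j_upstar X \<in> D}"
      using j_shriek.F.F_Ob[OF YO] by simp
    then show "Y \<in> ess_image \<A>'' j_upstar {X \<in> Ob \<A>. obj_map j_upstar X \<in> D}"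
      using j_upstar_j_lowshriek[OF YO] by (rule ess_imageI)
  qed
qed

lemma bij_betw_ess_image_j_upstar:
  "bij_betw (\<lambda>C. ess_image \<A>'' j_upstar C)
     {C. ICE_closed \<A> C \<and> ess_image \<A> i_lowstar (Ob \<A>') \<subseteq> C \<and>
         ess_image \<A> j_lowshriek (ess_image \<A>'' j_upstar C) \<subseteq> C}
     {D. ICE_closed \<A>'' D \<and> D \<noteq> {}}"
proof (rule bij_betwI[where g = "\<lambda>D. {X \<in> Ob \<A>. obj_map j_upstar X \<in> D}"])
  show "ess_image \<A>'' j_upstar \<in>
    {C. ICE_closed \<A> C \<and> ess_image \<A> i_lowstar (Ob \<A>') \<subseteq> C \<and>
      ess_image \<A> j_lowshriek (ess_image \<A>'' j_upstar C) \<subseteq> C} \<rightarrow> {D. ICE_closed \<A>'' D \<and> D \<noteq> {}}"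
    using ICE_closed_ess_image_j_upstar ess_image_j_upstar_nonempty[OF R] by blast
  show "{X \<in> Ob \<A>. obj_map j_upstar X \<in> ess_image \<A>'' j_upstar C} = C"
    if "C \<in> {C. ICE_closed \<A> C \<and> ess_image \<A> i_lowstar (Ob \<A>') \<subseteq> C \<and>
      ess_image \<A> j_lowshriek (ess_image \<A>'' j_upstar C) \<subseteq> C}" for C
    using that preimage_ess_image by blast
  fix D assume "D \<in> {D. ICE_closed \<A>'' D \<and> D \<noteq> {}}"
  then have D: "ICE_closed \<A>'' D" "D \<noteq> {}" by auto
  then have rep: "replete_subcategory \<A>'' D" by (simp add: ICE_closed_def)
  show "ess_image \<A>'' j_upstar {X \<in> Ob \<A>. obj_map j_upstar X \<in> D} = D"
    by (rule ess_image_preimage[OF rep])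
next
  show "(\<lambda>D. {X \<in> Ob \<A>. obj_map j_upstar X \<in> D}) \<in> {D. ICE_closed \<A>'' D \<and> D \<noteq> {}} \<rightarrow>
    {C. ICE_closed \<A> C \<and> ess_image \<A> i_lowstar (Ob \<A>') \<subseteq> C \<and>
      ess_image \<A> j_lowshriek (ess_image \<A>'' j_upstar C) \<subseteq> C}"
  proof (intro Pi_I CollectI conjI)
    fix D assume "D \<in> {D. ICE_closed \<A>'' D \<and> D \<noteq> {}}"
    then have D: "ICE_closed \<A>'' D" "D \<noteq> {}" by auto
    then have rep: "replete_subcategory \<A>'' D" by (simp add: ICE_closed_def)
    let ?P = "{X \<in> Ob \<A>. obj_map j_upstar X \<in> D}"
    show P: "ICE_closed \<A> ?P" by (rule j.ICE_closed_preimage[OF D(1)])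
    show "ess_image \<A> i_lowstar (Ob \<A>') \<subseteq> ?P"
    proof
      fix X assume X: "X \<in> ess_image \<A> i_lowstar (Ob \<A>')"
      then have "X \<in> Ob \<A>" by (simp add: ess_image_def)
      \<comment> \<open>\<open>j_upstar\<close> sends \<open>X\<close> to a zero object, and
        \<open>D\<close>, being nonempty, contains all of these.\<close>
      then show "X \<in> ?P" using A''.ICE_closed_zero[OF D] zero_j_upstar_iff X by blast
    qed
    show "ess_image \<A> j_lowshriek (ess_image \<A>'' j_upstar ?P) \<subseteq> ?P"
      unfolding ess_image_preimage[OF rep]
    proof
      fix X assume "X \<in> ess_image \<A> j_lowshriek D"
      then obtain Y where Y: "Y \<in> D" "isomorphic \<A> (obj_map j_lowshriek Y) X"
        unfolding ess_image_def by blast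
      have "Y \<in> Ob \<A>''" using rep Y(1) unfolding replete_subcategory_def by blast
      then have "isomorphic \<A>'' Y (obj_map j_upstar X)"
        using A''.isomorphic_trans[OF j_shriek.GF_isomorphic j.F_isomorphic[OF Y(2)]] by blast
      then have "obj_map j_upstar X \<in> D" using A''.ICE_closed_replete[OF D(1) _ Y(1)] by blast
      moreover have "X \<in> Ob \<A>" using Y(2) by (simp add: isomorphic_def)
      ultimately show "X \<in> ?P" by blast
    qed
  qed
qed

text \<open>Adjunctions and full faithfulness restrict to full subcategories once the functors
  respect objects, so the content lies in \<open>o1\<close> to \<open>o6\<close> and in the
  comparison of kernels.\<close>

lemma ICE_recollement:
  assumes C: "ICE_closed \<A> C" and i: "ess_image \<A> i_lowstar (Ob \<A>') \<subseteq> C"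
    and j: "ess_image \<A> j_lowshriek (ess_image \<A>'' j_upstar C) \<subseteq> C"
  shows "ICE_recollement \<A>' \<A> \<A>'' i_upstar i_lowstar i_upshriek j_lowshriek j_upstar j_lowstar C"
proof -
  let ?D = "ess_image \<A>'' j_upstar C"
  let ?B = "full_subcategory \<A> C" and ?B'' = "full_subcategory \<A>'' ?D"
  have CO: "C \<subseteq> Ob \<A>" using C by (simp add: ICE_closed_def replete_subcategory_def)
  have DO: "?D \<subseteq> Ob \<A>''" by (auto simp: ess_image_def)
  note P = preimage_ess_image[OF C i j]
  have B: "full_in ?B \<A>" and B'': "full_in ?B'' \<A>''" and A': "full_in \<A>' \<A>'"
    using full_in_full_subcategory[OF CO] full_in_full_subcategory[OF DO]
      full_in_refl[OF A'.category_axioms] by auto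
  have Ob: "Ob ?B = C" "Ob ?B'' = ?D" by (simp_all add: full_subcategory_def)
  have o1: "X \<in> Ob ?B \<Longrightarrow> obj_map i_upstar X \<in> Ob \<A>'" for X
    using i_star.F.F_Ob CO Ob by auto
  have o2: "X \<in> Ob \<A>' \<Longrightarrow> obj_map i_lowstar X \<in> Ob ?B" for X
    using i.F_in_ess_image[of X "Ob \<A>'"] i Ob by auto
  have o3: "X \<in> Ob ?B \<Longrightarrow> obj_map i_upshriek X \<in> Ob \<A>'" for X
    using i_shriek.G.F_Ob CO Ob by auto
  have o4: "Y \<in> Ob ?B'' \<Longrightarrow> obj_map j_lowshriek Y \<in> Ob ?B" for Y
    using j_shriek.F.F_in_ess_image[of Y ?D] DO j Ob by auto
  have o5: "X \<in> Ob ?B \<Longrightarrow> obj_map j_upstar X \<in> Ob ?B''" for X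
    using j.F_in_ess_image[of X C] CO Ob by auto
  \<comment> \<open>No hypothesis mentions \<open>j_lowstar\<close>. But \<open>C\<close> is a full
    preimage by \<open>P\<close>, so it suffices that \<open>j_upstar\<close> brings the object back
    to \<open>Y\<close> up to isomorphism.\<close>
  have o6: "obj_map j_lowstar Y \<in> Ob ?B" if "Y \<in> Ob ?B''" for Y
  proof -
    have Y: "Y \<in> ?D" "Y \<in> Ob \<A>''" using that Ob DO by auto
    have "obj_map j_upstar (obj_map j_lowstar Y) \<in> ?D"
      using A''.ICE_closed_replete[OF ICE_closed_ess_image_j_upstar[OF C i j]]
        A''.isomorphic_sym[OF j_upstar_j_lowstar[OF Y(2)]] Y(1) by blast
    then show ?thesis using P j_star.G.F_Ob[OF Y(2)] Ob by blast
  qed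
  \<comment> \<open>Zero objects and isomorphisms between members are the same in a full subcategory
    as in the ambient category, so the kernel condition can be checked there.\<close>
  have "zero_object ?B'' (obj_map j_upstar X) \<longleftrightarrow> X \<in> ess_image ?B i_lowstar (Ob \<A>')" if X: "X \<in> C" for X
  proof -
    have XB: "X \<in> Ob ?B" and XO: "X \<in> Ob \<A>" using X CO Ob by auto
    have "zero_object ?B'' (obj_map j_upstar X) \<longleftrightarrow> X \<in> ess_image \<A> i_lowstar (Ob \<A>')"
      using full_in_zero_object[OF A''.preadditive_category_axioms B'' o5[OF XB]]
        zero_j_upstar_iff[OF XO] by simp
    also have "\<dots> \<longleftrightarrow> X \<in> ess_image ?B i_lowstar (Ob \<A>')"
      unfolding ess_image_def using full_in_isomorphic[OF B o2 XB] XB XO by blast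
    finally show ?thesis .
  qed
  then have ker: "ftor_kernel ?B ?B'' j_upstar = ess_image ?B i_lowstar (Ob \<A>')"
    unfolding ftor_kernel_def using Ob by (auto simp: ess_image_def)
  have "recollement_conditions \<A>' ?B ?B'' i_upstar i_lowstar i_upshriek j_lowshriek j_upstar j_lowstar"
    unfolding recollement_conditions_def
  proof (intro conjI ker)
    show "additive_functor ?B \<A>' i_upstar"
      by (rule additive_functor_restrict[OF i_star.F.F B A' o1])
    show "additive_functor \<A>' ?B i_lowstar"
      by (rule additive_functor_restrict[OF i.F A' B o2])
    show "additive_functor ?B \<A>' i_upshriek"
      by (rule additive_functor_restrict[OF i_shriek.G.F B A' o3])
    show "additive_functor ?B'' ?B j_lowshriek"
      by (rule additive_functor_restrict[OF j_shriek.F.F B'' B o4])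
    show "additive_functor ?B ?B'' j_upstar"
      by (rule additive_functor_restrict[OF j.F B B'' o5])
    show "additive_functor ?B'' ?B j_lowstar"
      by (rule additive_functor_restrict[OF j_star.G.F B'' B o6])
    show "adjoint_pair ?B \<A>' i_upstar i_lowstar"
      by (rule adjoint_pair_restrict[OF i_star.adj B A' o1 o2])
    show "adjoint_pair \<A>' ?B i_lowstar i_upshriek"
      by (rule adjoint_pair_restrict[OF i_shriek.adj A' B o2 o3])
    show "adjoint_pair ?B'' ?B j_lowshriek j_upstar"
      by (rule adjoint_pair_restrict[OF j_shriek.adj B'' B o4 o5])
    show "adjoint_pair ?B ?B'' j_upstar j_lowstar"
      by (rule adjoint_pair_restrict[OF j_star.adj B B'' o5 o6])
    show "fully_faithful \<A>' ?B i_lowstar"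
      by (rule fully_faithful_restrict[OF i.ff A' B o2])
    show "fully_faithful ?B'' ?B j_lowshriek"
      by (rule fully_faithful_restrict[OF j_shriek.ff B'' B o4])
    show "fully_faithful ?B'' ?B j_lowstar"
      by (rule fully_faithful_restrict[OF j_star.ff B'' B o6])
  qed
  then show ?thesis
    unfolding ICE_recollement_def using ICE_closed_ess_image_j_upstar[OF C i j] by blast
qed

end

theorem theorem1p1:
  fixes \<A>' :: "('o1, 'm1) preadditive"
    and \<A> :: "('o, 'm) preadditive"
    and \<A>'' :: "('o2, 'm2) preadditive"
    and i_upstar :: "('o, 'm, 'o1, 'm1) ftor"
    and i_lowstar :: "('o1, 'm1, 'o, 'm) ftor"
    and i_upshriek :: "('o, 'm, 'o1, 'm1) ftor"
    and j_lowshriek :: "('o2, 'm2, 'o, 'm) ftor"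
    and j_upstar :: "('o, 'm, 'o2, 'm2) ftor"
    and j_lowstar :: "('o2, 'm2, 'o, 'm) ftor"
  assumes "recollement \<A>' \<A> \<A>'' i_upstar i_lowstar i_upshriek j_lowshriek j_upstar j_lowstar"
  shows
    "(\<forall>C. ICE_closed \<A>' C \<longrightarrow> ICE_closed \<A> (ess_image \<A> i_lowstar C)) \<and>
     (exact_functor \<A>'' \<A> j_lowstar \<longrightarrow>
        (\<forall>C. ICE_closed \<A>'' C \<longrightarrow> ICE_closed \<A> (ess_image \<A> j_lowstar C))) \<and>
     (exact_functor \<A>'' \<A> j_lowshriek \<longrightarrow>
        (\<forall>C. ICE_closed \<A>'' C \<longrightarrow> ICE_closed \<A> (ess_image \<A> j_lowshriek C))) \<and>
     bij_betw (\<lambda>C. ess_image \<A>'' j_upstar C)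
       {C. ICE_closed \<A> C \<and> ess_image \<A> i_lowstar (Ob \<A>') \<subseteq> C \<and>
           ess_image \<A> j_lowshriek (ess_image \<A>'' j_upstar C) \<subseteq> C}
       {D. ICE_closed \<A>'' D \<and> D \<noteq> {}} \<and>
     (\<forall>C. ICE_closed \<A> C \<and> ess_image \<A> i_lowstar (Ob \<A>') \<subseteq> C \<and>
          ess_image \<A> j_lowshriek (ess_image \<A>'' j_upstar C) \<subseteq> C \<longrightarrow>
        ICE_recollement \<A>' \<A> \<A>'' i_upstar i_lowstar i_upshriek j_lowshriek j_upstar j_lowstar C)"
proof -
  interpret abelian_recollement \<A>' \<A> \<A>'' i_upstar i_lowstar i_upshriek j_lowshriek j_upstar j_lowstar
    by (rule abelian_recollement.intro[OF assms])
  show ?thesis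
    using ICE_closed_i_lowstar ICE_closed_j_lowstar ICE_closed_j_lowshriek
      bij_betw_ess_image_j_upstar ICE_recollement by blast
qed

end
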